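(* If the real number $\beta>0$ is badly approximable, then $$\lambda(\mathcal{A}(\bm{a}(\beta)))=\lambda(\mathcal{A}(\bm{b}(\beta)))=1.$$
   Context: The index $p$ runs over primes; $n_p\geq1$ is the integer such that $p$ is the $n_p$-th prime in increasing order ($n_p=\pi(p)$). For an integer $n$ and a prime $p$, $n \pmod p$ denotes the unique integer in $\{0,\ldots,p-1\}$ congruent to $n$ modulo $p$. For a real number $\beta>0$, the sequences $\bm{a}(\beta)=(a_p(\beta))_p$ and $\bm{b}(\beta)=(b_p(\beta))_p$ are $$a_p(\beta)=\lfloor\beta p n_p\rfloor \pmod p,\qquad b_p(\beta)=\lfloor\beta p^2\rfloor\pmod p.$$ For a sequence $\bm{a}=(a_p)_p$ of integers with $0\leq a_p<p$, $\mathcal{A}(\bm{a})=\{x\in[0,1] : \liminf_{p\to\infty}p|x-a_p/p|=0\}$. $\lambda$ is Lebesgue measure on $[0,1]$. A real number $\beta$ is badly approximable if there exists $c=c(\beta)>0$ such that $|\beta-\frac{a}{q}|>\frac{c}{q^2}$ for all integers $a$ and $q\geq1$. *)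

theory Defs
  imports "HOL-Analysis.Analysis" "HOL-Computational_Algebra.Primes"
begin

definition badly_approximable :: "real \<Rightarrow> bool" where
  "badly_approximable \<beta> \<longleftrightarrow>
     (\<exists>c>0. \<forall>a q :: int. q \<ge> 1 \<longrightarrow>
        \<bar>\<beta> - real_of_int a / real_of_int q\<bar> > c / (real_of_int q)\<^sup>2)"

definition prime_index :: "nat \<Rightarrow> nat" where
  "prime_index p = card {q :: nat. prime q \<and> q \<le> p}"

text \<open>
  Sequences indexed by primes are functions on \<^typ>\<open>nat\<close> of which only the values at primes
  matter: limits along the primes are taken with respect to the following filter.
\<close>

definition primes_at_top :: "nat filter" where
  "primes_at_top = inf at_top (principal {p. prime p})"

definition seq_a :: "real \<Rightarrow> nat \<Rightarrow> int" where
  "seq_a \<beta> p = \<lfloor>\<beta> * real p * real (prime_index p)\<rfloor> mod int p"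

definition seq_b :: "real \<Rightarrow> nat \<Rightarrow> int" where
  "seq_b \<beta> p = \<lfloor>\<beta> * (real p)\<^sup>2\<rfloor> mod int p"

text \<open>
  The lower limit is taken in the extended reals, so that it exists without any boundedness
  assumption.
\<close>

definition approximable_points :: "(nat \<Rightarrow> int) \<Rightarrow> real set" where
  "approximable_points a =
     {x \<in> {0..1}. Liminf primes_at_top
        (\<lambda>p. ereal (real p * \<bar>x - real_of_int (a p) / real p\<bar>)) = 0}"

end

theory Submission
  imports Defs
    "HOL-Computational_Algebra.Squarefree"
    "HOL-Number_Theory.Prime_Powers"
    "HOL-Number_Theory.Totient"
    "HOL-Real_Asymp.Real_Asymp"
begin

text \<open>
  Consider the balls of radius \<open>\<epsilon> / p\<close> around the points \<open>a p / p\<close>. Within every interval \<open>J\<close>, the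
  Chung--Erdos inequality bounds the measure of the union of the balls below by
  \<open>(\<Sum>1/p)\<^sup>2\<close> over the sum of the pairwise intersections, where \<open>p\<close> runs over the primes whose
  ball is centred in \<open>J\<close>. If the centres are equidistributed with respect to the weights \<open>1/p\<close> and
  the intersections are on average at most a constant times what independence would give, the
  limsup set meets every interval in a fixed proportion, hence has full measure; then let
  \<open>\<epsilon>\<close> tend to \<open>0\<close>.

  Up to \<open>O(1/p)\<close> the centres are \<open>\<beta> n_p\<close> and \<open>\<beta> p\<close> modulo \<open>1\<close>. For the first sequence both
  conditions follow from the separation of the points \<open>\<beta> n\<close>. For the second,
  equidistribution is Vinogradov's theorem (Vaughan's identity, with power savings since \<open>\<beta>\<close>
  is badly approximable), and the intersections are controlled by counting the primes
  \<open>q \<in> (2^j p, 2^(j+1) p]\<close> with \<open>\<beta> (q - p)\<close> within \<open>O(1/p)\<close> of an integer. Selberg's sieve bounds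
  their number by \<open>O(2^j / (j + 1))\<close>, so that summing over \<open>j\<close> costs only the factor
  \<open>log log\<close> which \<open>\<Sum>1/p\<close> provides.
\<close>

section \<open>Distance to the nearest integer and exponential sums\<close>

text \<open>The factor \<open>2^j / (j + 1)\<close> shapes the treatment of the second sequence.
  Around a prime \<open>p\<close>, independence predicts of order \<open>2^j\<close> integers
  \<open>q\<close> in the \<open>j\<close>-th dyadic block with \<open>\<beta> * (q - p)\<close>
  that close to an integer. Counting integers instead of primes would thus give order
  \<open>1 / p\<close> per block and \<open>log N / p\<close> in total, whereas the Chung--Erdos
  argument tolerates only a multiple of \<open>1 / p\<close> times the sum of the
  \<open>1 / q\<close>, which may be as small as \<open>log log N / p\<close>. The bound must be
  uniform in \<open>j\<close>, also in the first blocks, where only boundedly many integers qualify;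
  the sifting level is therefore a power of \<open>2^j\<close>, not of \<open>q\<close>. Bad
  approximability enters through one inequality, \<open>c / q \<le> int_dist (q * \<beta>)\<close>.
  It passes to \<open>d * \<beta>\<close> with constant \<open>c / d\<close>, so that congruence
  conditions modulo \<open>d\<close> in the sieve cost only powers of \<open>d\<close>, and every
  frequency \<open>h * \<beta>\<close> in Weyl's criterion is covered by the same estimate as
  \<open>\<beta>\<close> itself.\<close>

definition int_dist :: "real \<Rightarrow> real" where
  "int_dist x = \<bar>x - of_int (round x)\<bar>"

text \<open>The additive character usually written e(t), of period 1.\<close>

definition ucis :: "real \<Rightarrow> complex" where
  "ucis t = cis (2 * pi * t)"

text \<open>Bad approximability in terms of the distance to the nearest integer, with the constant
  exposed so that its change under multiples of \<open>\<theta>\<close> can be tracked.\<close>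

definition bad_const :: "real \<Rightarrow> real \<Rightarrow> bool" where
  "bad_const c \<theta> \<longleftrightarrow> c > 0 \<and> (\<forall>q::nat. q \<ge> 1 \<longrightarrow> c / real q \<le> int_dist (real q * \<theta>))"

lemma int_dist_le: "int_dist x \<le> \<bar>x - of_int n\<bar>"
  unfolding int_dist_def by (rule round_diff_minimal)

lemma int_dist_nonneg [simp]: "0 \<le> int_dist x"
  by (simp add: int_dist_def)

lemma int_dist_le_half: "int_dist x \<le> 1 / 2"
  unfolding int_dist_def using of_int_round_abs_le[of x] by linarith

lemma int_dist_triangle: "int_dist (x + y) \<le> int_dist x + int_dist y"
proof -
  have "int_dist (x + y) \<le> \<bar>(x + y) - of_int (round x + round y)\<bar>" by (rule int_dist_le)
  thus ?thesis unfolding int_dist_def by simp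
qed

lemma int_dist_minus [simp]: "int_dist (- x) = int_dist x"
proof (rule antisym)
  have "int_dist (- x) \<le> int_dist x" for x
    using int_dist_le[of "- x" "- round x"] unfolding int_dist_def[of x] by simp
  from this[of x] this[of "- x"] show "int_dist (- x) \<le> int_dist x" "int_dist x \<le> int_dist (- x)"
    by simp_all
qed

lemma int_dist_minus_commute: "int_dist (x - y) = int_dist (y - x)"
  using int_dist_minus[of "x - y"] by simp

lemma int_dist_add_int [simp]: "int_dist (x + of_int n) = int_dist x"
proof (rule antisym)
  have *: "int_dist (x + of_int n) \<le> int_dist x" for x n
    using int_dist_le[of "x + of_int n" "round x + n"] unfolding int_dist_def[of x] by simp
  show "int_dist (x + of_int n) \<le> int_dist x" by (rule *)
  show "int_dist x \<le> int_dist (x + of_int n)" using *[of "x + of_int n" "- n"] by simp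
qed

lemma int_dist_mult_nat_le: "int_dist (real n * x) \<le> real n * int_dist x"
proof -
  have "int_dist (real n * x) \<le> \<bar>real n * x - of_int (int n * round x)\<bar>" by (rule int_dist_le)
  also have "\<dots> = real n * int_dist x"
    by (simp add: int_dist_def abs_mult flip: right_diff_distrib)
  finally show ?thesis .
qed

lemma ucis_add: "ucis (s + t) = ucis s * ucis t"
  by (simp add: ucis_def cis_mult ring_distribs)

lemma norm_ucis [simp]: "norm (ucis t) = 1"
  by (simp add: ucis_def)

lemma ucis_0 [simp]: "ucis 0 = 1"
  by (simp add: ucis_def)

lemma ucis_of_int [simp]: "ucis (of_int n) = 1"
  unfolding ucis_def using cis_multiple_2pi[of "of_int n"] by (simp add: mult_ac)

lemma ucis_of_nat [simp]: "ucis (of_nat n) = 1"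
  using ucis_of_int[of "int n"] by simp

lemma ucis_add_int [simp]: "ucis (t + of_int n) = ucis t"
  by (simp add: ucis_add)

lemma cnj_ucis: "cnj (ucis t) = ucis (- t)"
  by (simp add: ucis_def cis_cnj)

lemma ucis_power: "ucis (real n * t) = ucis t ^ n"
  unfolding ucis_def Complex.DeMoivre by (rule arg_cong[of _ _ cis]) simp

lemma norm_one_minus_ucis: "norm (1 - ucis t) = 2 * \<bar>sin (pi * t)\<bar>"
proof -
  have "norm (1 - ucis t) ^ 2 = (1 - cos (2 * (pi * t))) ^ 2 + sin (2 * (pi * t)) ^ 2"
    by (simp add: cmod_power2 ucis_def mult_ac)
  also have "\<dots> = 2 - 2 * cos (2 * (pi * t))"
    using sin_cos_squared_add[of "2 * (pi * t)"] by (simp add: power2_eq_square algebra_simps)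
  also have "\<dots> = (2 * \<bar>sin (pi * t)\<bar>) ^ 2"
    unfolding cos_double_sin by (simp add: power_mult_distrib)
  finally show ?thesis
    by (rule power2_eq_imp_eq) auto
qed

lemma norm_ucis_diff_le: "norm (ucis s - ucis t) \<le> 2 * pi * \<bar>s - t\<bar>"
proof -
  have "ucis s - ucis t = ucis s * (1 - ucis (t - s))"
    by (simp add: right_diff_distrib flip: ucis_add)
  hence "norm (ucis s - ucis t) = 2 * \<bar>sin (pi * (t - s))\<bar>"
    by (simp add: norm_mult norm_one_minus_ucis)
  also have "\<dots> \<le> 2 * \<bar>pi * (t - s)\<bar>"
    using abs_sin_x_le_abs_x by simp
  finally show ?thesis by (simp add: abs_mult abs_minus_commute)
qed

text \<open>A weak form of Jordan's inequality: the mean value theorem gives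
  \<open>y * cos y \<le> sin y\<close> at \<open>y = x / 2\<close>, and the double angle formulas
  lift this to \<open>x / 2 * (1 + cos x) \<le> sin x\<close>. The constant 1/2 is good enough below
  because \<open>pi \<ge> 2\<close>.\<close>

lemma sin_ge_half:
  assumes "0 \<le> x" "x \<le> pi / 2"
  shows "x / 2 \<le> sin x"
proof (cases "x = 0")
  case False
  define y where "y = x / 2"
  have y: "0 < y" "y < pi" "x = 2 * y" using assms False by (auto simp: y_def)
  obtain z where z: "0 < z" "z < y" "sin y - sin 0 = (y - 0) * cos z"
    using MVT2[of 0 y sin cos] y by (auto intro: DERIV_sin)
  have "cos y \<le> cos z" using z y by (intro cos_monotone_0_pi_le) auto
  hence "y * cos y \<le> sin y" using z y by simp
  moreover have "cos y > 0" using y assms by (intro cos_gt_zero) auto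
  ultimately have "2 * (y * cos y) * cos y \<le> 2 * sin y * cos y"
    by (intro mult_right_mono) auto
  also have "\<dots> = sin x" by (simp add: y sin_double)
  also have "2 * (y * cos y) * cos y = x / 2 * (1 + cos x)"
    by (simp add: y cos_double_cos power2_eq_square)
  finally have "x / 2 * (1 + cos x) \<le> sin x" .
  moreover have "x / 2 * 1 \<le> x / 2 * (1 + cos x)"
    using assms by (intro mult_left_mono) (auto intro: cos_ge_zero)
  ultimately show ?thesis by simp
qed auto

lemma norm_one_minus_ucis_ge: "2 * int_dist t \<le> norm (1 - ucis t)"
proof -
  define s where "s = t - of_int (round t)"
  have s: "\<bar>s\<bar> = int_dist t" "\<bar>s\<bar> \<le> 1 / 2"
    using int_dist_le_half[of t] by (auto simp: s_def int_dist_def)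
  have "norm (1 - ucis t) = norm (1 - ucis s)"
    using ucis_add_int[of s "round t"] by (simp add: s_def)
  also have "\<dots> = 2 * sin (pi * \<bar>s\<bar>)"
  proof -
    have "sin (pi * \<bar>s\<bar>) \<ge> 0"
      using s by (intro sin_ge_zero) (auto simp: field_simps intro: order_trans[of _ "pi * 1"])
    thus ?thesis unfolding norm_one_minus_ucis by (cases "s \<ge> 0") auto
  qed
  finally have "norm (1 - ucis t) = 2 * sin (pi * \<bar>s\<bar>)" .
  moreover have "sin (pi * \<bar>s\<bar>) \<ge> pi * \<bar>s\<bar> / 2"
    using s by (intro sin_ge_half) auto
  moreover have "2 * \<bar>s\<bar> \<le> pi * \<bar>s\<bar>"
    using pi_ge_two by (intro mult_right_mono) auto
  ultimately show ?thesis using s by simp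
qed

lemma norm_sum_ucis_le:
  assumes "int_dist t > 0"
  shows "norm (\<Sum>k<n. ucis (real k * t)) \<le> 1 / int_dist t"
proof -
  have ne: "ucis t \<noteq> 1"
    using norm_one_minus_ucis_ge[of t] assms by auto
  have "(\<Sum>k<n. ucis (real k * t)) = (1 - ucis t ^ n) / (1 - ucis t)"
    using ne by (simp add: ucis_power sum_gp_strict)
  also have "norm \<dots> \<le> 2 / (2 * int_dist t)"
    unfolding norm_divide
    using norm_one_minus_ucis_ge[of t] assms norm_triangle_ineq4[of 1 "ucis t ^ n"]
    by (intro frac_le) (auto simp: norm_power)
  finally show ?thesis by simp
qed

lemma sum_inverse_squares_le: "(\<Sum>j=1..n. 1 / real j ^ 2) \<le> 2"
proof -
  have "n \<ge> 1 \<Longrightarrow> (\<Sum>j=1..n. 1 / real j ^ 2) \<le> 2 - 1 / real n"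
  proof (induction n rule: nat_induct_at_least)
    case (Suc n)
    have "1 / real (Suc n) ^ 2 \<le> 1 / (real n * real (Suc n))"
      using Suc.hyps by (intro divide_left_mono) (auto simp: power2_eq_square)
    also have "\<dots> = 1 / real n - 1 / real (Suc n)"
      using Suc.hyps by (simp add: field_simps)
    finally show ?case using Suc.IH by simp
  qed auto
  thus ?thesis by (cases "n \<ge> 1") (auto intro: order_trans)
qed

lemma bad_constD:
  assumes "bad_const c \<theta>"
  shows "c > 0" "\<And>q. q \<ge> 1 \<Longrightarrow> c / real q \<le> int_dist (real q * \<theta>)"
    "\<And>q. q \<ge> 1 \<Longrightarrow> int_dist (real q * \<theta>) > 0"
proof -
  show c: "c > 0" and *: "\<And>q. q \<ge> 1 \<Longrightarrow> c / real q \<le> int_dist (real q * \<theta>)"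
    using assms by (auto simp: bad_const_def)
  show "int_dist (real q * \<theta>) > 0" if "q \<ge> 1" for q
    using c *[OF that] that by (intro less_le_trans[OF _ *[OF that]]) auto
qed

lemma bad_const_mult:
  assumes "bad_const c \<theta>" "d \<ge> 1"
  shows "bad_const (c / real d) (real d * \<theta>)"
  unfolding bad_const_def
proof (intro conjI allI impI)
  show "c / real d > 0" using assms by (simp add: bad_const_def)
  show "c / real d / real q \<le> int_dist (real q * (real d * \<theta>))" if "q \<ge> 1" for q
    using bad_constD(2)[OF assms(1), of "q * d"] that assms(2) by (simp add: mult_ac)
qed

lemma bad_const_le_half: "bad_const c \<theta> \<Longrightarrow> c \<le> 1 / 2"
  using bad_constD(2)[of c \<theta> 1] int_dist_le_half[of \<theta>] by simp

lemma bad_const_separated: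
  assumes "bad_const c \<theta>" "h \<noteq> h'"
  shows "c / \<bar>real h - real h'\<bar> \<le> int_dist (real h * \<theta> - real h' * \<theta>)"
proof -
  have *: "c / \<bar>real h - real h'\<bar> \<le> int_dist (real h * \<theta> - real h' * \<theta>)" if "h' < h" for h h'
    using bad_constD(2)[OF assms(1), of "h - h'"] that
    by (simp add: of_nat_diff algebra_simps)
  show ?thesis
  proof (cases "h' < h")
    case False
    with assms(2) have "h < h'" by simp
    from *[OF this] show ?thesis by (simp add: int_dist_minus_commute abs_minus_commute)
  qed (rule *)
qed

text \<open>
  The fractional parts \<^term>\<open>h * \<theta>\<close> with \<open>h < K\<close> are \<open>c / K\<close>-separated, so each bin of that
  width on either side of the nearest integer contains at most one of them.
\<close>

lemma sum_int_dist_inverse_square_le: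
  assumes "bad_const c \<theta>"
  shows "(\<Sum>h=1..<K. 1 / int_dist (real h * \<theta>) ^ 2) \<le> 4 * real K ^ 2 / c ^ 2"
proof -
  note c = bad_constD[OF assms]
  define d where "d h = int_dist (real h * \<theta>)" for h :: nat
  \<comment> \<open>The bin number in units of \<open>c / K\<close>; \<open>s\<close> below records
    the side of the nearest integer. No point falls into bin 0, since \<open>d h \<ge> c / h\<close>
    and \<open>h < K\<close>, so inverse squares of bin numbers can be summed.\<close>
  define j where "j h = nat \<lfloor>real K * d h / c\<rfloor>" for h
  define s where "s h = (real h * \<theta> \<ge> of_int (round (real h * \<theta>)))" for h :: nat
  have ge1: "real K * d h / c \<ge> 1" if "h \<in> {1..<K}" for h
  proof -
    have "real K * d h \<ge> real K * (c / real h)"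
      using c(2)[of h] that by (intro mult_left_mono) (auto simp: d_def)
    moreover have "real K * (c / real h) \<ge> c"
      using that c(1) by (simp add: field_simps)
    ultimately show ?thesis using c(1) by (simp add: field_simps)
  qed
  have j: "real (j h) \<le> real K * d h / c" "real K * d h / c < real (j h) + 1" "j h \<ge> 1"
    if "h \<in> {1..<K}" for h
    using ge1[OF that] unfolding j_def by linarith+
  have inj: "inj_on (\<lambda>h. (j h, s h)) {1..<K}"
  proof (rule inj_onI, rule ccontr)
    fix h h' assume h: "h \<in> {1..<K}" "h' \<in> {1..<K}" and eq: "(j h, s h) = (j h', s h')" and ne: "h \<noteq> h'"
    have K: "real K > 0" using h by simp
    have "\<bar>real K * d h / c - real K * d h' / c\<bar> < 1"
      using j[OF h(1)] j[OF h(2)] eq by auto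
    hence "\<bar>d h - d h'\<bar> * (real K / c) < 1"
      unfolding diff_divide_distrib[symmetric] right_diff_distrib[symmetric]
      using K c(1) by (simp add: abs_mult mult.commute)
    hence lt: "\<bar>d h - d h'\<bar> < c / real K"
      using K c(1) by (simp add: field_simps)
    have "int_dist (real h * \<theta> - real h' * \<theta>) \<le> \<bar>d h - d h'\<bar>"
    proof -
      have "int_dist (real h * \<theta> - real h' * \<theta>) \<le>
          \<bar>(real h * \<theta> - real h' * \<theta>) - of_int (round (real h * \<theta>) - round (real h' * \<theta>))\<bar>"
        by (rule int_dist_le)
      also have "\<dots> = \<bar>d h - d h'\<bar>"
        using eq by (cases "s h") (auto simp: s_def d_def int_dist_def)
      finally show ?thesis .
    qed
    moreover have "c / real K \<le> c / \<bar>real h - real h'\<bar>"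
      using h ne c(1) by (intro divide_left_mono) auto
    ultimately show False
      using bad_const_separated[OF assms ne] lt by linarith
  qed
  define J where "J = Max (insert 0 (j ` {1..<K}))"
  have "(\<Sum>h=1..<K. 1 / d h ^ 2) \<le> (\<Sum>h=1..<K. (real K / c) ^ 2 * (1 / real (j h) ^ 2))"
  proof (rule sum_mono)
    fix h assume h: "h \<in> {1..<K}"
    have "real (j h) ^ 2 \<le> (real K * d h / c) ^ 2"
      using j(1)[OF h] by (intro power_mono) auto
    moreover have "d h > 0" using c(3)[of h] h by (simp add: d_def)
    ultimately show "1 / d h ^ 2 \<le> (real K / c) ^ 2 * (1 / real (j h) ^ 2)"
      using j(3)[OF h] c(1) by (simp add: field_simps)
  qed
  also have "\<dots> = (\<Sum>p\<in>(\<lambda>h. (j h, s h)) ` {1..<K}. (real K / c) ^ 2 * (1 / real (fst p) ^ 2))"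
    by (subst sum.reindex[OF inj]) (simp add: o_def)
  \<comment> \<open>Each of the two sides contributes at most the sum of inverse squares, which is
    bounded by 2; hence the constant 4.\<close>
  also have "\<dots> \<le> (\<Sum>p\<in>{1..J} \<times> (UNIV :: bool set). (real K / c) ^ 2 * (1 / real (fst p) ^ 2))"
  proof (rule sum_mono2)
    have "j h \<le> J" if "h \<in> {1..<K}" for h
      unfolding J_def using that by (intro Max_ge) auto
    thus "(\<lambda>h. (j h, s h)) ` {1..<K} \<subseteq> {1..J} \<times> UNIV"
      using j(3) by auto
  qed auto
  also have "\<dots> = (\<Sum>i=1..J. \<Sum>b\<in>(UNIV :: bool set). (real K / c) ^ 2 * (1 / real i ^ 2))"
    by (subst sum.cartesian_product) (simp add: case_prod_unfold)
  also have "\<dots> = 2 * (real K / c) ^ 2 * (\<Sum>i=1..J. 1 / real i ^ 2)"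
    by (simp add: sum_distrib_left mult_ac)
  also have "\<dots> \<le> 2 * (real K / c) ^ 2 * 2"
    using sum_inverse_squares_le by (intro mult_left_mono) auto
  finally show ?thesis by (simp add: d_def power_divide)
qed

text \<open>Cauchy--Schwarz against the previous bound. This is weaker than the order
  \<open>K * log K\<close> that summing over the bins directly would give, but it suffices where a
  power of \<open>N\<close> is saved anyway.\<close>

lemma sum_int_dist_inverse_le:
  assumes "bad_const c \<theta>"
  shows "(\<Sum>h=1..<K. 1 / int_dist (real h * \<theta>)) \<le> 2 * real K * sqrt (real K) / c"
proof -
  have "(\<Sum>h=1..<K. 1 * (1 / int_dist (real h * \<theta>)))\<^sup>2 \<le>
      (\<Sum>h=1..<K. 1\<^sup>2) * (\<Sum>h=1..<K. (1 / int_dist (real h * \<theta>))\<^sup>2)"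
    by (rule Cauchy_Schwarz_ineq_sum)
  also have "\<dots> \<le> real K * (4 * real K ^ 2 / c ^ 2)"
    using sum_int_dist_inverse_square_le[OF assms, of K]
    by (intro mult_mono) (auto simp: power_divide intro!: sum_nonneg)
  also have "\<dots> = (2 * real K * sqrt (real K) / c) ^ 2"
    by (simp add: power_mult_distrib power_divide)
  finally have "(\<Sum>h=1..<K. 1 * (1 / int_dist (real h * \<theta>)))\<^sup>2 \<le> (2 * real K * sqrt (real K) / c)\<^sup>2" .
  moreover have "0 \<le> 2 * real K * sqrt (real K) / c" using bad_constD(1)[OF assms] by simp
  ultimately show ?thesis unfolding mult_1 by (rule power2_le_imp_le)
qed

lemma badly_approximable_imp_bad_const:
  assumes "badly_approximable \<beta>"
  shows "\<exists>c. bad_const c \<beta>"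
proof -
  from assms obtain c where c: "c > 0"
    "\<And>a q :: int. q \<ge> 1 \<Longrightarrow> \<bar>\<beta> - of_int a / of_int q\<bar> > c / (of_int q)\<^sup>2"
    unfolding badly_approximable_def by blast
  have "bad_const c \<beta>" unfolding bad_const_def
  proof (intro conjI allI impI c(1))
    fix q :: nat assume q: "q \<ge> 1"
    define a where "a = round (real q * \<beta>)"
    have "c / (real q)\<^sup>2 < \<bar>\<beta> - of_int a / real q\<bar>"
      using c(2)[of "int q" a] q by simp
    hence "real q * (c / (real q)\<^sup>2) \<le> real q * \<bar>\<beta> - of_int a / real q\<bar>"
      by (intro mult_left_mono) auto
    also have "real q * \<bar>\<beta> - of_int a / real q\<bar> = \<bar>real q * (\<beta> - of_int a / real q)\<bar>"
      by (simp add: abs_mult)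
    also have "\<dots> = int_dist (real q * \<beta>)"
      using q by (simp add: int_dist_def a_def algebra_simps)
    finally show "c / real q \<le> int_dist (real q * \<beta>)"
      using q by (simp add: power2_eq_square field_simps)
  qed
  thus ?thesis ..
qed

section \<open>The Moebius function, squarefree sums and Selberg weights\<close>

definition mob :: "nat \<Rightarrow> real" where
  "mob n = (if squarefree n then (- 1) ^ card (prime_factors n) else 0)"

lemma mob_1 [simp]: "mob (Suc 0) = 1"
  by (simp add: mob_def)

lemma abs_mob: "\<bar>mob n\<bar> = (if squarefree n then 1 else 0)"
  by (simp add: mob_def power_abs)

lemma abs_mob_le: "\<bar>mob n\<bar> \<le> 1"
  by (simp add: abs_mob)

lemma mob_mult_prime:
  assumes "prime p" "\<not> p dvd d" "squarefree d"
  shows "mob (p * d) = - mob d"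
proof -
  have d: "d \<noteq> 0" using assms(3) by (intro notI) simp
  have "coprime p d" using assms by (simp add: prime_imp_coprime)
  hence "squarefree (p * d)"
    by (rule squarefree_mult_coprime[OF _ squarefree_prime[OF assms(1)] assms(3)])
  moreover have "prime_factors (p * d) = insert p (prime_factors d)"
    using assms d by (subst prime_factors_product) (auto simp: prime_prime_factors)
  moreover have "p \<notin> prime_factors d" using assms by auto
  ultimately show ?thesis using assms by (simp add: mob_def)
qed

text \<open>For \<open>n > 1\<close> fix a prime \<open>p\<close> dividing \<open>n\<close>: the
  squarefree divisors pair off as \<open>d\<close> and \<open>p * d\<close> with \<open>d\<close>
  prime to \<open>p\<close>, and the two values cancel.\<close>

lemma sum_mob_divisors:
  assumes "n > 0"
  shows "(\<Sum>d | d dvd n. mob d) = (if n = 1 then 1 else 0)"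
proof (cases "n = 1")
  case False
  then obtain p where p: "prime p" "p dvd n"
    using prime_factor_nat by blast
  define A where "A = {d. d dvd n \<and> squarefree d \<and> \<not> p dvd d}"
  have fin: "finite {d. d dvd n}" using assms by simp
  hence finA: "finite A" by (rule finite_subset[rotated]) (auto simp: A_def)
  have sub: "A \<union> (*) p ` A \<subseteq> {d. d dvd n}"
    using p by (auto simp: A_def intro!: divides_mult prime_imp_coprime)
  have zero: "mob d = 0" if "d \<in> {d. d dvd n} - (A \<union> (*) p ` A)" for d
  proof (rule ccontr)
    assume "mob d \<noteq> 0"
    hence sq: "squarefree d" by (auto simp: mob_def split: if_splits)
    with that have "p dvd d" "d dvd n" by (auto simp: A_def)
    then obtain e where e: "d = p * e" by auto
    have "\<not> p dvd e"
    proof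
      assume "p dvd e"
      hence "p ^ 2 dvd d" by (auto simp: e power2_eq_square)
      with sq have "p dvd 1" by (rule squarefreeD)
      with p show False by auto
    qed
    moreover have "squarefree e" using sq e squarefree_multD(2) by blast
    moreover have "e dvd n" using \<open>d dvd n\<close> e by auto
    ultimately have "d \<in> (*) p ` A" by (auto simp: A_def e)
    with that show False by auto
  qed
  have "(\<Sum>d | d dvd n. mob d) = (\<Sum>d\<in>A \<union> (*) p ` A. mob d)"
    using zero by (intro sum.mono_neutral_right[OF fin sub]) auto
  also have "\<dots> = (\<Sum>d\<in>A. mob d) + (\<Sum>d\<in>(*) p ` A. mob d)"
    using finA by (intro sum.union_disjoint) (auto simp: A_def)
  also have "(\<Sum>d\<in>(*) p ` A. mob d) = (\<Sum>d\<in>A. - mob d)"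
    using p by (subst sum.reindex)
       (auto simp: inj_on_def A_def mob_mult_prime prime_gt_0_nat intro!: sum.cong)
  finally show ?thesis using False by (simp add: sum_negf)
qed simp

text \<open>Every positive \<open>n\<close> is a squarefree number times a square, so the harmonic
  sum is at most the squarefree sum times the sum of inverse squares; bounding the latter by 2
  produces the denominator.\<close>

lemma sum_squarefree_ge:
  "ln (real R + 1) / 2 \<le> (\<Sum>r | r \<in> {1..R} \<and> squarefree r. 1 / real r)"
proof -
  define SF where "SF = {r. r \<in> {1..R} \<and> squarefree r}"
  have finSF: "finite SF" by (simp add: SF_def)
  define f where "f n = (squarefree_part n, square_part n)" for n :: nat
  have decomp: "n = fst (f n) * snd (f n) ^ 2" for n
    using squarefree_decompose[of n] by (simp add: f_def)
  have inj: "inj_on f {1..R}"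
    by (rule inj_onI) (metis decomp)
  have im: "f ` {1..R} \<subseteq> SF \<times> {1..R}"
  proof
    fix x assume "x \<in> f ` {1..R}"
    then obtain n where n: "n \<in> {1..R}" "x = f n" by auto
    have pos: "squarefree_part n > 0" "square_part n > 0"
      using n by (auto simp: gr0_conv_Suc[symmetric] intro!: Nat.gr0I)
    have "squarefree_part n dvd n" by (metis decomp dvd_triv_left f_def fst_conv)
    moreover have "square_part n dvd n"
      using square_part_square_dvd[of n] unfolding power2_eq_square by (rule dvd_mult_left)
    ultimately have "squarefree_part n \<le> n" "square_part n \<le> n"
      using n by (auto intro: dvd_imp_le)
    thus "x \<in> SF \<times> {1..R}" using n pos by (auto simp: f_def SF_def)
  qed
  have "ln (real R + 1) \<le> (\<Sum>n=1..R. 1 / real n)"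
    using ln_le_harm[of R] by (simp add: harm_def inverse_eq_divide)
  also have "\<dots> = (\<Sum>n=1..R. 1 / real (fst (f n)) * (1 / real (snd (f n)) ^ 2))"
  proof (intro sum.cong refl)
    fix n show "1 / real n = 1 / real (fst (f n)) * (1 / real (snd (f n)) ^ 2)"
      by (subst decomp[of n]) simp
  qed
  also have "\<dots> = (\<Sum>x\<in>f ` {1..R}. 1 / real (fst x) * (1 / real (snd x) ^ 2))"
    by (subst sum.reindex[OF inj]) simp
  also have "\<dots> \<le> (\<Sum>x\<in>SF \<times> {1..R}. 1 / real (fst x) * (1 / real (snd x) ^ 2))"
    using finSF by (intro sum_mono2 im) auto
  also have "\<dots> = (\<Sum>r\<in>SF. 1 / real r) * (\<Sum>n=1..R. 1 / real n ^ 2)"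
    by (subst sum_product, subst sum.cartesian_product) (simp add: case_prod_unfold)
  also have "\<dots> \<le> (\<Sum>r\<in>SF. 1 / real r) * 2"
    using sum_inverse_squares_le by (intro mult_left_mono sum_nonneg) auto
  finally show ?thesis by (simp add: SF_def)
qed

lemma squarefree_eq_prod_prime_factors:
  assumes "squarefree (r :: nat)"
  shows "r = \<Prod>(prime_factors r)"
proof -
  have r: "r \<noteq> 0" using assms by (intro notI) simp
  have "r = (\<Prod>p\<in>prime_factors r. p ^ multiplicity p r)"
    using prod_prime_factors[OF r] by simp
  also have "\<dots> = \<Prod>(prime_factors r)"
    using assms squarefree_factorial_semiring'[OF r] by (intro prod.cong) auto
  finally show ?thesis .
qed

text \<open>Euler's argument: the product of \<open>1 + 1 / p\<close> over the primes up to
  \<open>N\<close> expands into a sum that contains \<open>1 / r\<close> for every squarefree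
  \<open>r \<le> N\<close>, and \<open>1 + x \<le> exp x\<close> turns the product into the
  exponential of the sum.\<close>

lemma sum_inverse_primes_ge:
  "ln (ln (real N + 1) / 2) \<le> (\<Sum>p | p \<in> {1..N} \<and> prime p. 1 / real p)"
proof (cases "N = 0")
  case False
  define P where "P = {p. p \<in> {1..N} \<and> prime p}"
  define SF where "SF = {r. r \<in> {1..N} \<and> squarefree r}"
  have fin: "finite P" by (simp add: P_def)
  have inj: "inj_on prime_factors SF"
    by (rule inj_onI) (metis (lifting) SF_def mem_Collect_eq squarefree_eq_prod_prime_factors)
  have im: "prime_factors ` SF \<subseteq> Pow P"
    by (auto simp: SF_def P_def in_prime_factors_iff Suc_le_eq prime_gt_0_nat
          intro: order_trans[OF dvd_imp_le])
  have "ln (real N + 1) / 2 \<le> (\<Sum>r\<in>SF. 1 / real r)"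
    using sum_squarefree_ge[of N] by (simp add: SF_def)
  also have "\<dots> = (\<Sum>r\<in>SF. \<Prod>p\<in>prime_factors r. 1 / real p)"
  proof (intro sum.cong refl)
    fix r assume "r \<in> SF"
    hence "real r = (\<Prod>p\<in>prime_factors r. real p)"
      by (subst squarefree_eq_prod_prime_factors) (auto simp: SF_def)
    thus "1 / real r = (\<Prod>p\<in>prime_factors r. 1 / real p)"
      by (simp add: prod_dividef)
  qed
  also have "\<dots> = (\<Sum>X\<in>prime_factors ` SF. \<Prod>p\<in>X. 1 / real p)"
    by (subst sum.reindex[OF inj]) simp
  also have "\<dots> \<le> (\<Sum>X\<in>Pow P. \<Prod>p\<in>X. 1 / real p)"
    using fin by (intro sum_mono2 im) (auto intro!: prod_nonneg)
  also have "\<dots> = (\<Prod>p\<in>P. 1 / real p + 1)"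
    using fin by (subst prod_add) auto
  also have "\<dots> \<le> (\<Prod>p\<in>P. exp (1 / real p))"
    by (intro prod_mono) (auto simp: add.commute exp_ge_add_one_self intro!: add_nonneg_nonneg)
  also have "\<dots> = exp (\<Sum>p\<in>P. 1 / real p)"
    using fin by (simp add: exp_sum)
  finally have "ln (real N + 1) / 2 \<le> exp (\<Sum>p\<in>P. 1 / real p)" .
  moreover have "ln (real N + 1) / 2 > 0" using False by simp
  ultimately have "ln (ln (real N + 1) / 2) \<le> ln (exp (\<Sum>p\<in>P. 1 / real p))"
    by (subst ln_le_cancel_iff) auto
  thus ?thesis by (simp add: P_def)
qed simp

lemma sum_swap3:
  "(\<Sum>d\<in>A. \<Sum>e\<in>B. \<Sum>r\<in>C. F d e r) = (\<Sum>r\<in>C. \<Sum>d\<in>A. \<Sum>e\<in>B. F d e r)"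
proof -
  have "(\<Sum>d\<in>A. \<Sum>e\<in>B. \<Sum>r\<in>C. F d e r) = (\<Sum>d\<in>A. \<Sum>r\<in>C. \<Sum>e\<in>B. F d e r)"
    by (rule sum.cong[OF refl], rule sum.swap)
  also have "\<dots> = (\<Sum>r\<in>C. \<Sum>d\<in>A. \<Sum>e\<in>B. F d e r)" by (rule sum.swap)
  finally show ?thesis .
qed

text \<open>
  The Selberg diagonalisation with the slightly suboptimal choice \<open>mob r / r\<close> in place of
  \<open>mob r / totient r\<close>, which avoids lower bounds for the totient function.
\<close>

lemma selberg_weights:
  assumes "R \<ge> 1"
  obtains l :: "nat \<Rightarrow> real" where "l 1 = 1" "\<And>d. \<bar>l d\<bar> \<le> real d"
    "(\<Sum>d=1..R. \<Sum>e=1..R. l d * l e / real (lcm d e)) \<le> 2 / ln (real R + 1)"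
proof -
  define G where "G = (\<Sum>r=1..R. \<bar>mob r\<bar> / real r)"
  have G_eq: "G = (\<Sum>r | r \<in> {1..R} \<and> squarefree r. 1 / real r)"
    unfolding G_def by (rule sum.mono_neutral_cong_right) (auto simp: abs_mob)
  have G_ge: "ln (real R + 1) / 2 \<le> G"
    unfolding G_eq by (rule sum_squarefree_ge)
  have lnR: "ln (real R + 1) > 0" using assms by simp
  have G: "G > 0" using G_ge lnR by linarith
  \<comment> \<open>The variables in which the quadratic form is diagonal: if \<open>y r\<close> is
    the sum of \<open>l d / d\<close> over the multiples \<open>d\<close> of \<open>r\<close>, the
    form becomes the sum of \<open>totient r * y r ^ 2\<close>. The factor \<open>1 / G\<close>
    enforces \<open>l 1 = 1\<close>, and the definition of \<open>l\<close> below is the inverse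
    change of variables.\<close>
  define y where "y r = mob r / (real r * G)" for r
  define l where "l d = real d * (\<Sum>r | r \<in> {1..R} \<and> d dvd r. mob (r div d) * y r)" for d
  have abs_y: "(\<Sum>r=1..R. \<bar>y r\<bar>) = 1"
    using G by (simp add: y_def abs_mult G_def flip: sum_divide_distrib divide_divide_eq_left)
  have mob2: "mob r * mob r = \<bar>mob r\<bar>" for r
    by (cases "even (card (prime_factors r))") (auto simp: mob_def)
  have l1: "l 1 = 1"
  proof -
    have "l 1 = (\<Sum>r=1..R. mob r * y r)"
      unfolding l_def by (simp, intro sum.cong) auto
    also have "\<dots> = (\<Sum>r=1..R. \<bar>mob r\<bar> / real r) / G"
      by (simp add: y_def mob2 sum_divide_distrib)
    finally show ?thesis using G by (simp add: G_def)
  qed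
  have labs: "\<bar>l d\<bar> \<le> real d" for d
  proof -
    have "\<bar>\<Sum>r | r \<in> {1..R} \<and> d dvd r. mob (r div d) * y r\<bar> \<le>
        (\<Sum>r | r \<in> {1..R} \<and> d dvd r. \<bar>mob (r div d) * y r\<bar>)"
      by (rule sum_abs)
    also have "\<dots> \<le> (\<Sum>r | r \<in> {1..R} \<and> d dvd r. \<bar>y r\<bar>)"
      by (intro sum_mono) (auto simp: abs_mult intro: mult_left_le_one_le abs_mob_le)
    also have "\<dots> \<le> (\<Sum>r=1..R. \<bar>y r\<bar>)"
      by (intro sum_mono2) auto
    finally show ?thesis
      unfolding abs_y by (simp add: l_def abs_mult mult_left_le)
  qed
  have inv: "(\<Sum>d | d \<in> {1..R} \<and> r dvd d. l d / real d) = y r" if r: "r \<in> {1..R}" for r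
  proof -
    have "(\<Sum>d | d \<in> {1..R} \<and> r dvd d. l d / real d) =
        (\<Sum>d | d \<in> {1..R} \<and> r dvd d. \<Sum>s | s \<in> {1..R} \<and> d dvd s. mob (s div d) * y s)"
      by (intro sum.cong) (auto simp: l_def)
    also have "\<dots> = (\<Sum>s\<in>{1..R}. \<Sum>d | (d \<in> {1..R} \<and> r dvd d) \<and> d dvd s. mob (s div d) * y s)"
      using sum.swap_restrict[of "{d. d \<in> {1..R} \<and> r dvd d}" "{1..R}"
        "\<lambda>d s. mob (s div d) * y s" "\<lambda>d s. d dvd s"] by simp
    also have "\<dots> = (\<Sum>s\<in>{1..R}. if s = r then y s else 0)"
    proof (intro sum.cong refl)
      fix s assume s: "s \<in> {1..R}"
      have "(\<Sum>d | (d \<in> {1..R} \<and> r dvd d) \<and> d dvd s. mob (s div d)) = (if s = r then 1 else 0)"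
      proof (cases "r dvd s")
        case True
        have "(\<Sum>d | (d \<in> {1..R} \<and> r dvd d) \<and> d dvd s. mob (s div d)) =
            (\<Sum>d | d dvd s div r. mob d)"
        proof (rule sum.reindex_bij_witness[of _ "\<lambda>d. s div d" "\<lambda>d. s div d"])
          fix d assume d: "d \<in> {d. (d \<in> {1..R} \<and> r dvd d) \<and> d dvd s}"
          show "s div (s div d) = d" using d s by auto
          from d obtain a b where "d = r * a" "s = r * a * b" by (auto elim!: dvdE)
          thus "s div d \<in> {d. d dvd s div r}" using s r d by auto
        next
          fix d assume d: "d \<in> {d. d dvd s div r}"
          from True obtain b where b: "s = r * b" by auto
          with d r obtain a where a: "b = d * a" by auto
          have pos: "r > 0" "d > 0" "a > 0" using s b a by auto
          have "r * a \<le> R" using s b a pos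
            by (metis One_nat_def Suc_leI atLeastAtMost_iff dual_order.trans mult.commute mult.left_commute
                mult_le_mono2 nat_mult_1_right)
          thus "s div d \<in> {d. (d \<in> {1..R} \<and> r dvd d) \<and> d dvd s}"
            using pos by (auto simp: b a Suc_le_eq)
          show "s div (s div d) = d" using pos by (auto simp: b a)
        qed auto
        also have "\<dots> = (if s div r = 1 then 1 else 0)"
          using True s r by (intro sum_mob_divisors) (auto simp: div_greater_zero_iff dvd_imp_le)
        also have "s div r = 1 \<longleftrightarrow> s = r" using True r by (auto elim!: dvdE)
        finally show ?thesis .
      next
        case False
        hence "{d. (d \<in> {1..R} \<and> r dvd d) \<and> d dvd s} = {}" by (auto dest: dvd_trans)
        thus ?thesis using False by (auto simp del: Collect_empty_eq)
      qed
      thus "(\<Sum>d | (d \<in> {1..R} \<and> r dvd d) \<and> d dvd s. mob (s div d) * y s) =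
          (if s = r then y s else 0)"
        by (simp flip: sum_distrib_right)
    qed
    also have "\<dots> = y r" using r by simp
    finally show ?thesis .
  qed
  \<comment> \<open>Uses \<open>1 / lcm d e = gcd d e / (d * e)\<close> and writes the gcd as the
    sum of \<open>totient r\<close> over its divisors, which separates \<open>d\<close> from
    \<open>e\<close>.\<close>
  have "(\<Sum>d=1..R. \<Sum>e=1..R. l d * l e / real (lcm d e)) =
      (\<Sum>d=1..R. \<Sum>e=1..R. \<Sum>r | r \<in> {1..R} \<and> r dvd d \<and> r dvd e.
         real (totient r) * (l d / real d) * (l e / real e))"
  proof (intro sum.cong refl)
    fix d e assume de: "d \<in> {1..R}" "e \<in> {1..R}"
    have "(\<Sum>r | r \<in> {1..R} \<and> r dvd d \<and> r dvd e. totient r) = (\<Sum>r | r dvd gcd d e. totient r)"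
      using de by (intro sum.cong) (auto dest: dvd_imp_le intro: Nat.gr0I simp: Suc_le_eq)
    also have "\<dots> = gcd d e" by (rule totient_divisor_sum)
    finally have tot: "(\<Sum>r | r \<in> {1..R} \<and> r dvd d \<and> r dvd e. real (totient r)) = real (gcd d e)"
      by (metis of_nat_sum)
    have "real (gcd d e) * real (lcm d e) = real d * real e"
      by (metis of_nat_mult prod_gcd_lcm_nat)
    moreover have "real (lcm d e) > 0" using de by (simp add: lcm_pos_nat)
    ultimately have "l d * l e / real (lcm d e) = real (gcd d e) * (l d / real d) * (l e / real e)"
      using de by (simp add: field_simps)
    thus "l d * l e / real (lcm d e) = (\<Sum>r | r \<in> {1..R} \<and> r dvd d \<and> r dvd e.
         real (totient r) * (l d / real d) * (l e / real e))"
      by (simp only: tot[symmetric] sum_distrib_right)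
  qed
  also have "\<dots> = (\<Sum>d=1..R. \<Sum>e=1..R. \<Sum>r=1..R. real (totient r) *
      ((if r dvd d then l d / real d else 0) * (if r dvd e then l e / real e else 0)))"
    by (rule sum.cong[OF refl], rule sum.cong[OF refl], rule sum.mono_neutral_cong_left) auto
  also have "\<dots> = (\<Sum>r=1..R. real (totient r) *
      ((\<Sum>d=1..R. if r dvd d then l d / real d else 0) * (\<Sum>e=1..R. if r dvd e then l e / real e else 0)))"
    by (subst sum_swap3, subst sum_product) (simp only: sum_distrib_left)
  also have "\<dots> = (\<Sum>r=1..R. real (totient r) * (y r * y r))"
  proof (intro sum.cong refl)
    fix r assume r: "r \<in> {1..R}"
    have "(\<Sum>d=1..R. if r dvd d then l d / real d else 0) = y r"
      by (subst inv[OF r, symmetric], rule sum.mono_neutral_cong_right) auto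
    thus "real (totient r) * ((\<Sum>d=1..R. if r dvd d then l d / real d else 0) *
        (\<Sum>e=1..R. if r dvd e then l e / real e else 0)) = real (totient r) * (y r * y r)"
      by simp
  qed
  \<comment> \<open>The bound \<open>totient r \<le> r\<close> fits the choice of \<open>y\<close>:
    the sum collapses to \<open>G / G ^ 2\<close>.\<close>
  also have "\<dots> \<le> (\<Sum>r=1..R. real r * (y r * y r))"
    by (intro sum_mono mult_right_mono) (auto simp: totient_le)
  also have "\<dots> = (\<Sum>r=1..R. \<bar>mob r\<bar> / real r) / G ^ 2"
    unfolding sum_divide_distrib
    by (intro sum.cong) (auto simp: y_def power2_eq_square mob2)
  also have "\<dots> = 1 / G" using G unfolding G_def[symmetric] by (simp add: power2_eq_square)
  also have "\<dots> \<le> 2 / ln (real R + 1)"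
    using G_ge G lnR by (simp add: field_simps)
  finally show ?thesis using that[of l] l1 labs by simp
qed

section \<open>An upper bound sieve for Bohr sets\<close>

lemma sum_ucis_multiples:
  assumes "D \<ge> 1"
  shows "(\<Sum>a<D. ucis (real a * real_of_int n / real D)) = (if int D dvd n then of_nat D else 0)"
proof (cases "int D dvd n")
  case True
  then obtain m where m: "n = int D * m" by auto
  have "ucis (real a * real_of_int n / real D) = 1" for a
  proof -
    have "real a * real_of_int n / real D = of_int (int a * m)"
      using assms by (simp add: m)
    thus ?thesis by (simp only: ucis_of_int)
  qed
  thus ?thesis using True by simp
next
  case False
  define t where "t = real_of_int n / real D"
  have "int_dist t > 0"
  proof (rule ccontr)
    assume "\<not> int_dist t > 0"
    hence "t = of_int (round t)" using int_dist_nonneg[of t] by (simp add: int_dist_def)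
    hence "real_of_int n = of_int (int D * round t)"
      using assms by (simp add: t_def field_simps)
    hence "n = int D * round t" by (simp only: of_int_eq_iff)
    with False show False by auto
  qed
  hence ne: "ucis t \<noteq> 1" using norm_one_minus_ucis_ge[of t] by auto
  have "(\<Sum>a<D. ucis (real a * real_of_int n / real D)) = (\<Sum>a<D. ucis t ^ a)"
    by (simp add: t_def flip: ucis_power)
  also have "\<dots> = (1 - ucis t ^ D) / (1 - ucis t)"
    using ne by (simp add: sum_gp_strict)
  also have "ucis t ^ D = 1"
    using assms by (simp add: t_def flip: ucis_power)
  finally show ?thesis using False by simp
qed

text \<open>Averaging over the differences \<open>i - j\<close>, rather than over an interval,
  yields a multiple of the Fejer kernel. It decays like the inverse square of
  \<open>int_dist t\<close>, so that its sum over many frequencies is controlled by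
  \<open>sum_int_dist_inverse_square_le\<close>.\<close>

lemma norm_sum_ucis_square:
  "(\<Sum>i<L. \<Sum>j<L. ucis ((real i - real j) * t)) = of_real (norm (\<Sum>i<L. ucis (real i * t)) ^ 2)"
proof -
  have "of_real (norm (\<Sum>i<L. ucis (real i * t)) ^ 2) =
      (\<Sum>i<L. ucis (real i * t)) * cnj (\<Sum>i<L. ucis (real i * t))"
    by (rule complex_norm_square)
  also have "\<dots> = (\<Sum>i<L. \<Sum>j<L. ucis (real i * t) * ucis (- (real j * t)))"
    by (simp only: cnj_sum cnj_ucis sum_product)
  also have "\<dots> = (\<Sum>i<L. \<Sum>j<L. ucis ((real i - real j) * t))"
    by (simp add: left_diff_distrib flip: ucis_add)
  finally show ?thesis ..
qed

lemma sum_offdiag_le: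
  fixes f :: "nat \<Rightarrow> real"
  assumes "\<And>h. f h \<ge> 0"
  shows "(\<Sum>k<K. \<Sum>l | l < K \<and> l \<noteq> k. f (if l < k then k - l else l - k)) \<le> 2 * real K * (\<Sum>h=1..<K. f h)"
proof -
  have "(\<Sum>l | l < K \<and> l \<noteq> k. f (if l < k then k - l else l - k)) \<le> 2 * (\<Sum>h=1..<K. f h)"
    if k: "k < K" for k
  proof -
    have "{l. l < K \<and> l \<noteq> k} = {..<k} \<union> {k<..<K}" using k by auto
    hence "(\<Sum>l | l < K \<and> l \<noteq> k. f (if l < k then k - l else l - k)) =
        (\<Sum>l\<in>{..<k} \<union> {k<..<K}. f (if l < k then k - l else l - k))"
      by (simp only:)
    also have "\<dots> = (\<Sum>l<k. f (if l < k then k - l else l - k)) +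
        (\<Sum>l\<in>{k<..<K}. f (if l < k then k - l else l - k))"
      by (rule sum.union_disjoint) auto
    also have "(\<Sum>l<k. f (if l < k then k - l else l - k)) = (\<Sum>l<k. f (k - l))"
      by (intro sum.cong) auto
    also have "(\<Sum>l\<in>{k<..<K}. f (if l < k then k - l else l - k)) = (\<Sum>l\<in>{k<..<K}. f (l - k))"
      by (intro sum.cong) auto
    also have "(\<Sum>l<k. f (k - l)) = sum f ((\<lambda>l. k - l) ` {..<k})"
      by (subst sum.reindex) (auto simp: inj_on_def)
    also have "\<dots> \<le> (\<Sum>h=1..<K. f h)"
      using k assms by (intro sum_mono2) auto
    also have "(\<Sum>l\<in>{k<..<K}. f (l - k)) = sum f ((\<lambda>l. l - k) ` {k<..<K})"
      by (subst sum.reindex) (auto simp: inj_on_def)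
    also have "\<dots> \<le> (\<Sum>h=1..<K. f h)"
      using k assms by (intro sum_mono2) auto
    finally show ?thesis by simp
  qed
  hence "(\<Sum>k<K. \<Sum>l | l < K \<and> l \<noteq> k. f (if l < k then k - l else l - k)) \<le>
      (\<Sum>k<K. 2 * (\<Sum>h=1..<K. f h))"
    by (intro sum_mono) auto
  thus ?thesis by simp
qed

text \<open>\<open>K\<close> times the Fejer kernel of order \<open>K\<close> at
  \<open>\<beta> * n - \<alpha>\<close>: a nonnegative trigonometric polynomial of degree below
  \<open>K\<close> that dominates a multiple of the indicator of the Bohr set.\<close>

definition bohr_weight :: "real \<Rightarrow> real \<Rightarrow> nat \<Rightarrow> int \<Rightarrow> real" where
  "bohr_weight \<beta> \<alpha> K n = norm (\<Sum>k<K. ucis (real k * (\<beta> * of_int n - \<alpha>))) ^ 2"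

lemma bohr_weight_nonneg [simp]: "bohr_weight \<beta> \<alpha> K n \<ge> 0"
  by (simp add: bohr_weight_def)

text \<open>Within \<open>1 / (6 * K)\<close> of an integer, each phase \<open>k * t\<close> with
  \<open>k < K\<close> is at most a sixth of a turn, so each term has real part at least
  \<open>cos (pi / 3) = 1 / 2\<close>.\<close>

lemma bohr_weight_ge:
  assumes "int_dist (\<beta> * of_int n - \<alpha>) \<le> 1 / (6 * real K)" "K \<ge> 1"
  shows "bohr_weight \<beta> \<alpha> K n \<ge> real K ^ 2 / 4"
proof -
  define t where "t = \<beta> * of_int n - \<alpha>"
  define s where "s = t - of_int (round t)"
  have s: "\<bar>s\<bar> \<le> 1 / (6 * real K)" using assms by (simp add: s_def t_def int_dist_def)
  have "1 / 2 \<le> Re (ucis (real k * t))" if "k < K" for k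
  proof -
    have "real k * t = real k * s + of_int (int k * round t)"
      by (simp add: s_def algebra_simps)
    hence "ucis (real k * t) = ucis (real k * s)" by (simp only: ucis_add_int)
    hence "Re (ucis (real k * t)) = cos \<bar>2 * pi * (real k * s)\<bar>" by (simp add: ucis_def)
    also have "\<dots> \<ge> cos (pi / 3)"
    proof (rule cos_monotone_0_pi_le)
      have "real k * \<bar>s\<bar> \<le> real K * (1 / (6 * real K))"
        using that s by (intro mult_mono) auto
      hence "real k * \<bar>s\<bar> \<le> 1 / 6" using assms by simp
      hence "2 * pi * (real k * \<bar>s\<bar>) \<le> 2 * pi * (1 / 6)" by (intro mult_left_mono) auto
      thus "\<bar>2 * pi * (real k * s)\<bar> \<le> pi / 3" by (simp add: abs_mult)
    qed auto
    finally show ?thesis by (simp add: cos_60)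
  qed
  hence "(\<Sum>k<K. 1 / 2) \<le> Re (\<Sum>k<K. ucis (real k * t))"
    unfolding Re_sum by (intro sum_mono) auto
  also have "\<dots> \<le> norm (\<Sum>k<K. ucis (real k * t))" by (rule complex_Re_le_cmod)
  finally have "(real K / 2) ^ 2 \<le> norm (\<Sum>k<K. ucis (real k * t)) ^ 2"
    by (intro power_mono) auto
  thus ?thesis by (simp add: bohr_weight_def t_def power_divide)
qed

text \<open>
  The condition \<open>D dvd n\<close> is detected by additive characters modulo \<open>D\<close>; the main term is the
  contribution of the zero frequency, and every other frequency stays away from the integers.
\<close>

lemma bohr_weight_divisible_sum:
  assumes bad: "bad_const c \<beta>" and D: "D \<ge> 1"
  shows "\<bar>(\<Sum>i<L. \<Sum>j<L. if int D dvd n0 + int i - int j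
             then bohr_weight \<beta> \<alpha> K (n0 + int i - int j) else 0) - real K * real L ^ 2 / real D\<bar>
         \<le> 9 * real K ^ 3 * real D ^ 4 / c ^ 2"
proof -
  note c = bad_constD[OF bad]
  define Q where "Q t = norm (\<Sum>i<L. ucis (real i * t)) ^ 2" for t
  \<comment> \<open>The combined frequency: \<open>a / D\<close> from the character modulo
    \<open>D\<close> and \<open>(k - l) * \<beta>\<close> from expanding the weight. The main term
    comes from \<open>a = 0\<close>, \<open>k = l\<close>, which occurs \<open>K\<close>
    times.\<close>
  define \<tau> where "\<tau> a k l = real a / real D + (real k - real l) * \<beta>" for a k l :: nat
  define ph where "ph a k l = ucis (\<tau> a k l * of_int n0 - (real k - real l) * \<alpha>)" for a k l
  define S where "S = (\<Sum>i<L. \<Sum>j<L. if int D dvd n0 + int i - int j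
             then bohr_weight \<beta> \<alpha> K (n0 + int i - int j) else 0)"
  have trm: "of_real (if int D dvd n then bohr_weight \<beta> \<alpha> K n else 0) =
      (\<Sum>a<D. \<Sum>k<K. \<Sum>l<K. ucis (\<tau> a k l * of_int n - (real k - real l) * \<alpha>)) / of_nat D" for n
  proof -
    have "(\<Sum>a<D. \<Sum>k<K. \<Sum>l<K. ucis (\<tau> a k l * of_int n - (real k - real l) * \<alpha>)) =
       (\<Sum>a<D. \<Sum>k<K. \<Sum>l<K. ucis (real a * of_int n / real D) *
          ucis ((real k - real l) * (\<beta> * of_int n - \<alpha>)))"
      by (intro sum.cong refl) (simp add: \<tau>_def algebra_simps flip: ucis_add)
    also have "\<dots> = (\<Sum>a<D. ucis (real a * of_int n / real D)) *
        of_real (bohr_weight \<beta> \<alpha> K n)"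
      by (simp only: bohr_weight_def flip: norm_sum_ucis_square sum_distrib_left sum_distrib_right)
    also have "\<dots> = (if int D dvd n then of_nat D else 0) * of_real (bohr_weight \<beta> \<alpha> K n)"
      by (simp only: sum_ucis_multiples[OF D])
    finally show ?thesis using D by simp
  qed
  have "of_real S = (\<Sum>i<L. \<Sum>j<L. (\<Sum>a<D. \<Sum>k<K. \<Sum>l<K.
      ucis (\<tau> a k l * of_int (n0 + int i - int j) - (real k - real l) * \<alpha>)) / of_nat D)"
    unfolding S_def of_real_sum trm ..
  also have "\<dots> = (\<Sum>i<L. \<Sum>j<L. (\<Sum>a<D. \<Sum>k<K. \<Sum>l<K.
      ph a k l * ucis ((real i - real j) * \<tau> a k l))) / of_nat D"
    unfolding sum_divide_distrib ph_def ucis_add[symmetric]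
    by (intro sum.cong refl arg_cong2[where f = "(/)"] arg_cong[where f = ucis])
       (simp add: algebra_simps)
  also have "(\<Sum>i<L. \<Sum>j<L. (\<Sum>a<D. \<Sum>k<K. \<Sum>l<K. ph a k l * ucis ((real i - real j) * \<tau> a k l))) =
      (\<Sum>a<D. \<Sum>i<L. \<Sum>j<L. (\<Sum>k<K. \<Sum>l<K. ph a k l * ucis ((real i - real j) * \<tau> a k l)))"
    by (rule sum_swap3)
  also have "\<dots> = (\<Sum>a<D. \<Sum>k<K. \<Sum>i<L. \<Sum>j<L. (\<Sum>l<K. ph a k l * ucis ((real i - real j) * \<tau> a k l)))"
    by (rule sum.cong[OF refl], rule sum_swap3)
  also have "\<dots> = (\<Sum>a<D. \<Sum>k<K. \<Sum>l<K. \<Sum>i<L. \<Sum>j<L. ph a k l * ucis ((real i - real j) * \<tau> a k l))"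
    by (rule sum.cong[OF refl], rule sum.cong[OF refl], rule sum_swap3)
  also have "\<dots> = (\<Sum>a<D. \<Sum>k<K. \<Sum>l<K. ph a k l * of_real (Q (\<tau> a k l)))"
    by (simp only: Q_def flip: norm_sum_ucis_square sum_distrib_left)
  finally have S_eq: "of_real S = (\<Sum>a<D. \<Sum>k<K. \<Sum>l<K. ph a k l * of_real (Q (\<tau> a k l))) / of_nat D" .
  define diag where "diag a k l \<longleftrightarrow> a = 0 \<and> k = l" for a k l :: nat
  define err where "err = (\<Sum>a<D. \<Sum>k<K. \<Sum>l<K. if diag a k l then 0 else ph a k l * of_real (Q (\<tau> a k l)))"
  have Q0: "Q 0 = real L ^ 2" by (simp add: Q_def)
  have "(\<Sum>a<D. \<Sum>k<K. \<Sum>l<K. ph a k l * of_real (Q (\<tau> a k l))) =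
      (\<Sum>a<D. \<Sum>k<K. \<Sum>l<K. (if diag a k l then of_real (real L ^ 2) else 0) +
         (if diag a k l then 0 else ph a k l * of_real (Q (\<tau> a k l))))"
    by (intro sum.cong refl) (auto simp: diag_def ph_def \<tau>_def Q0)
  also have "\<dots> = (\<Sum>a<D. \<Sum>k<K. \<Sum>l<K. (if diag a k l then of_real (real L ^ 2) else 0)) + err"
    by (simp only: sum.distrib err_def)
  also have "(\<Sum>a<D. \<Sum>k<K. \<Sum>l<K. (if diag a k l then of_real (real L ^ 2) else 0)) =
      (\<Sum>a<D. if a = 0 then of_real (real K * real L ^ 2) else (0 :: complex))"
    by (intro sum.cong refl) (auto simp: diag_def)
  also have "\<dots> = of_real (real K * real L ^ 2)"
    using D by simp
  finally have "of_real S = (of_real (real K * real L ^ 2) + err) / of_nat D"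
    using S_eq by simp
  hence "of_real (S - real K * real L ^ 2 / real D) = err / of_nat D"
    by (simp add: add_divide_distrib)
  hence abs_eq: "\<bar>S - real K * real L ^ 2 / real D\<bar> = norm err / real D"
    by (metis norm_divide norm_of_nat norm_of_real)
  have "norm err \<le> (\<Sum>a<D. \<Sum>k<K. \<Sum>l<K. if diag a k l then 0 else Q (\<tau> a k l))"
    unfolding err_def
    by (intro order_trans[OF norm_sum] sum_mono) (auto simp: norm_mult norm_power ph_def Q_def)
  also have "\<dots> \<le> (\<Sum>a<D. real K * real D ^ 2 + 8 * real K ^ 3 * real D ^ 4 / c ^ 2)"
  proof (rule sum_mono)
    fix a assume a: "a \<in> {..<D}"
    define f where "f h = real D ^ 2 / int_dist (real h * (real D * \<beta>)) ^ 2" for h :: nat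
    have Qle: "Q t \<le> 1 / int_dist t ^ 2" if "int_dist t > 0" for t
      using norm_sum_ucis_le[OF that, of L] unfolding Q_def
      by (metis norm_ge_zero power_mono power_one_over)
    \<comment> \<open>A fraction \<open>a / D\<close> that is not an integer keeps distance at least
      \<open>1 / D\<close> from the integers.\<close>
    have diag: "Q (\<tau> a k k) \<le> real D ^ 2" if "a \<noteq> 0" for k
    proof -
      have "1 / real D \<le> int_dist (real a / real D)"
      proof (rule ccontr)
        assume "\<not> 1 / real D \<le> int_dist (real a / real D)"
        hence "real D * int_dist (real a / real D) < 1" using D by (simp add: field_simps)
        moreover have "real D * int_dist (real a / real D) =
            \<bar>real D * (real a / real D - of_int (round (real a / real D)))\<bar>"
          by (simp add: int_dist_def abs_mult)
        moreover have "real D * (real a / real D - of_int (round (real a / real D))) =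
            real_of_int (int a - int D * round (real a / real D))"
          using D by (simp add: right_diff_distrib)
        ultimately have "int a = int D * round (real a / real D)" by linarith
        hence "int D dvd int a" by (metis dvd_triv_left)
        with a that show False by (auto dest: nat_dvd_not_less simp: int_dvd_int_iff)
      qed
      moreover have D': "1 / real D > 0" using D by simp
      ultimately have i: "int_dist (\<tau> a k k) \<ge> 1 / real D" "int_dist (\<tau> a k k) > 0"
        by (simp add: \<tau>_def, simp add: \<tau>_def less_le_trans[OF D'])
      have "Q (\<tau> a k k) \<le> 1 / int_dist (\<tau> a k k) ^ 2" by (rule Qle) fact
      also have "\<dots> \<le> 1 / (1 / real D) ^ 2"
        using i D by (intro divide_left_mono power_mono mult_pos_pos) auto
      finally show ?thesis by (simp add: power_divide)
    qed
    \<comment> \<open>Multiplying the frequency by \<open>D\<close> turns \<open>a / D\<close> into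
      an integer and leaves \<open>h * (D * \<beta>)\<close>, to which bad approximability applies;
      the price is a factor \<open>D\<close> in the distance.\<close>
    have off: "Q (\<tau> a k l) \<le> f (if l < k then k - l else l - k)" if "k \<noteq> l" for k l
    proof -
      define h where "h = (if l < k then k - l else l - k)"
      have h: "h \<ge> 1" using that by (auto simp: h_def)
      have "int_dist (real D * \<tau> a k l) = int_dist ((real k - real l) * (real D * \<beta>) + of_int (int a))"
        using D by (simp add: \<tau>_def algebra_simps)
      also have "\<dots> = int_dist ((real k - real l) * (real D * \<beta>))" by (rule int_dist_add_int)
      also have "\<dots> = int_dist (real h * (real D * \<beta>))"
      proof (cases "l < k")
        case False
        hence "(real k - real l) * (real D * \<beta>) = - (real h * (real D * \<beta>))"
          using that by (simp add: h_def of_nat_diff algebra_simps)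
        thus ?thesis by simp
      qed (simp add: h_def of_nat_diff)
      finally have eq: "int_dist (real D * \<tau> a k l) = int_dist (real h * (real D * \<beta>))" .
      have pos: "int_dist (real h * (real D * \<beta>)) > 0"
        using bad_constD(3)[OF bad_const_mult[OF bad D] h] .
      have ge: "int_dist (real h * (real D * \<beta>)) / real D \<le> int_dist (\<tau> a k l)"
        using int_dist_mult_nat_le[of D "\<tau> a k l"] D unfolding eq by (simp add: field_simps)
      moreover have pos': "int_dist (real h * (real D * \<beta>)) / real D > 0" using pos D by simp
      ultimately have "int_dist (\<tau> a k l) > 0" by linarith
      hence "Q (\<tau> a k l) \<le> 1 / int_dist (\<tau> a k l) ^ 2" by (rule Qle)
      also have "\<dots> \<le> 1 / (int_dist (real h * (real D * \<beta>)) / real D) ^ 2"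
        using ge pos' \<open>int_dist (\<tau> a k l) > 0\<close>
        by (intro divide_left_mono power_mono mult_pos_pos zero_less_power) auto
      also have "\<dots> = f h" by (simp add: f_def power_divide)
      finally show ?thesis by (simp add: h_def)
    qed
    have "(\<Sum>h=1..<K. f h) = real D ^ 2 * (\<Sum>h=1..<K. 1 / int_dist (real h * (real D * \<beta>)) ^ 2)"
      by (simp add: f_def sum_distrib_left)
    also have "\<dots> \<le> real D ^ 2 * (4 * real K ^ 2 / (c / real D) ^ 2)"
      by (intro mult_left_mono sum_int_dist_inverse_square_le bad_const_mult bad D) auto
    finally have sumf: "(\<Sum>h=1..<K. f h) \<le> real D ^ 2 * (4 * real K ^ 2 / (c / real D) ^ 2)" .
    have "(\<Sum>k<K. \<Sum>l<K. if diag a k l then 0 else Q (\<tau> a k l)) \<le>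
        (\<Sum>k<K. real D ^ 2 + (\<Sum>l | l < K \<and> l \<noteq> k. f (if l < k then k - l else l - k)))"
    proof (rule sum_mono)
      fix k assume k: "k \<in> {..<K}"
      have "{..<K} = insert k {l. l < K \<and> l \<noteq> k}" using k by auto
      hence "(\<Sum>l<K. if diag a k l then 0 else Q (\<tau> a k l)) =
          (if diag a k k then 0 else Q (\<tau> a k k)) +
          (\<Sum>l | l < K \<and> l \<noteq> k. if diag a k l then 0 else Q (\<tau> a k l))"
        by simp
      also have "\<dots> \<le> real D ^ 2 + (\<Sum>l | l < K \<and> l \<noteq> k. f (if l < k then k - l else l - k))"
      proof (intro add_mono sum_mono)
        show "(if diag a k k then 0 else Q (\<tau> a k k)) \<le> real D ^ 2"
          using diag[of k] by (cases "a = 0") (simp_all add: diag_def)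
        show "(if diag a k l then 0 else Q (\<tau> a k l)) \<le> f (if l < k then k - l else l - k)"
          if "l \<in> {l. l < K \<and> l \<noteq> k}" for l
          using off[of k l] that by (simp only: diag_def mem_Collect_eq) (metis (full_types))
      qed
      finally show "(\<Sum>l<K. if diag a k l then 0 else Q (\<tau> a k l)) \<le> \<dots>" .
    qed
    also have "\<dots> = real K * real D ^ 2 + (\<Sum>k<K. \<Sum>l | l < K \<and> l \<noteq> k. f (if l < k then k - l else l - k))"
      by (simp add: sum.distrib)
    also have "\<dots> \<le> real K * real D ^ 2 + 2 * real K * (\<Sum>h=1..<K. f h)"
      by (intro add_left_mono sum_offdiag_le) (auto simp: f_def)
    also have "\<dots> \<le> real K * real D ^ 2 + 2 * real K * (real D ^ 2 * (4 * real K ^ 2 / (c / real D) ^ 2))"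
      by (intro add_left_mono mult_left_mono sumf) simp
    also have "real K * real D ^ 2 + 2 * real K * (real D ^ 2 * (4 * real K ^ 2 / (c / real D) ^ 2)) =
        real K * real D ^ 2 + 8 * real K ^ 3 * real D ^ 4 / c ^ 2"
      using D c(1) by (simp add: field_simps eval_nat_numeral)
    finally show "(\<Sum>k<K. \<Sum>l<K. if diag a k l then 0 else Q (\<tau> a k l)) \<le>
        real K * real D ^ 2 + 8 * real K ^ 3 * real D ^ 4 / c ^ 2" .
  qed
  also have "\<dots> = real D * (real K * real D ^ 2 + 8 * real K ^ 3 * real D ^ 4 / c ^ 2)" by simp
  finally have "norm err \<le> real D * (real K * real D ^ 2 + 8 * real K ^ 3 * real D ^ 4 / c ^ 2)" .
  hence "norm err / real D \<le> real K * real D ^ 2 + 8 * real K ^ 3 * real D ^ 4 / c ^ 2"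
    using D by (simp add: field_simps)
  \<comment> \<open>The term from \<open>k = l\<close> is absorbed into the off-diagonal error
    because \<open>c \<le> 1 / 2\<close>; hence 9 instead of 8.\<close>
  moreover have "real K * real D ^ 2 \<le> real K ^ 3 * real D ^ 4 / c ^ 2"
  proof (cases "K = 0")
    case False
    have "real K * real D ^ 2 * c ^ 2 \<le> real K ^ 3 * real D ^ 4 * 1 ^ 2"
      using False D c(1) bad_const_le_half[OF bad]
      by (intro mult_mono power_mono power_increasing) (auto intro!: self_le_power)
    thus ?thesis using c(1) by (simp add: field_simps)
  qed simp
  ultimately have "\<bar>S - real K * real L ^ 2 / real D\<bar> \<le> 9 * (real K ^ 3 * real D ^ 4 / c ^ 2)"
    unfolding abs_eq by simp
  thus ?thesis by (simp add: S_def)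
qed

lemma sum_UN_le:
  fixes f :: "'a \<Rightarrow> real"
  assumes "finite I" "\<And>i. i \<in> I \<Longrightarrow> finite (B i)" "\<And>x. f x \<ge> 0"
  shows "sum f (\<Union>i\<in>I. B i) \<le> (\<Sum>i\<in>I. sum f (B i))"
  using assms(1,2)
proof (induction I rule: finite_induct)
  case (insert i I)
  have "sum f (B i \<union> (\<Union>i\<in>I. B i)) \<le> sum f (B i) + sum f (\<Union>i\<in>I. B i)"
    using sum.union_inter[of "B i" "\<Union>i\<in>I. B i" f] insert assms(3)
      sum_nonneg[of "B i \<inter> (\<Union>i\<in>I. B i)" f] by auto
  with insert show ?case by auto
qed auto

text \<open>Selberg's upper bound with the Bohr condition built into the weight: on \<open>Z\<close>
  the squared divisor sum is 1, as only \<open>d = 1\<close> divides, and the Fejer weight is at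
  least \<open>K ^ 2 / 4\<close>. Expanding the square leaves sums over multiples of
  \<open>lcm d e\<close>, whose main terms form the quadratic form bounded in
  \<open>selberg_weights\<close>.\<close>

lemma sieve_bohr_set:
  fixes b :: int
  assumes bad: "bad_const c \<beta>" and L: "L \<ge> 1" and K: "K \<ge> 1" and R: "R \<ge> 1" and fin: "finite Z"
    and near: "\<And>n. n \<in> Z \<Longrightarrow> \<bar>n - b\<bar> \<le> int (L div 2)"
    and bohr: "\<And>n. n \<in> Z \<Longrightarrow> int_dist (\<beta> * of_int n - \<alpha>) \<le> 1 / (6 * real K)"
    and sift: "\<And>n d. n \<in> Z \<Longrightarrow> d \<in> {1..R} \<Longrightarrow> int d dvd n \<Longrightarrow> d = 1"
  shows "real (card Z) \<le> 16 * real L / (real K * ln (real R + 1)) + 72 * real R ^ 12 * real K / (real L * c ^ 2)"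
proof -
  note c = bad_constD[OF bad]
  obtain l where l: "l 1 = 1" "\<And>d. \<bar>l d\<bar> \<le> real d"
      "(\<Sum>d=1..R. \<Sum>e=1..R. l d * l e / real (lcm d e)) \<le> 2 / ln (real R + 1)"
    by (rule selberg_weights[OF R]) blast
  define W where "W = bohr_weight \<beta> \<alpha> K"
  define \<Phi> where "\<Phi> n = (\<Sum>d=1..R. if int d dvd n then l d else 0) ^ 2" for n :: int
  define g where "g n = \<Phi> n * W n" for n
  define A where "A = (\<Sum>i<L. \<Sum>j<L. g (b + int i - int j))"
  have g_nonneg: "g n \<ge> 0" for n by (simp add: g_def \<Phi>_def W_def)
  \<comment> \<open>Every \<open>n\<close> within \<open>L div 2\<close> of \<open>b\<close> has at
    least \<open>h\<close> representations \<open>b + i - j\<close> with \<open>i, j < L\<close>;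
    this compensates for the triangular density of the differences.\<close>
  define h where "h = L - L div 2"
  have h: "real h \<ge> real L / 2" unfolding h_def by (simp add: of_nat_diff)
  have gZ: "g n \<ge> real K ^ 2 / 4" if "n \<in> Z" for n
  proof -
    have "(\<Sum>d=1..R. if int d dvd n then l d else 0) = (\<Sum>d=1..R. if d = 1 then l 1 else 0)"
      using sift[OF that] by (intro sum.cong) auto
    hence "\<Phi> n = 1" using R l(1) by (simp add: \<Phi>_def)
    thus ?thesis using bohr_weight_ge[OF bohr[OF that] K] by (simp add: g_def W_def)
  qed
  \<comment> \<open>Encodes the \<open>t\<close>-th representation of \<open>n\<close>: the
    difference of the coordinates recovers \<open>n\<close> and their minimum recovers
    \<open>t\<close>, which gives injectivity.\<close>
  define pt where "pt = (\<lambda>(n, t). if n \<ge> b then (t + nat (n - b), t) else (t, t + nat (b - n)))"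
  have pt_diff: "b + int (fst (pt (n, t))) - int (snd (pt (n, t))) = n" for n t
    by (auto simp: pt_def)
  have pt_min: "min (fst (pt (n, t))) (snd (pt (n, t))) = t" for n t
    by (auto simp: pt_def)
  have inj: "inj_on pt (Z \<times> {..<h})"
    by (rule inj_onI) (metis pt_diff pt_min surj_pair)
  have sub: "pt ` (Z \<times> {..<h}) \<subseteq> {..<L} \<times> {..<L}"
  proof (rule image_subsetI)
    fix x assume "x \<in> Z \<times> {..<h}"
    then obtain n t where x: "x = (n, t)" "n \<in> Z" "t < h" by auto
    have "nat \<bar>n - b\<bar> \<le> L div 2" using near[OF x(2)] by simp
    hence "t + nat \<bar>n - b\<bar> < L" using x(3) by (simp add: h_def)
    thus "pt x \<in> {..<L} \<times> {..<L}" by (auto simp: x pt_def abs_if split: if_splits)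
  qed
  have "real (card Z) * (real h * (real K ^ 2 / 4)) = (\<Sum>x\<in>Z \<times> {..<h}. real K ^ 2 / 4)"
    by (simp add: card_cartesian_product)
  also have "\<dots> \<le> (\<Sum>x\<in>Z \<times> {..<h}. g (b + int (fst (pt x)) - int (snd (pt x))))"
  proof (rule sum_mono)
    fix x assume "x \<in> Z \<times> {..<h}"
    then obtain n t where x: "x = (n, t)" "n \<in> Z" by auto
    show "real K ^ 2 / 4 \<le> g (b + int (fst (pt x)) - int (snd (pt x)))"
      unfolding x(1) pt_diff by (rule gZ[OF x(2)])
  qed
  also have "\<dots> = (\<Sum>x\<in>pt ` (Z \<times> {..<h}). g (b + int (fst x) - int (snd x)))"
    by (subst sum.reindex[OF inj]) simp
  also have "\<dots> \<le> (\<Sum>x\<in>{..<L} \<times> {..<L}. g (b + int (fst x) - int (snd x)))"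
    by (intro sum_mono2 sub) (auto simp: g_nonneg)
  also have "\<dots> = A"
    unfolding A_def by (subst sum.cartesian_product) (simp add: case_prod_unfold)
  finally have lower: "real (card Z) * (real h * (real K ^ 2 / 4)) \<le> A" .
  define S where "S D = (\<Sum>i<L. \<Sum>j<L. if int D dvd b + int i - int j
             then W (b + int i - int j) else 0)" for D
  have g_eq: "g n = (\<Sum>d=1..R. \<Sum>e=1..R. l d * l e * (if int (lcm d e) dvd n then W n else 0))" for n
  proof -
    have "\<Phi> n = (\<Sum>d=1..R. \<Sum>e=1..R. (if int d dvd n then l d else 0) * (if int e dvd n then l e else 0))"
      by (simp add: \<Phi>_def power2_eq_square sum_product)
    also have "\<dots> = (\<Sum>d=1..R. \<Sum>e=1..R. l d * l e * (if int (lcm d e) dvd n then 1 else 0))"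
      by (intro sum.cong refl) (auto simp: lcm_least_iff simp flip: lcm_int_int_eq)
    finally show ?thesis
      by (auto simp: g_def sum_distrib_right intro!: sum.cong)
  qed
  have "A = (\<Sum>i<L. \<Sum>d=1..R. \<Sum>e=1..R. \<Sum>j<L. l d * l e *
      (if int (lcm d e) dvd b + int i - int j then W (b + int i - int j) else 0))"
    unfolding A_def g_eq
    by (rule sum.cong[OF refl], rule sum_swap3[symmetric])
  also have "\<dots> = (\<Sum>d=1..R. \<Sum>e=1..R. \<Sum>i<L. \<Sum>j<L. l d * l e *
      (if int (lcm d e) dvd b + int i - int j then W (b + int i - int j) else 0))"
    by (rule sum_swap3[symmetric])
  also have "\<dots> = (\<Sum>d=1..R. \<Sum>e=1..R. l d * l e * S (lcm d e))"
    by (simp only: S_def sum_distrib_left)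
  \<comment> \<open>In the error, \<open>lcm d e \<le> R ^ 2\<close> contributes
    \<open>R ^ 8\<close> and the weights contribute \<open>R ^ 2\<close>; summing over the
    \<open>R ^ 2\<close> pairs then raises it to \<open>R ^ 12\<close>.\<close>
  also have "\<dots> \<le> (\<Sum>d=1..R. \<Sum>e=1..R. real K * real L ^ 2 * (l d * l e / real (lcm d e)) +
      9 * real K ^ 3 * real R ^ 10 / c ^ 2)"
  proof (intro sum_mono)
    fix d e assume de: "d \<in> {1..R}" "e \<in> {1..R}"
    define D where "D = lcm d e"
    have D: "D \<ge> 1" using de by (auto simp: D_def Suc_le_eq lcm_pos_nat)
    have "D dvd d * e" by (auto simp: D_def)
    hence "D \<le> d * e" using de by (intro dvd_imp_le) auto
    also have "\<dots> \<le> R * R" using de by (intro mult_mono) auto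
    finally have "real D \<le> real R ^ 2" by (simp add: power2_eq_square flip: of_nat_mult)
    hence D4: "real D ^ 4 \<le> (real R ^ 2) ^ 4" by (intro power_mono) auto
    have "\<bar>l d * l e\<bar> \<le> real d * real e"
      unfolding abs_mult using l(2) by (intro mult_mono) auto
    also have "\<dots> \<le> real R * real R" using de by (intro mult_mono) auto
    finally have ll: "\<bar>l d * l e\<bar> \<le> real R ^ 2" by (simp add: power2_eq_square)
    have "l d * l e * S D - l d * l e * (real K * real L ^ 2 / real D) \<le>
        \<bar>l d * l e\<bar> * \<bar>S D - real K * real L ^ 2 / real D\<bar>"
      unfolding abs_mult[symmetric] right_diff_distrib[symmetric] by (rule abs_ge_self)
    also have "\<dots> \<le> real R ^ 2 * (9 * real K ^ 3 * real D ^ 4 / c ^ 2)"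
      using bohr_weight_divisible_sum[OF bad D, of b \<alpha> K L] ll unfolding S_def W_def
      by (intro mult_mono) auto
    also have "\<dots> \<le> real R ^ 2 * (9 * real K ^ 3 * (real R ^ 2) ^ 4 / c ^ 2)"
      using D4 by (intro mult_left_mono divide_right_mono) auto
    also have "\<dots> = 9 * real K ^ 3 * real R ^ 10 / c ^ 2"
      by (simp flip: power_mult power_add)
    finally show "l d * l e * S (lcm d e) \<le> real K * real L ^ 2 * (l d * l e / real (lcm d e)) +
        9 * real K ^ 3 * real R ^ 10 / c ^ 2"
      by (simp add: D_def mult_ac)
  qed
  also have "\<dots> = real K * real L ^ 2 * (\<Sum>d=1..R. \<Sum>e=1..R. l d * l e / real (lcm d e)) +
      real R ^ 2 * (9 * real K ^ 3 * real R ^ 10 / c ^ 2)"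
    by (simp add: sum.distrib sum_distrib_left power2_eq_square)
  also have "\<dots> \<le> real K * real L ^ 2 * (2 / ln (real R + 1)) + 9 * real K ^ 3 * real R ^ 12 / c ^ 2"
  proof (intro add_mono mult_left_mono)
    have "real R ^ 12 = real R ^ 2 * real R ^ 10" by (simp flip: power_add)
    thus "real R ^ 2 * (9 * real K ^ 3 * real R ^ 10 / c ^ 2) \<le> 9 * real K ^ 3 * real R ^ 12 / c ^ 2"
      by (simp only: times_divide_eq_right mult_ac order_refl)
  qed (use l(3) in auto)
  finally have upper: "A \<le> real K * real L ^ 2 * (2 / ln (real R + 1)) + 9 * real K ^ 3 * real R ^ 12 / c ^ 2" .
  have pos: "real L > 0" "real K > 0" "ln (real R + 1) > 0" "c > 0" using L K R c(1) by auto
  have "real (card Z) * (real L / 2 * (real K ^ 2 / 4)) \<le> real (card Z) * (real h * (real K ^ 2 / 4))"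
    using h by (intro mult_left_mono mult_right_mono) auto
  with lower upper have "real (card Z) * (real L / 2 * (real K ^ 2 / 4)) \<le>
      real K * real L ^ 2 * (2 / ln (real R + 1)) + 9 * real K ^ 3 * real R ^ 12 / c ^ 2" by linarith
  hence "real (card Z) \<le> (real K * real L ^ 2 * (2 / ln (real R + 1)) + 9 * real K ^ 3 * real R ^ 12 / c ^ 2) /
      (real L / 2 * (real K ^ 2 / 4))"
    using pos by (subst pos_le_divide_eq) auto
  also have "\<dots> = 16 * real L / (real K * ln (real R + 1)) + 72 * real R ^ 12 * real K / (real L * c ^ 2)"
    using pos by (simp add: field_simps eval_nat_numeral)
  finally show ?thesis .
qed

text \<open>The sifting level \<open>2 ^ (j div 12)\<close> has twelfth power at most
  \<open>2 ^ j\<close>, which the sieve error can afford, while its logarithm is still of order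
  \<open>j + 1\<close>. The value 48 covers the rounding in \<open>j div 12\<close> and
  \<open>ln 2 \<ge> 1 / 2\<close>.\<close>

lemma ln_power_two_div_ge: "(real j + 1) / 48 \<le> ln (real (2 ^ (j div 12)) + 1)"
proof -
  define m where "m = max 1 (j div 12)"
  have "(2 :: real) ^ m \<le> real (2 ^ (j div 12)) + 1"
    by (cases "j div 12 = 0") (auto simp: m_def max_def)
  hence "ln ((2 :: real) ^ m) \<le> ln (real (2 ^ (j div 12)) + 1)"
    by (subst ln_le_cancel_iff) (auto intro: add_pos_nonneg)
  moreover have "ln ((2 :: real) ^ m) = real m * ln 2" by (simp add: ln_realpow)
  moreover have "real m * (1 / 2) \<le> real m * ln 2"
    using ln2_ge_two_thirds by (intro mult_left_mono) auto
  moreover have "j + 1 \<le> 24 * m"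
    unfolding m_def by linarith
  hence "real (j + 1) \<le> real (24 * m)" by (simp only: of_nat_le_iff)
  hence "(real j + 1) / 48 \<le> real m * (1 / 2)" by simp
  ultimately show ?thesis by (metis order_trans)
qed

text \<open>The sieve is applied to a window around \<open>M = 2 ^ j * p\<close> with
  \<open>L = 2 * M\<close> and \<open>K\<close> about \<open>p / (6 * C)\<close>. The main term is
  then of order \<open>2 ^ j / (j + 1)\<close>, and the error \<open>R ^ 12 * K / L\<close> stays
  bounded because \<open>R ^ 12 \<le> 2 ^ j\<close>. A prime \<open>q > M \<ge> R\<close> has no
  divisor in \<open>{2..R}\<close>, so it is sifted.\<close>

lemma card_primes_dyadic_bohr:
  assumes bad: "bad_const c \<beta>" and C: "C > 0"
  defines "C' \<equiv> 18432 * C + 12 / (C * c ^ 2)"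
  assumes p: "real p \<ge> 12 * C" "p \<ge> 1"
  shows "real (card {q. prime q \<and> 2 ^ j * p < q \<and> q \<le> 2 ^ Suc j * p \<and>
      int_dist (\<beta> * (real q - real p)) \<le> C / real p}) \<le> C' * 2 ^ j / (real j + 1)"
proof -
  note c = bad_constD[OF bad]
  define Q where "Q = {q. prime q \<and> 2 ^ j * p < q \<and> q \<le> 2 ^ Suc j * p \<and>
      int_dist (\<beta> * (real q - real p)) \<le> C / real p}"
  define Z where "Z = int ` Q"
  define M where "M = 2 ^ j * p"
  define L where "L = 2 * M"
  define K where "K = nat \<lfloor>real p / (6 * C)\<rfloor>"
  define R :: nat where "R = 2 ^ (j div 12)"
  have finQ: "finite Q" by (rule finite_subset[of _ "{..2 ^ Suc j * p}"]) (auto simp: Q_def)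
  have pC: "real p / (6 * C) \<ge> 2" using p C by (simp add: field_simps)
  have K: "real K \<le> real p / (6 * C)" "real p / (6 * C) - 1 < real K" "K \<ge> 1"
    unfolding K_def using pC by linarith+
  have K': "real p / (12 * C) \<le> real K" using K(2) pC by (simp add: field_simps)
  have M: "M \<ge> 1" "real M = 2 ^ j * real p" using p by (auto simp: M_def)
  have R: "R \<ge> 1" by (simp add: R_def)
  have "R ^ 12 \<le> 2 ^ j" unfolding R_def power_mult[symmetric] by (intro power_increasing) auto
  hence R12: "real R ^ 12 \<le> 2 ^ j" by (metis of_nat_le_iff of_nat_numeral of_nat_power)
  have RM: "R \<le> M"
  proof -
    have "R \<le> 2 ^ j" unfolding R_def by (intro power_increasing) auto
    also have "\<dots> \<le> M" using p by (simp add: M_def)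
    finally show ?thesis .
  qed
  have "real (card Z) \<le> 16 * real L / (real K * ln (real R + 1)) + 72 * real R ^ 12 * real K / (real L * c ^ 2)"
  proof (rule sieve_bohr_set[OF bad, where b = "int M" and \<alpha> = "\<beta> * real p"])
    show "L \<ge> 1" "K \<ge> 1" "R \<ge> 1" "finite Z" using M K R finQ by (auto simp: L_def Z_def)
    fix n assume "n \<in> Z"
    then obtain q where q: "n = int q" "q \<in> Q" by (auto simp: Z_def)
    show "\<bar>n - int M\<bar> \<le> int (L div 2)"
    proof -
      have "M < q" "q \<le> 2 * M" using q by (auto simp: M_def Q_def)
      thus ?thesis using q by (simp add: L_def)
    qed
    have "C / real p \<le> 1 / (6 * real K)"
      using K C p by (simp add: field_simps)
    thus "int_dist (\<beta> * of_int n - \<beta> * real p) \<le> 1 / (6 * real K)"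
      using q by (simp add: Q_def right_diff_distrib)
    fix d assume d: "d \<in> {1..R}" "int d dvd n"
    have "d dvd q" "prime q" "q > M" using d q by (auto simp: Q_def M_def)
    hence "d = 1 \<or> d = q" by (auto simp: prime_nat_iff)
    thus "d = 1" using d RM \<open>q > M\<close> by auto
  qed
  also have "16 * real L / (real K * ln (real R + 1)) \<le>
      16 * (2 * 2 ^ j * real p) / (real p / (12 * C) * ((real j + 1) / 48))"
    using K' C p ln_power_two_div_ge[of j] M
    by (intro frac_le mult_mono) (auto simp: L_def R_def)
  also have "\<dots> = 18432 * C * 2 ^ j / (real j + 1)"
    using p C by (simp add: divide_simps)
  also have "72 * real R ^ 12 * real K / (real L * c ^ 2) \<le>
      72 * 2 ^ j * (real p / (6 * C)) / (2 * 2 ^ j * real p * c ^ 2)"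
    using R12 K C M c(1) p by (intro frac_le mult_mono) (auto simp: L_def)
  also have "\<dots> = 6 / (C * c ^ 2)" using p C c(1) by (simp add: field_simps)
  \<comment> \<open>A bounded error is harmless in every block, since
    \<open>2 * 2 ^ j / (j + 1)\<close> is at least 1.\<close>
  also have "\<dots> \<le> 6 / (C * c ^ 2) * (2 * 2 ^ j / (real j + 1))"
  proof -
    have "j + 1 \<le> 2 * 2 ^ j" using less_exp[of j] by linarith
    hence "real (j + 1) \<le> real (2 * 2 ^ j)" by (simp only: of_nat_le_iff)
    hence "1 \<le> 2 * 2 ^ j / (real j + 1)" by simp
    hence "6 / (C * c ^ 2) * 1 \<le> 6 / (C * c ^ 2) * (2 * 2 ^ j / (real j + 1))"
      using C c(1) by (intro mult_left_mono) auto
    thus ?thesis by simp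
  qed
  also have "18432 * C * 2 ^ j / (real j + 1) + 6 / (C * c ^ 2) * (2 * 2 ^ j / (real j + 1)) =
      C' * 2 ^ j / (real j + 1)"
    unfolding C'_def by (simp add: add_divide_distrib distrib_right)
  finally show ?thesis unfolding Q_def[symmetric] by (simp add: Z_def card_image)
qed

text \<open>Each dyadic block contributes at most a multiple of \<open>1 / (p * (j + 1))\<close>,
  and about \<open>log 2 N\<close> blocks cover the range, so the harmonic sum over \<open>j\<close>
  has order at most \<open>log log N\<close>, which the sum of the \<open>1 / q\<close>
  dominates.\<close>

lemma prime_bohr_sum_le:
  assumes bad: "bad_const c \<beta>" and C: "C > 0"
  obtains C' p0 where "C' > 0" "\<And>p N. p \<ge> p0 \<Longrightarrow>
     (\<Sum>q | prime q \<and> p < q \<and> q \<le> N \<and> int_dist (\<beta> * (real q - real p)) \<le> C / real p. 1 / real q) \<le>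
     C' * (1 / real p) * (\<Sum>q | q \<in> {1..N} \<and> prime q. 1 / real q)"
proof -
  note c = bad_constD[OF bad]
  define C1 where "C1 = 18432 * C + 12 / (C * c ^ 2)"
  have C1: "C1 > 0" using C c(1) by (auto simp: C1_def intro!: add_pos_pos)
  \<comment> \<open>The comparison needs large \<open>N\<close>, and \<open>N > p \<ge> p0\<close>
    ensures that; the resulting constant depends on neither \<open>p\<close> nor
    \<open>N\<close>.\<close>
  have "eventually (\<lambda>N :: nat. 1 + ln (log 2 (real N) + 1) \<le> 3 * ln (ln (real N + 1) / 2)) at_top"
    by real_asymp
  then obtain N0 where N0: "\<And>N :: nat. N \<ge> N0 \<Longrightarrow> 1 + ln (log 2 (real N) + 1) \<le> 3 * ln (ln (real N + 1) / 2)"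
    by (auto simp: eventually_at_top_linorder)
  define p0 where "p0 = max N0 (max 1 (nat \<lceil>12 * C\<rceil>))"
  show thesis
  proof (rule that[of "3 * C1" p0])
    fix p N assume p: "p \<ge> p0"
    have p1: "p \<ge> 1" "real p \<ge> 12 * C" "p \<ge> N0" using p by (auto simp: p0_def)
    define Q where "Q = {q. prime q \<and> p < q \<and> q \<le> N \<and> int_dist (\<beta> * (real q - real p)) \<le> C / real p}"
    define B where "B j = {q. prime q \<and> 2 ^ j * p < q \<and> q \<le> 2 ^ Suc j * p \<and>
      int_dist (\<beta> * (real q - real p)) \<le> C / real p}" for j :: nat
    have finB: "finite (B j)" for j by (rule finite_subset[of _ "{..2 ^ Suc j * p}"]) (auto simp: B_def)
    have finQ: "finite Q" by (rule finite_subset[of _ "{..N}"]) (auto simp: Q_def)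
    show "sum (\<lambda>q. 1 / real q) Q \<le> 3 * C1 * (1 / real p) * (\<Sum>q | q \<in> {1..N} \<and> prime q. 1 / real q)"
    proof (cases "p < N")
      case False
      hence "Q = {}" by (auto simp: Q_def)
      thus ?thesis using C1 by (auto intro!: mult_nonneg_nonneg divide_nonneg_nonneg sum_nonneg)
    next
      case True
      define J where "J = nat \<lceil>log 2 (real N)\<rceil>"
      have N: "N \<ge> 2" using True p1 by simp
      have log: "log 2 (real N) \<ge> 1" using N by (simp add: le_log_iff)
      have J: "log 2 (real N) \<le> real J" "real J \<le> log 2 (real N) + 1" "J \<ge> 1"
        unfolding J_def using log by linarith+
      have "real N \<le> 2 powr real J" using J(1) N by (simp add: log_le_iff)
      hence "real N \<le> real (2 ^ J)" by (simp add: powr_realpow)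
      hence NJ: "N \<le> 2 ^ J" by (simp only: of_nat_le_iff)
      have "Q \<subseteq> (\<Union>j<J. B j)"
      proof
        fix q assume q: "q \<in> Q"
        \<comment> \<open>Minimality gives \<open>2 ^ j * p < q\<close>, except that for
          \<open>j = 0\<close> this is the assumption \<open>p < q\<close>.\<close>
        define j where "j = (LEAST j. q \<le> 2 ^ Suc j * p)"
        have ex: "q \<le> 2 ^ Suc (J - 1) * p"
        proof -
          have "q \<le> N" using q by (simp add: Q_def)
          also have "N \<le> 2 ^ Suc (J - 1)" using NJ J(3) by simp
          also have "\<dots> \<le> 2 ^ Suc (J - 1) * p" using p1 by simp
          finally show ?thesis .
        qed
        have 1: "q \<le> 2 ^ Suc j * p" unfolding j_def by (rule LeastI) (rule ex)
        have "j \<le> J - 1" unfolding j_def by (rule Least_le) (rule ex)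
        have "2 ^ j * p < q"
        proof (cases j)
          case 0
          thus ?thesis using q by (simp add: Q_def)
        next
          case (Suc i)
          hence "i < j" by simp
          hence "\<not> q \<le> 2 ^ Suc i * p" unfolding j_def by (rule not_less_Least)
          thus ?thesis using Suc by simp
        qed
        hence "q \<in> B j" using q 1 by (simp add: Q_def B_def)
        moreover have "j < J" using \<open>j \<le> J - 1\<close> J(3) by linarith
        ultimately show "q \<in> (\<Union>j<J. B j)" by blast
      qed
      hence "sum (\<lambda>q. 1 / real q) Q \<le> sum (\<lambda>q. 1 / real q) (\<Union>j<J. B j)"
        using finB by (intro sum_mono2) auto
      also have "\<dots> \<le> (\<Sum>j<J. sum (\<lambda>q. 1 / real q) (B j))"
        using finB by (intro sum_UN_le) auto
      also have "\<dots> \<le> (\<Sum>j<J. C1 / real p * (1 / real (Suc j)))"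
      proof (rule sum_mono)
        fix j
        have "sum (\<lambda>q. 1 / real q) (B j) \<le> (\<Sum>q\<in>B j. 1 / (2 ^ j * real p))"
        proof (rule sum_mono)
          fix q assume q: "q \<in> B j"
          hence "real (2 ^ j * p) \<le> real q" unfolding B_def by (intro of_nat_mono) auto
          moreover have "(2 :: real) ^ j * real p > 0" using p1 by simp
          ultimately show "1 / real q \<le> 1 / (2 ^ j * real p)"
            using p1 q by (intro divide_left_mono mult_pos_pos) (auto simp: B_def prime_gt_0_nat)
        qed
        also have "\<dots> = real (card (B j)) / (2 ^ j * real p)" by simp
        also have "\<dots> \<le> (C1 * 2 ^ j / (real j + 1)) / (2 ^ j * real p)"
          using card_primes_dyadic_bohr[OF bad C p1(2,1), of j]
          by (intro divide_right_mono) (auto simp: B_def C1_def)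
        also have "\<dots> = C1 / real p * (1 / real (Suc j))"
          using p1 by (simp add: divide_simps)
        finally show "sum (\<lambda>q. 1 / real q) (B j) \<le> C1 / real p * (1 / real (Suc j))" .
      qed
      also have "\<dots> = C1 / real p * harm J"
        by (simp add: harm_altdef sum_distrib_left inverse_eq_divide)
      also have "harm J \<le> 1 + ln (real J)"
        using euler_mascheroni_sequence_decreasing[of 1 J] J(3) by (simp add: harm_expand)
      also have "\<dots> \<le> 1 + ln (log 2 (real N) + 1)"
        using J(2,3) by (subst add_le_cancel_left, subst ln_le_cancel_iff) auto
      also have "\<dots> \<le> 3 * ln (ln (real N + 1) / 2)" using True p1 by (intro N0) auto
      also have "\<dots> \<le> 3 * (\<Sum>q | q \<in> {1..N} \<and> prime q. 1 / real q)"
        using sum_inverse_primes_ge[of N] by simp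
      finally show ?thesis using C1 p1 by (simp add: mult_ac mult_left_mono divide_right_mono)
    qed
  qed (use C1 in simp)
qed

section \<open>Vaughan's identity and exponential sums over primes\<close>

lemma abel_summation:
  fixes z :: "nat \<Rightarrow> complex"
  assumes "m \<le> N"
  shows "(\<Sum>n=m..N. of_real (f n) * z n) = of_real (f N) * (\<Sum>i=m..N. z i) -
           (\<Sum>n=m..<N. of_real (f (Suc n) - f n) * (\<Sum>i=m..n. z i))"
  using assms
proof (induction N rule: nat_induct_at_least)
  case (Suc n)
  thus ?case by (simp add: sum.atLeastLessThan_Suc algebra_simps)
qed simp

lemma norm_abel_incseq_le:
  fixes z :: "nat \<Rightarrow> complex"
  assumes "m \<le> N" "f m \<ge> 0" "\<And>n. m \<le> n \<Longrightarrow> n < N \<Longrightarrow> f n \<le> f (Suc n)"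
    and B: "\<And>n. m \<le> n \<Longrightarrow> n \<le> N \<Longrightarrow> norm (\<Sum>i=m..n. z i) \<le> B"
  shows "norm (\<Sum>n=m..N. of_real (f n) * z n) \<le> 2 * B * f N"
proof -
  have tele: "(\<Sum>n=m..<N. f (Suc n) - f n) = f N - f m"
    using sum_Suc_diff'[OF assms(1), of f] .
  have nn: "f N - f m \<ge> 0"
    unfolding tele[symmetric] using assms(3) by (intro sum_nonneg) auto
  have B0: "B \<ge> 0" using B[of m] assms(1) norm_ge_zero order_trans by blast
  have "norm (\<Sum>n=m..N. of_real (f n) * z n) \<le> norm (of_real (f N) * (\<Sum>i=m..N. z i)) +
      norm (\<Sum>n=m..<N. of_real (f (Suc n) - f n) * (\<Sum>i=m..n. z i))"
    unfolding abel_summation[OF assms(1)] by (rule norm_triangle_ineq4)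
  also have "\<dots> \<le> f N * B + (\<Sum>n=m..<N. (f (Suc n) - f n) * B)"
  proof (intro add_mono order_trans[OF norm_sum] sum_mono)
    show "norm (of_real (f N) * (\<Sum>i=m..N. z i)) \<le> f N * B"
      unfolding norm_mult norm_of_real using assms(1,2) nn B[of N] by (intro mult_mono) auto
    fix n assume n: "n \<in> {m..<N}"
    have "\<bar>f (Suc n) - f n\<bar> = f (Suc n) - f n" using assms(3)[of n] n by auto
    moreover have "norm (\<Sum>i=m..n. z i) \<le> B" using B n by auto
    ultimately show "norm (of_real (f (Suc n) - f n) * (\<Sum>i=m..n. z i)) \<le> (f (Suc n) - f n) * B"
      unfolding norm_mult norm_of_real using assms(3)[of n] n by (simp add: mult_left_mono)
  qed
  also have "\<dots> = f N * B + (f N - f m) * B"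
    unfolding sum_distrib_right[symmetric] tele ..
  also have "\<dots> \<le> f N * B + f N * B"
    using assms(2) B0 by (intro add_left_mono mult_right_mono) auto
  finally show ?thesis by simp
qed

text \<open>Unlike in the increasing case the bound may vary with \<open>n\<close>: it will be
  applied to partial sums that are only known to be small compared with \<open>n\<close>.\<close>

lemma norm_abel_decseq_le:
  fixes z :: "nat \<Rightarrow> complex"
  assumes "m \<le> N" "f N \<ge> 0" "\<And>n. m \<le> n \<Longrightarrow> n < N \<Longrightarrow> f (Suc n) \<le> f n"
    and B: "\<And>n. m \<le> n \<Longrightarrow> n \<le> N \<Longrightarrow> norm (\<Sum>i=m..n. z i) \<le> B n"
  shows "norm (\<Sum>n=m..N. of_real (f n) * z n) \<le> f N * B N + (\<Sum>n=m..<N. (f n - f (Suc n)) * B n)"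
proof -
  have "norm (\<Sum>n=m..N. of_real (f n) * z n) \<le> norm (of_real (f N) * (\<Sum>i=m..N. z i)) +
      norm (\<Sum>n=m..<N. of_real (f (Suc n) - f n) * (\<Sum>i=m..n. z i))"
    unfolding abel_summation[OF assms(1)] by (rule norm_triangle_ineq4)
  also have "\<dots> \<le> f N * B N + (\<Sum>n=m..<N. (f n - f (Suc n)) * B n)"
  proof (intro add_mono order_trans[OF norm_sum] sum_mono)
    show "norm (of_real (f N) * (\<Sum>i=m..N. z i)) \<le> f N * B N"
      unfolding norm_mult norm_of_real using assms(1,2) B[of N] by (intro mult_mono) auto
    fix n assume n: "n \<in> {m..<N}"
    have "\<bar>f (Suc n) - f n\<bar> = f n - f (Suc n)" using assms(3)[of n] n by auto
    moreover have "norm (\<Sum>i=m..n. z i) \<le> B n" using B n by auto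
    ultimately show "norm (of_real (f (Suc n) - f n) * (\<Sum>i=m..n. z i)) \<le> (f n - f (Suc n)) * B n"
      unfolding norm_mult norm_of_real using assms(3)[of n] n by (simp add: mult_left_mono)
  qed
  finally show ?thesis .
qed

section \<open>Vaughan's decomposition of exponential sums over the von Mangoldt function\<close>

abbreviation ucis_sum :: "nat \<Rightarrow> real \<Rightarrow> complex" where
  "ucis_sum M t \<equiv> (\<Sum>m=1..M. ucis (real m * t))"

abbreviation log_ucis_sum :: "nat \<Rightarrow> real \<Rightarrow> complex" where
  "log_ucis_sum M t \<equiv> (\<Sum>l=1..M. of_real (ln (real l)) * ucis (real l * t))"

lemma sum_hyperbola:
  "(\<Sum>k=1..M. \<Sum>n=1..M div k. F k n) = (\<Sum>l=1..(M::nat). \<Sum>k | k dvd l. F k (l div k))"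
proof -
  have fin: "finite {k. k dvd l}" if "l \<in> {1..M}" for l using that by simp
  have "(\<Sum>k=1..M. \<Sum>n=1..M div k. F k n) = (\<Sum>(k,n)\<in>(SIGMA k:{1..M}. {1..M div k}). F k n)"
    by (rule sum.Sigma) auto
  also have "\<dots> = (\<Sum>(l,k)\<in>(SIGMA l:{1..M}. {k. k dvd l}). F k (l div k))"
  proof (rule sum.reindex_bij_witness[of _ "\<lambda>(l,k). (k, l div k)" "\<lambda>(k,n). (k * n, k)"])
    fix x assume "x \<in> (SIGMA k:{1..M}. {1..M div k})"
    then obtain k n where x: "x = (k, n)" "k \<ge> 1" "n \<ge> 1" "n \<le> M div k" by auto
    have "k * n \<le> M" using x less_eq_div_iff_mult_less_eq[of k n M] by (simp add: mult.commute)
    thus "(case case x of (k, n) \<Rightarrow> (k * n, k) of (l, k) \<Rightarrow> (k, l div k)) = x"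
      "(case x of (k, n) \<Rightarrow> (k * n, k)) \<in> (SIGMA l:{1..M}. {k. k dvd l})"
      "(case case x of (k, n) \<Rightarrow> (k * n, k) of (l, k) \<Rightarrow> F k (l div k)) = (case x of (k, n) \<Rightarrow> F k n)"
      using x by auto
  next
    fix y assume "y \<in> (SIGMA l:{1..M}. {k. k dvd l})"
    then obtain l k where y: "y = (l, k)" "l \<ge> 1" "l \<le> M" "k dvd l" by auto
    have "k \<le> l" "k \<ge> 1" using y by (auto intro: dvd_imp_le Nat.gr0I simp: Suc_le_eq)
    moreover have "l div k \<ge> 1" using y \<open>k \<le> l\<close> \<open>k \<ge> 1\<close> by (simp add: Suc_le_eq div_greater_zero_iff)
    moreover have "l div k \<le> M div k" using y by (intro div_le_mono)
    ultimately show "(case case y of (l, k) \<Rightarrow> (k, l div k) of (k, n) \<Rightarrow> (k * n, k)) = y"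
      "(case y of (l, k) \<Rightarrow> (k, l div k)) \<in> (SIGMA k:{1..M}. {1..M div k})"
      using y by auto
  qed
  also have "\<dots> = (\<Sum>l=1..M. \<Sum>k | k dvd l. F k (l div k))"
    by (rule sum.Sigma[symmetric]) (use fin in auto)
  finally show ?thesis .
qed

text \<open>
  A triple \<open>(n, d, e)\<close> with \<open>d dvd n\<close> and \<open>e dvd n\<close> is determined by the factorisation
  \<open>n = gcd d e * (d div gcd d e) * (e div gcd d e) * (n div lcm d e)\<close>.
\<close>

lemma sum_divisor_count_square_le:
  "(\<Sum>n=1..N. real (card {d. d dvd n}) ^ 2 / real n) \<le> harm N ^ 4"
proof -
  define X where "X = (SIGMA n:{1..N}. {d. d dvd n} \<times> {d. d dvd n})"
  define g where "g = (\<lambda>(n :: nat, d :: nat, e). ((gcd d e, d div gcd d e), (e div gcd d e, n div lcm d e)))"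
  define w where "w = (\<lambda>((a, b), (x, y)). ((1 / real a) * (1 / real b)) * ((1 / real x) * (1 / real y)))"
  define I where "I = {1..N}"
  have finX: "finite X" unfolding X_def by (intro finite_SigmaI) auto
  have g_props: "n = a * b * x * y \<and> d = a * b \<and> e = a * x \<and> {a, b, x, y} \<subseteq> I"
    if "(n, d, e) \<in> X" "g (n, d, e) = ((a, b), (x, y))" for n d e a b x y
  proof -
    from that have n: "n \<in> {1..N}" "d dvd n" "e dvd n" by (auto simp: X_def)
    have ab: "a = gcd d e" "b = d div gcd d e" "x = e div gcd d e" "y = n div lcm d e"
      using that(2) by (auto simp: g_def)
    have d: "d = a * b" and e: "e = a * x" by (simp_all add: ab)
    have pos: "d > 0" "e > 0" using n by (auto intro: Nat.gr0I)
    hence apos: "a > 0" by (simp add: ab)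
    have "a * lcm d e = d * e" unfolding ab(1) by (rule prod_gcd_lcm_nat[symmetric])
    also have "\<dots> = a * (a * b * x)" by (simp add: d e)
    finally have lcm: "lcm d e = a * b * x" using apos by simp
    have "lcm d e dvd n" using n by simp
    hence ny: "n = a * b * x * y" by (simp add: ab(4) flip: lcm)
    hence "a dvd n" "b dvd n" "x dvd n" "y dvd n" by auto
    hence "{a, b, x, y} \<subseteq> I" using n(1) by (auto simp: I_def Suc_le_eq intro: Nat.gr0I dest: dvd_imp_le)
    with ny d e show ?thesis by blast
  qed
  have inj: "inj_on g X"
  proof (rule inj_onI)
    fix p q assume pq: "p \<in> X" "q \<in> X" "g p = g q"
    obtain n d e where p: "p = (n, d, e)" by (cases p) auto
    obtain n' d' e' where q: "q = (n', d', e')" by (cases q) auto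
    obtain a b x y where abxy: "g p = ((a, b), (x, y))" by (metis surj_pair)
    show "p = q"
      using g_props[of n d e a b x y] g_props[of n' d' e' a b x y] pq abxy by (simp add: p q)
  qed
  have sub: "g ` X \<subseteq> (I \<times> I) \<times> (I \<times> I)"
  proof (rule image_subsetI)
    fix p assume pX: "p \<in> X"
    obtain n d e where p: "p = (n, d, e)" by (cases p) auto
    obtain a b x y where abxy: "g p = ((a, b), (x, y))" by (metis surj_pair)
    show "g p \<in> (I \<times> I) \<times> (I \<times> I)"
      using g_props[of n d e a b x y] pX abxy by (simp add: p)
  qed
  have harm: "harm N = (\<Sum>i\<in>I. 1 / real i)"
    by (simp add: harm_def I_def inverse_eq_divide)
  have "(\<Sum>n=1..N. real (card {d. d dvd n}) ^ 2 / real n) =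
      (\<Sum>n=1..N. \<Sum>p\<in>{d. d dvd n} \<times> {d. d dvd n}. 1 / real n)"
    by (intro sum.cong refl) (simp add: card_cartesian_product power2_eq_square)
  also have "\<dots> = (\<Sum>(n, p)\<in>X. 1 / real n)"
    unfolding X_def by (rule sum.Sigma) auto
  also have "\<dots> = (\<Sum>p\<in>X. w (g p))"
  proof (intro sum.cong refl)
    fix p assume pX: "p \<in> X"
    obtain n d e where p: "p = (n, d, e)" by (cases p) auto
    obtain a b x y where abxy: "g p = ((a, b), (x, y))" by (metis surj_pair)
    have "n = a * b * x * y"
      using g_props[of n d e a b x y] pX abxy by (simp add: p)
    thus "(case p of (n, p) \<Rightarrow> 1 / real n) = w (g p)"
      unfolding abxy by (simp add: p w_def)
  qed
  also have "\<dots> = (\<Sum>q\<in>g ` X. w q)" by (subst sum.reindex[OF inj]) simp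
  \<comment> \<open>Dropping the constraint that the four factors have product at most
    \<open>N\<close> leaves four independent harmonic sums.\<close>
  also have "\<dots> \<le> (\<Sum>q\<in>(I \<times> I) \<times> (I \<times> I). w q)"
    by (intro sum_mono2 sub) (auto simp: I_def w_def)
  also have "\<dots> = (\<Sum>p\<in>I \<times> I. \<Sum>q\<in>I \<times> I. w (p, q))"
    by (subst sum.cartesian_product) (simp add: case_prod_unfold)
  also have "\<dots> = (\<Sum>p\<in>I \<times> I. (1 / real (fst p)) * (1 / real (snd p))) *
      (\<Sum>p\<in>I \<times> I. (1 / real (fst p)) * (1 / real (snd p)))"
    by (simp add: sum_product w_def case_prod_unfold)
  also have "(\<Sum>p\<in>I \<times> I. (1 / real (fst p)) * (1 / real (snd p))) = harm N * harm N"
    unfolding harm sum_product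
    by (subst sum.cartesian_product) (simp add: case_prod_unfold)
  finally show ?thesis by (simp add: eval_nat_numeral)
qed

lemma sum_inverse_squares_tail_le:
  assumes "U \<ge> 1"
  shows "(\<Sum>k\<in>{U<..K}. 1 / real k ^ 2) \<le> 1 / real U"
proof -
  have "K \<ge> U \<Longrightarrow> (\<Sum>k\<in>{U<..K}. 1 / real k ^ 2) \<le> 1 / real U - 1 / real K"
  proof (induction K rule: nat_induct_at_least)
    case (Suc K)
    have K: "K \<ge> 1" using Suc assms by simp
    have "{U<..Suc K} = insert (Suc K) {U<..K}" using Suc by auto
    hence "(\<Sum>k\<in>{U<..Suc K}. 1 / real k ^ 2) = 1 / real (Suc K) ^ 2 + (\<Sum>k\<in>{U<..K}. 1 / real k ^ 2)"
      by simp
    moreover have "1 / real (Suc K) ^ 2 \<le> 1 / (real K * real (Suc K))"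
      using K by (intro divide_left_mono) (auto simp: power2_eq_square)
    moreover have "1 / (real K * real (Suc K)) = 1 / real K - 1 / real (Suc K)"
      using K by (simp add: field_simps)
    ultimately show ?case using Suc.IH by linarith
  qed simp
  moreover have "1 / real U - 1 / real K \<le> 1 / real U" by simp
  moreover have "\<not> U \<le> K \<Longrightarrow> {U<..K} = {}" by auto
  ultimately show ?thesis by (cases "U \<le> K") (linarith, simp)
qed

text \<open>Cutting the Moebius divisor sum at \<open>V\<close> splits the indicator of 1 into
  \<open>mob_low V\<close> and \<open>mob_high V\<close>. The first leads to geometric sums; the
  second vanishes on \<open>{1..V}\<close>, which keeps both variables of the bilinear sum away from
  1.\<close>

definition mob_low :: "nat \<Rightarrow> nat \<Rightarrow> real" where
  "mob_low V n = (\<Sum>d | d dvd n \<and> d \<le> V. mob d)"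

definition mob_high :: "nat \<Rightarrow> nat \<Rightarrow> real" where
  "mob_high V n = (\<Sum>d | d dvd n \<and> V < d. mob d)"

lemma mob_low_plus_high:
  assumes "n > 0"
  shows "mob_low V n + mob_high V n = (if n = 1 then 1 else 0)"
proof -
  have fin: "finite {d. d dvd n}" using assms by simp
  have "{d. d dvd n} = {d. d dvd n \<and> d \<le> V} \<union> {d. d dvd n \<and> V < d}" by auto
  hence "(\<Sum>d | d dvd n. mob d) = sum mob ({d. d dvd n \<and> d \<le> V} \<union> {d. d dvd n \<and> V < d})"
    by (rule arg_cong)
  also have "\<dots> = mob_low V n + mob_high V n"
    unfolding mob_low_def mob_high_def
    by (rule sum.union_disjoint; (rule finite_subset[OF _ fin])?) auto
  finally have "(\<Sum>d | d dvd n. mob d) = mob_low V n + mob_high V n" .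
  thus ?thesis using sum_mob_divisors[OF assms] by simp
qed

lemma mob_high_eq_0: "n > 0 \<Longrightarrow> n \<le> V \<Longrightarrow> mob_high V n = 0"
  unfolding mob_high_def by (intro sum.neutral) (auto dest: dvd_imp_le)

lemma abs_mob_high_le:
  assumes "n > 0"
  shows "\<bar>mob_high V n\<bar> \<le> real (card {d. d dvd n})"
proof -
  have fin: "finite {d. d dvd n}" using assms by simp
  have "\<bar>mob_high V n\<bar> \<le> (\<Sum>d | d dvd n \<and> V < d. \<bar>mob d\<bar>)"
    unfolding mob_high_def by (rule sum_abs)
  also have "\<dots> \<le> (\<Sum>d | d dvd n. \<bar>mob d\<bar>)"
    using fin by (intro sum_mono2) auto
  also have "\<dots> \<le> (\<Sum>d | d dvd n. 1)"
    by (intro sum_mono abs_mob_le)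
  finally show ?thesis by simp
qed

text \<open>Writing \<open>n = d * m\<close> in the opened divisor sum leaves, for each
  \<open>d \<le> V\<close>, a complete geometric sum of frequency \<open>d * t\<close>.\<close>

lemma sum_mob_low_ucis:
  "(\<Sum>n=1..M. of_real (mob_low V n) * ucis (real n * t)) =
   (\<Sum>d=1..V. of_real (mob d) * (ucis_sum (M div d) (real d * t)))"
proof -
  define F where "F d m = (if d \<le> V then of_real (mob d) * ucis (real m * (real d * t)) else 0)" for d m :: nat
  have "(\<Sum>n=1..M. of_real (mob_low V n) * ucis (real n * t)) = (\<Sum>n=1..M. \<Sum>d | d dvd n. F d (n div d))"
  proof (intro sum.cong refl)
    fix n assume n: "n \<in> {1..M}"
    have fin: "finite {d. d dvd n}" using n by simp
    have "(\<Sum>d | d dvd n. F d (n div d)) = (\<Sum>d | d dvd n \<and> d \<le> V. of_real (mob d) * ucis (real n * t))"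
    proof (rule sum.mono_neutral_cong_right[OF fin])
      fix d assume d: "d \<in> {d. d dvd n \<and> d \<le> V}"
      hence "real (n div d) * real d = real n"
        by (metis dvd_div_mult_self mem_Collect_eq of_nat_mult)
      hence eq: "real (n div d) * (real d * t) = real n * t" by (metis mult.assoc)
      show "F d (n div d) = of_real (mob d) * ucis (real n * t)" unfolding F_def eq using d by simp
    qed (auto simp: F_def)
    thus "of_real (mob_low V n) * ucis (real n * t) = (\<Sum>d | d dvd n. F d (n div d))"
      by (simp add: mob_low_def sum_distrib_right)
  qed
  also have "\<dots> = (\<Sum>d=1..M. \<Sum>m=1..M div d. F d m)" by (rule sum_hyperbola[symmetric])
  also have "\<dots> = (\<Sum>d\<in>{1..M} \<union> {1..V}. \<Sum>m=1..M div d. F d m)"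
    by (rule sum.mono_neutral_left) auto
  also have "\<dots> = (\<Sum>d=1..V. of_real (mob d) * (ucis_sum (M div d) (real d * t)))"
    by (rule sum.mono_neutral_cong_right) (auto simp: F_def sum_distrib_left)
  finally show ?thesis .
qed

text \<open>The Dirichlet convolution of the von Mangoldt function with 1 is the logarithm, here
  carried along with the phases.\<close>

lemma sum_mangoldt_ucis_hyperbola:
  "(\<Sum>k=1..M. of_real (mangoldt k) * (ucis_sum (M div k) (real k * t))) =
   (log_ucis_sum M t)"
proof -
  have "(\<Sum>k=1..M. of_real (mangoldt k) * (ucis_sum (M div k) (real k * t))) =
      (\<Sum>k=1..M. \<Sum>m=1..M div k. mangoldt k * ucis (real m * (real k * t)))"
    by (simp add: sum_distrib_left)
  also have "\<dots> = (\<Sum>l=1..M. \<Sum>k | k dvd l. mangoldt k * ucis (real (l div k) * (real k * t)))"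
    by (rule sum_hyperbola)
  also have "\<dots> = (log_ucis_sum M t)"
  proof (intro sum.cong refl)
    fix l assume l: "l \<in> {1..M}"
    have "(\<Sum>k | k dvd l. mangoldt k * ucis (real (l div k) * (real k * t))) =
        (\<Sum>k | k dvd l. mangoldt k * ucis (real l * t))"
    proof (intro sum.cong refl)
      fix k assume "k \<in> {k. k dvd l}"
      hence "real (l div k) * real k = real l"
        by (metis dvd_div_mult_self mem_Collect_eq of_nat_mult)
      hence eq: "real (l div k) * (real k * t) = real l * t" by (metis mult.assoc)
      show "mangoldt k * ucis (real (l div k) * (real k * t)) = mangoldt k * ucis (real l * t)"
        unfolding eq ..
    qed
    also have "\<dots> = of_real (ln (real l)) * ucis (real l * t)"
      using l by (simp add: mangoldt_sum flip: sum_distrib_right)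
    finally show "(\<Sum>k | k dvd l. mangoldt k * ucis (real (l div k) * (real k * t))) =
      of_real (ln (real l)) * ucis (real l * t)" .
  qed
  finally show ?thesis .
qed

definition prime_exp_sum :: "real \<Rightarrow> nat \<Rightarrow> complex" where
  "prime_exp_sum \<theta> N = (\<Sum>n=1..N. of_real (mangoldt n) * ucis (real n * \<theta>))"

text \<open>For \<open>k > U\<close> the phase \<open>ucis (k * \<theta>)\<close> is the only term,
  at \<open>n = 1\<close>, that survives in \<open>low k + high k\<close>. The high part is the
  bilinear sum. The low part is completed to all \<open>k \<le> N\<close>, where the sum over
  \<open>k\<close> collapses to a logarithmic weight, and the terms with \<open>k \<le> U\<close>
  are subtracted again.\<close>

lemma vaughan_identity:
  assumes "U \<le> N"
  shows "prime_exp_sum \<theta> N =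
    (\<Sum>k=1..U. of_real (mangoldt k) * ucis (real k * \<theta>)) +
    (\<Sum>d=1..V. of_real (mob d) * (log_ucis_sum (N div d) (real d * \<theta>))) -
    (\<Sum>k=1..U. of_real (mangoldt k) * (\<Sum>d=1..V. of_real (mob d) *
       (ucis_sum (N div k div d) (real d * (real k * \<theta>))))) +
    (\<Sum>k\<in>{U<..N}. of_real (mangoldt k) *
       (\<Sum>n=1..N div k. of_real (mob_high V n) * ucis (real n * (real k * \<theta>))))"
proof -
  define low where "low k = (\<Sum>n=1..N div k. of_real (mob_low V n) * ucis (real n * (real k * \<theta>)))" for k
  define high where "high k = (\<Sum>n=1..N div k. of_real (mob_high V n) * ucis (real n * (real k * \<theta>)))" for k
  define L where "L k = complex_of_real (mangoldt k)" for k :: nat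
  have low_eq: "low k = (\<Sum>d=1..V. of_real (mob d) *
       (ucis_sum (N div k div d) (real d * (real k * \<theta>))))" for k
    unfolding low_def by (rule sum_mob_low_ucis)
  have lh: "low k + high k = ucis (real k * \<theta>)" if "k \<in> {1..N}" for k
  proof -
    have Nk: "1 \<le> N div k" using that by (simp add: Suc_le_eq div_greater_zero_iff)
    have "low k + high k = (\<Sum>n=1..N div k. of_real (mob_low V n + mob_high V n) * ucis (real n * (real k * \<theta>)))"
      unfolding low_def high_def sum.distrib[symmetric] by (simp add: distrib_right)
    also have "\<dots> = (\<Sum>n=1..N div k. if n = 1 then ucis (real k * \<theta>) else 0)"
      by (intro sum.cong refl) (auto simp: mob_low_plus_high)
    also have "\<dots> = ucis (real k * \<theta>)" using Nk by (simp add: sum.delta)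
    finally show ?thesis .
  qed
  have split: "{1..N} = {1..U} \<union> {U<..N}" using assms by auto
  have splitsum: "sum f {1..N} = sum f {1..U} + sum f {U<..N}" for f :: "nat \<Rightarrow> complex"
    unfolding split by (rule sum.union_disjoint) auto
  have "prime_exp_sum \<theta> N = (\<Sum>k=1..U. L k * ucis (real k * \<theta>)) + (\<Sum>k\<in>{U<..N}. L k * ucis (real k * \<theta>))"
    unfolding prime_exp_sum_def L_def by (rule splitsum)
  also have "(\<Sum>k\<in>{U<..N}. L k * ucis (real k * \<theta>)) = (\<Sum>k\<in>{U<..N}. L k * (low k + high k))"
    by (intro sum.cong refl) (subst lh, auto)
  also have "\<dots> = (\<Sum>k\<in>{U<..N}. L k * low k) + (\<Sum>k\<in>{U<..N}. L k * high k)"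
    by (simp add: distrib_left sum.distrib)
  also have "(\<Sum>k\<in>{U<..N}. L k * low k) = (\<Sum>k=1..N. L k * low k) - (\<Sum>k=1..U. L k * low k)"
    using splitsum[of "\<lambda>k. L k * low k"] by simp
  also have "(\<Sum>k=1..N. L k * low k) = (\<Sum>d=1..V. of_real (mob d) * (\<Sum>k=1..N. L k *
      (ucis_sum (N div d div k) (real k * (real d * \<theta>)))))"
  proof -
    have "(\<Sum>k=1..N. L k * low k) = (\<Sum>k=1..N. \<Sum>d=1..V. L k * (of_real (mob d) *
       (ucis_sum (N div k div d) (real d * (real k * \<theta>)))))"
      unfolding low_eq by (simp only: sum_distrib_left)
    also have "\<dots> = (\<Sum>d=1..V. \<Sum>k=1..N. L k * (of_real (mob d) *
       (ucis_sum (N div k div d) (real d * (real k * \<theta>)))))"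
      by (rule sum.swap)
    also have "\<dots> = (\<Sum>d=1..V. \<Sum>k=1..N. of_real (mob d) * (L k *
      (ucis_sum (N div d div k) (real k * (real d * \<theta>)))))"
      by (intro sum.cong refl) (simp add: mult_ac flip: div_mult2_eq)
    finally show ?thesis by (simp only: sum_distrib_left)
  qed
  also have "\<dots> = (\<Sum>d=1..V. of_real (mob d) * (log_ucis_sum (N div d) (real d * \<theta>)))"
  proof (intro sum.cong refl)
    fix d
    \<comment> \<open>For \<open>k > N div d\<close> the inner sum is empty, so the range shrinks to
      the one in \<open>sum_mangoldt_ucis_hyperbola\<close>.\<close>
    have "(\<Sum>k=1..N. L k * (ucis_sum (N div d div k) (real k * (real d * \<theta>)))) =
        (\<Sum>k=1..N div d. L k * (ucis_sum (N div d div k) (real k * (real d * \<theta>))))"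
      by (rule sum.mono_neutral_right) (auto intro: order_trans[OF _ div_le_dividend])
    also have "\<dots> = (log_ucis_sum (N div d) (real d * \<theta>))"
      unfolding L_def by (rule sum_mangoldt_ucis_hyperbola)
    finally show "of_real (mob d) * (\<Sum>k=1..N. L k * (ucis_sum (N div d div k) (real k * (real d * \<theta>)))) =
        of_real (mob d) * (log_ucis_sum (N div d) (real d * \<theta>))"
      by simp
  qed
  finally show ?thesis unfolding low_eq by (simp add: L_def high_def)
qed

section \<open>Estimates for the pieces of Vaughan's identity\<close>

lemma norm_sum_ucis_interval_le:
  assumes "int_dist t > 0"
  shows "norm (\<Sum>k=m..n. ucis (real k * t)) \<le> 1 / int_dist t"
proof -
  have "(\<Sum>k=m..n. ucis (real k * t)) = (\<Sum>k<Suc n - m. ucis (real m * t) * ucis (real k * t))"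
    by (rule sum.reindex_bij_witness[of _ "\<lambda>k. k + m" "\<lambda>k. k - m"])
       (auto simp flip: ucis_add simp: algebra_simps of_nat_diff)
  thus ?thesis using norm_sum_ucis_le[OF assms, of "Suc n - m"]
    by (simp add: norm_mult flip: sum_distrib_left)
qed

text \<open>Partial summation removes the increasing weight \<open>ln l\<close> at the cost of a
  factor \<open>2 * ln N\<close>; the remaining geometric sums are at most
  \<open>d / c\<close>.\<close>

lemma norm_log_ucis_sum_le:
  assumes bad: "bad_const c \<theta>" and "d \<ge> 1" "M \<le> N"
  shows "norm (log_ucis_sum M (real d * \<theta>)) \<le> 2 * (real d / c) * ln (real N)"
proof (cases "M \<ge> 1")
  case True
  note c = bad_constD[OF bad]
  have pos: "int_dist (real d * \<theta>) > 0" using c(3) assms by simp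
  have "norm (log_ucis_sum M (real d * \<theta>)) \<le>
      2 * (1 / int_dist (real d * \<theta>)) * ln (real M)"
    using True by (intro norm_abel_incseq_le norm_sum_ucis_interval_le pos) auto
  also have "\<dots> \<le> 2 * (real d / c) * ln (real N)"
  proof (intro mult_mono)
    have "1 / int_dist (real d * \<theta>) \<le> 1 / (c / real d)"
      using c assms pos by (intro divide_left_mono) auto
    thus "1 / int_dist (real d * \<theta>) \<le> real d / c" by simp
  qed (use True assms c(1) in auto)
  finally show ?thesis .
next
  case False
  hence "M = 0" by simp
  thus ?thesis using bad_constD(1)[OF bad] by (cases "N = 0") auto
qed

text \<open>
  The weight \<open>n\<close> matches the weight \<open>1/n\<close> on the squared divisor function in the Cauchy--Schwarz
  step below, which makes a dyadic decomposition unnecessary.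
\<close>

lemma sum_weighted_exp_sums_le:
  fixes N :: nat
  assumes bad: "bad_const c \<theta>" and U: "U \<ge> 1" and V: "V \<ge> 1"
  defines "K \<equiv> N div V"
  shows "(\<Sum>n\<in>{V<..N}. real n * norm (\<Sum>k\<in>{U<..N div n}. of_real (mangoldt k) * ucis (real n * (real k * \<theta>))) ^ 2)
    \<le> ln (real N) ^ 2 * (real N ^ 2 / real U + 8 * real N * (real K * sqrt (real K)) / c)"
proof -
  note c = bad_constD[OF bad]
  define B where "B n = (\<Sum>k\<in>{U<..N div n}. of_real (mangoldt k) * ucis (real n * (real k * \<theta>)))" for n
  define I where "I = {U<..K}"
  define t where "t k l = (real k - real l) * \<theta>" for k l :: nat
  \<comment> \<open>After expanding the square and exchanging sums, \<open>n\<close> is innermost.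
    Its conditions amount to \<open>n \<le> N div max k l\<close>, so this is a geometric sum of
    frequency \<open>t k l\<close> with the increasing weight \<open>n\<close>.\<close>
  define E where "E k l = (\<Sum>n | n \<in> {V<..N} \<and> n * k \<le> N \<and> n * l \<le> N. of_real (real n) * ucis (real n * t k l))" for k l
  \<comment> \<open>Bound for an off-diagonal \<open>E k l\<close>, charged to the larger index:
    \<open>N / k\<close> is the largest weight \<open>n\<close> that occurs. It vanishes unless
    \<open>l < k\<close>, so that \<open>G k l + G l k\<close> serves both orders.\<close>
  define G where "G k l = (if l < k then 2 * real N / real k * (1 / int_dist (real (k - l) * \<theta>)) else 0)" for k l :: nat
  have t_eq: "int_dist (t k l) = int_dist (real (k - l) * \<theta>)" "int_dist (t l k) = int_dist (real (k - l) * \<theta>)"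
    if "l < k" for k l
  proof -
    have "t k l = real (k - l) * \<theta>" "t l k = - (real (k - l) * \<theta>)"
      using that by (auto simp: t_def of_nat_diff algebra_simps)
    thus "int_dist (t k l) = int_dist (real (k - l) * \<theta>)" "int_dist (t l k) = int_dist (real (k - l) * \<theta>)"
      by simp_all
  qed
  have "of_real (\<Sum>n\<in>{V<..N}. real n * norm (B n) ^ 2) =
      (\<Sum>n\<in>{V<..N}. of_real (real n) * (B n * cnj (B n)))"
    unfolding of_real_sum of_real_mult complex_norm_square ..
  also have "\<dots> = (\<Sum>n\<in>{V<..N}. \<Sum>p | p \<in> I \<times> I \<and> (n * fst p \<le> N \<and> n * snd p \<le> N).
      of_real (mangoldt (fst p) * mangoldt (snd p)) * (of_real (real n) * ucis (real n * t (fst p) (snd p))))"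
  proof (intro sum.cong refl)
    fix n assume n: "n \<in> {V<..N}"
    hence n0: "n > 0" by auto
    have le: "N div n \<le> K" unfolding K_def using n V by (intro div_le_mono2) auto
    have iff: "x \<le> N div n \<longleftrightarrow> n * x \<le> N" for x
      using n0 by (simp add: less_eq_div_iff_mult_less_eq mult.commute)
    have leK: "x \<le> K" if "n * x \<le> N" for x
      using that le unfolding iff[symmetric] by (rule order_trans)
    have set: "{U<..N div n} \<times> {U<..N div n} =
        {p. p \<in> I \<times> I \<and> (n * fst p \<le> N \<and> n * snd p \<le> N)}"
      unfolding I_def by (auto simp: iff dest: leK)
    have "of_real (real n) * (B n * cnj (B n)) = (\<Sum>k\<in>{U<..N div n}. \<Sum>l\<in>{U<..N div n}.
        of_real (real n) * ((of_real (mangoldt k) * ucis (real n * (real k * \<theta>))) *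
          (of_real (mangoldt l) * ucis (- (real n * (real l * \<theta>))))))"
    proof -
      have cn: "cnj (B n) = (\<Sum>l\<in>{U<..N div n}. of_real (mangoldt l) * ucis (- (real n * (real l * \<theta>))))"
        by (simp only: B_def cnj_sum complex_cnj_mult complex_cnj_complex_of_real cnj_ucis)
      show ?thesis unfolding cn unfolding B_def sum_product by (simp only: sum_distrib_left)
    qed
    also have "\<dots> = (\<Sum>k\<in>{U<..N div n}. \<Sum>l\<in>{U<..N div n}.
        of_real (mangoldt k * mangoldt l) * (of_real (real n) * ucis (real n * t k l)))"
    proof (intro sum.cong refl)
      fix k l
      have "ucis (real n * t k l) = ucis (real n * (real k * \<theta>)) * ucis (- (real n * (real l * \<theta>)))"
        unfolding ucis_add[symmetric] by (simp add: t_def algebra_simps)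
      thus "of_real (real n) * ((of_real (mangoldt k) * ucis (real n * (real k * \<theta>))) *
          (of_real (mangoldt l) * ucis (- (real n * (real l * \<theta>))))) =
          of_real (mangoldt k * mangoldt l) * (of_real (real n) * ucis (real n * t k l))"
        by (simp add: mult_ac)
    qed
    also have "\<dots> = (\<Sum>p\<in>{U<..N div n} \<times> {U<..N div n}.
        of_real (mangoldt (fst p) * mangoldt (snd p)) * (of_real (real n) * ucis (real n * t (fst p) (snd p))))"
      by (subst sum.cartesian_product) (simp add: case_prod_unfold)
    finally show "of_real (real n) * (B n * cnj (B n)) =
        (\<Sum>p | p \<in> I \<times> I \<and> (n * fst p \<le> N \<and> n * snd p \<le> N).
          of_real (mangoldt (fst p) * mangoldt (snd p)) * (of_real (real n) * ucis (real n * t (fst p) (snd p))))"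
      unfolding set .
  qed
  also have "\<dots> = (\<Sum>p\<in>I \<times> I. \<Sum>n | n \<in> {V<..N} \<and> (n * fst p \<le> N \<and> n * snd p \<le> N).
      of_real (mangoldt (fst p) * mangoldt (snd p)) * (of_real (real n) * ucis (real n * t (fst p) (snd p))))"
    by (rule sum.swap_restrict) (auto simp: I_def)
  also have "\<dots> = (\<Sum>p\<in>I \<times> I. of_real (mangoldt (fst p) * mangoldt (snd p)) * E (fst p) (snd p))"
    by (simp only: E_def sum_distrib_left)
  finally have total: "of_real (\<Sum>n\<in>{V<..N}. real n * norm (B n) ^ 2) =
      (\<Sum>p\<in>I \<times> I. of_real (mangoldt (fst p) * mangoldt (snd p)) * E (fst p) (snd p))" .
  have E_bound: "norm (E k l) \<le> (if k = l then real N ^ 2 * (1 / real k ^ 2) else 0) + G k l + G l k"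
    if kl: "k \<in> I" "l \<in> I" for k l
  proof -
    define m where "m = max k l"
    define Y where "Y = N div m"
    have m: "m \<ge> 1" using kl by (auto simp: m_def I_def)
    have Y: "real Y \<le> real N / real m"
      unfolding Y_def by (rule of_nat_div_le_of_nat)
    have "{n. n \<in> {V<..N} \<and> n * k \<le> N \<and> n * l \<le> N} = {Suc V..Y}"
    proof -
      have "n * k \<le> N \<and> n * l \<le> N \<longleftrightarrow> n \<le> Y" for n
      proof -
        have "n * k \<le> n * m" "n * l \<le> n * m" "m = k \<or> m = l" by (auto simp: m_def)
        moreover have "n \<le> Y \<longleftrightarrow> n * m \<le> N"
          unfolding Y_def using m by (simp add: less_eq_div_iff_mult_less_eq)
        ultimately show ?thesis by (metis le_trans)
      qed
      moreover have "n \<le> Y \<Longrightarrow> n \<le> N" for n unfolding Y_def by (meson div_le_dividend order_trans)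
      ultimately show ?thesis by auto
    qed
    hence E_eq: "E k l = (\<Sum>n=Suc V..Y. of_real (real n) * ucis (real n * t k l))"
      by (simp only: E_def)
    have Gnn: "G k l \<ge> 0" "G l k \<ge> 0" by (auto simp: G_def)
    consider "k = l" | "k \<noteq> l" "Suc V \<le> Y" | "\<not> Suc V \<le> Y" by blast
    thus ?thesis
    proof cases
      case 1
      have "norm (E k l) \<le> (\<Sum>n=Suc V..Y. real n)"
        unfolding E_eq by (rule order_trans[OF norm_sum]) (simp add: norm_mult)
      also have "\<dots> \<le> (\<Sum>n=Suc V..Y. real Y)" by (intro sum_mono) auto
      also have "\<dots> \<le> real Y * real Y" by (auto intro!: mult_right_mono)
      also have "\<dots> \<le> (real N / real m) * (real N / real m)" using Y by (intro mult_mono) auto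
      finally show ?thesis using 1 Gnn by (simp add: m_def power2_eq_square)
    next
      case 2
      have pos: "int_dist (t k l) > 0"
      proof (cases "l < k")
        case True
        thus ?thesis unfolding t_eq(1)[OF True] by (intro c(3)) simp
      next
        case False
        hence "k < l" using 2 by simp
        thus ?thesis unfolding t_eq(2)[OF \<open>k < l\<close>] by (intro c(3)) simp
      qed
      have "norm (E k l) \<le> 2 * (1 / int_dist (t k l)) * real Y"
        unfolding E_eq using 2 by (intro norm_abel_incseq_le norm_sum_ucis_interval_le pos) auto
      also have "\<dots> \<le> 2 * (1 / int_dist (t k l)) * (real N / real m)"
        using Y by (intro mult_left_mono) auto
      also have "\<dots> = G k l + G l k"
      proof (cases "l < k")
        case True
        hence "G l k = 0" "m = k" by (auto simp: G_def m_def)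
        thus ?thesis unfolding t_eq(1)[OF True] using True by (simp add: G_def)
      next
        case False
        hence lk: "k < l" using 2 by simp
        hence "G k l = 0" "m = l" by (auto simp: G_def m_def)
        thus ?thesis unfolding t_eq(2)[OF lk] using lk by (simp add: G_def)
      qed
      finally show ?thesis using 2 by simp
    next
      case 3
      thus ?thesis using Gnn by (simp add: E_eq)
    qed
  qed
  have K_le: "K \<le> N" unfolding K_def by simp
  have sumG: "(\<Sum>k\<in>I. \<Sum>l\<in>I. G k l) \<le> 4 * real N * (real K * sqrt (real K)) / c"
  proof -
    \<comment> \<open>For fixed \<open>k\<close> the differences \<open>k - l\<close> are distinct
      positive numbers below \<open>k\<close>, and the bound of order \<open>k * sqrt k\<close> for
      the sum over them cancels the \<open>1 / k\<close> in \<open>G\<close>.\<close>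
    have "(\<Sum>k\<in>I. \<Sum>l\<in>I. G k l) \<le> (\<Sum>k\<in>I. 4 * real N / c * sqrt (real K))"
    proof (rule sum_mono)
      fix k assume k: "k \<in> I"
      have k0: "k > 0" "k \<le> K" using k by (auto simp: I_def)
      have "(\<Sum>l\<in>I. G k l) = (\<Sum>l\<in>I \<inter> {1..<k}. G k l)"
        by (rule sum.mono_neutral_right) (auto simp: G_def I_def)
      also have "\<dots> \<le> (\<Sum>l\<in>{1..<k}. G k l)"
        by (rule sum_mono2) (auto simp: G_def)
      also have "\<dots> = (\<Sum>h\<in>{1..<k}. 2 * real N / real k * (1 / int_dist (real h * \<theta>)))"
        by (rule sum.reindex_bij_witness[of _ "\<lambda>h. k - h" "\<lambda>l. k - l"]) (auto simp: G_def)
      also have "\<dots> = 2 * real N / real k * (\<Sum>h\<in>{1..<k}. 1 / int_dist (real h * \<theta>))"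
        by (simp add: sum_distrib_left)
      also have "\<dots> \<le> 2 * real N / real k * (2 * real k * sqrt (real k) / c)"
        by (intro mult_left_mono sum_int_dist_inverse_le bad) auto
      also have "\<dots> = 4 * real N / c * sqrt (real k)" using k0 by simp
      also have "\<dots> \<le> 4 * real N / c * sqrt (real K)" using k0 c(1) by (intro mult_left_mono) auto
      finally show "(\<Sum>l\<in>I. G k l) \<le> 4 * real N / c * sqrt (real K)" .
    qed
    also have "\<dots> = real (card I) * (4 * real N / c * sqrt (real K))" by simp
    also have "\<dots> \<le> real K * (4 * real N / c * sqrt (real K))"
      using c(1) by (intro mult_right_mono) (auto simp: I_def)
    finally show ?thesis by (simp add: mult_ac)
  qed
  have lnN: "ln (real N) \<ge> 0" by (cases "N = 0") auto
  have "(\<Sum>n\<in>{V<..N}. real n * norm (B n) ^ 2) = norm (of_real (\<Sum>n\<in>{V<..N}. real n * norm (B n) ^ 2) :: complex)"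
    unfolding norm_of_real by (intro abs_of_nonneg[symmetric] sum_nonneg) auto
  also have "\<dots> \<le> (\<Sum>p\<in>I \<times> I. ln (real N) ^ 2 * ((if fst p = snd p then real N ^ 2 * (1 / real (fst p) ^ 2) else 0) +
      G (fst p) (snd p) + G (snd p) (fst p)))"
    unfolding total
  proof (intro order_trans[OF norm_sum] sum_mono)
    fix p assume p: "p \<in> I \<times> I"
    have ml: "mangoldt k \<le> ln (real N)" if "k \<in> I" for k
    proof -
      have k: "k > 0" "k \<le> N" using that K_le by (auto simp: I_def)
      have "mangoldt k \<le> ln (real k)" using mangoldt_le[of k] k by simp
      also have "\<dots> \<le> ln (real N)" using k by simp
      finally show ?thesis .
    qed
    have "norm (of_real (mangoldt (fst p) * mangoldt (snd p)) * E (fst p) (snd p)) =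
        (mangoldt (fst p) * mangoldt (snd p)) * norm (E (fst p) (snd p))"
      by (simp add: norm_mult mangoldt_nonneg)
    also have "\<dots> \<le> (ln (real N) * ln (real N)) * ((if fst p = snd p then real N ^ 2 * (1 / real (fst p) ^ 2) else 0) +
      G (fst p) (snd p) + G (snd p) (fst p))"
      using p lnN by (intro mult_mono ml E_bound) (auto simp: mangoldt_nonneg)
    finally show "norm (of_real (mangoldt (fst p) * mangoldt (snd p)) * E (fst p) (snd p)) \<le>
      ln (real N) ^ 2 * ((if fst p = snd p then real N ^ 2 * (1 / real (fst p) ^ 2) else 0) +
      G (fst p) (snd p) + G (snd p) (fst p))"
      by (simp add: power2_eq_square)
  qed
  also have "\<dots> = ln (real N) ^ 2 * (\<Sum>k\<in>I. \<Sum>l\<in>I. (if k = l then real N ^ 2 * (1 / real k ^ 2) else 0) + G k l + G l k)"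
    unfolding sum_distrib_left[symmetric]
    by (subst sum.cartesian_product) (simp add: case_prod_unfold)
  also have "(\<Sum>k\<in>I. \<Sum>l\<in>I. (if k = l then real N ^ 2 * (1 / real k ^ 2) else 0) + G k l + G l k) =
      real N ^ 2 * (\<Sum>k\<in>I. 1 / real k ^ 2) + (\<Sum>k\<in>I. \<Sum>l\<in>I. G k l) + (\<Sum>k\<in>I. \<Sum>l\<in>I. G l k)"
    by (simp add: sum.distrib sum_distrib_left I_def)
  also have "(\<Sum>k\<in>I. \<Sum>l\<in>I. G l k) = (\<Sum>k\<in>I. \<Sum>l\<in>I. G k l)" by (rule sum.swap)
  finally have "(\<Sum>n\<in>{V<..N}. real n * norm (B n) ^ 2) \<le> ln (real N) ^ 2 *
      (real N ^ 2 * (\<Sum>k\<in>I. 1 / real k ^ 2) + (\<Sum>k\<in>I. \<Sum>l\<in>I. G k l) + (\<Sum>k\<in>I. \<Sum>l\<in>I. G k l))" .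
  also have "\<dots> \<le> ln (real N) ^ 2 * (real N ^ 2 * (1 / real U) + 4 * real N * (real K * sqrt (real K)) / c +
      4 * real N * (real K * sqrt (real K)) / c)"
    unfolding I_def by (intro mult_left_mono add_mono sumG[unfolded I_def] sum_inverse_squares_tail_le U) auto
  also have "real N ^ 2 * (1 / real U) + 4 * real N * (real K * sqrt (real K)) / c +
      4 * real N * (real K * sqrt (real K)) / c = real N ^ 2 / real U + 8 * real N * (real K * sqrt (real K)) / c"
    by (simp add: add_divide_distrib[symmetric])
  finally show ?thesis unfolding B_def .
qed

text \<open>With \<open>n\<close> as the outer variable, \<open>mob_high V n\<close> is bounded by
  the number of divisors of \<open>n\<close> and vanishes for \<open>n \<le> V\<close>.
  Cauchy--Schwarz with the factors \<open>\<bar>a n\<bar> / sqrt n\<close> and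
  \<open>sqrt n * norm (B n)\<close> separates this irregular coefficient from the smooth sum over
  \<open>n\<close> hidden in the square of \<open>B n\<close>.\<close>

lemma bilinear_sum_le:
  fixes N :: nat
  assumes bad: "bad_const c \<theta>" and U: "U \<ge> 1" and V: "V \<ge> 1"
  defines "K \<equiv> N div V"
  shows "norm (\<Sum>k\<in>{U<..N}. of_real (mangoldt k) *
       (\<Sum>n=1..N div k. of_real (mob_high V n) * ucis (real n * (real k * \<theta>)))) \<le>
    harm N ^ 2 * ln (real N) * sqrt (real N ^ 2 / real U + 8 * real N * (real K * sqrt (real K)) / c)"
proof -
  define a where "a n = mob_high V n" for n
  define L where "L k = complex_of_real (mangoldt k)" for k :: nat
  define B where "B n = (\<Sum>k\<in>{U<..N div n}. L k * ucis (real n * (real k * \<theta>)))" for n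
  define X where "X = real N ^ 2 / real U + 8 * real N * (real K * sqrt (real K)) / c"
  have X: "X \<ge> 0" using bad_constD(1)[OF bad] by (simp add: X_def)
  have lnN: "ln (real N) \<ge> 0" by (cases "N = 0") auto
  have "(\<Sum>k\<in>{U<..N}. L k * (\<Sum>n=1..N div k. of_real (a n) * ucis (real n * (real k * \<theta>)))) =
      (\<Sum>k\<in>{U<..N}. \<Sum>n | n \<in> {V<..N} \<and> n * k \<le> N. L k * (of_real (a n) * ucis (real n * (real k * \<theta>))))"
  proof (intro sum.cong refl)
    fix k assume k: "k \<in> {U<..N}"
    have iff: "n \<le> N div k \<longleftrightarrow> n * k \<le> N" for n
      using k by (simp add: less_eq_div_iff_mult_less_eq)
    have "n \<le> N" if "n * k \<le> N" for n
    proof -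
      have "1 \<le> k" using k by auto
      hence "n * 1 \<le> n * k" by (rule mult_le_mono2)
      from le_trans[OF this that] show ?thesis by simp
    qed
    hence "(\<Sum>n=1..N div k. of_real (a n) * ucis (real n * (real k * \<theta>))) =
        (\<Sum>n | n \<in> {V<..N} \<and> n * k \<le> N. of_real (a n) * ucis (real n * (real k * \<theta>)))"
    proof (intro sum.mono_neutral_right ballI)
      fix n assume n: "n \<in> {1..N div k} - {n. n \<in> {V<..N} \<and> n * k \<le> N}"
      hence "n * k \<le> N" "n > 0" by (auto simp: iff)
      moreover from this have "n \<le> N" using \<open>\<And>n. n * k \<le> N \<Longrightarrow> n \<le> N\<close> by blast
      ultimately have "n \<le> V" using n by auto
      thus "of_real (a n) * ucis (real n * (real k * \<theta>)) = 0"
        using \<open>n > 0\<close> by (simp add: a_def mob_high_eq_0)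
    qed (auto simp: iff)
    thus "L k * (\<Sum>n=1..N div k. of_real (a n) * ucis (real n * (real k * \<theta>))) =
        (\<Sum>n | n \<in> {V<..N} \<and> n * k \<le> N. L k * (of_real (a n) * ucis (real n * (real k * \<theta>))))"
      by (simp only: sum_distrib_left)
  qed
  also have "\<dots> = (\<Sum>n\<in>{V<..N}. \<Sum>k | k \<in> {U<..N} \<and> n * k \<le> N. L k * (of_real (a n) * ucis (real n * (real k * \<theta>))))"
    by (rule sum.swap_restrict) auto
  also have "\<dots> = (\<Sum>n\<in>{V<..N}. of_real (a n) * B n)"
  proof (intro sum.cong refl)
    fix n assume n: "n \<in> {V<..N}"
    have iff: "k \<le> N div n \<longleftrightarrow> n * k \<le> N" for k
      using n by (simp add: less_eq_div_iff_mult_less_eq mult.commute)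
    have "k \<le> N" if "n * k \<le> N" for k
    proof -
      have "1 \<le> n" using n by auto
      hence "1 * k \<le> n * k" by (rule mult_le_mono1)
      from le_trans[OF this that] show ?thesis by simp
    qed
    hence set: "{k. k \<in> {U<..N} \<and> n * k \<le> N} = {U<..N div n}"
      by (auto simp: iff)
    show "(\<Sum>k | k \<in> {U<..N} \<and> n * k \<le> N. L k * (of_real (a n) * ucis (real n * (real k * \<theta>)))) =
        of_real (a n) * B n"
      unfolding set B_def sum_distrib_left by (simp add: mult_ac)
  qed
  finally have S_eq: "(\<Sum>k\<in>{U<..N}. L k * (\<Sum>n=1..N div k. of_real (a n) * ucis (real n * (real k * \<theta>)))) =
      (\<Sum>n\<in>{V<..N}. of_real (a n) * B n)" .
  have "norm (\<Sum>n\<in>{V<..N}. of_real (a n) * B n) \<le>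
      (\<Sum>n\<in>{V<..N}. (\<bar>a n\<bar> / sqrt (real n)) * (sqrt (real n) * norm (B n)))"
    by (intro order_trans[OF norm_sum] sum_mono) (auto simp: norm_mult)
  hence "norm (\<Sum>n\<in>{V<..N}. of_real (a n) * B n) ^ 2 \<le>
      (\<Sum>n\<in>{V<..N}. (\<bar>a n\<bar> / sqrt (real n)) * (sqrt (real n) * norm (B n))) ^ 2"
    by (intro power_mono) auto
  also have "\<dots> \<le> (\<Sum>n\<in>{V<..N}. (\<bar>a n\<bar> / sqrt (real n)) ^ 2) * (\<Sum>n\<in>{V<..N}. (sqrt (real n) * norm (B n)) ^ 2)"
    by (rule Cauchy_Schwarz_ineq_sum)
  also have "\<dots> \<le> harm N ^ 4 * (ln (real N) ^ 2 * X)"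
  proof (intro mult_mono)
    have "(\<Sum>n\<in>{V<..N}. (\<bar>a n\<bar> / sqrt (real n)) ^ 2) \<le> (\<Sum>n\<in>{V<..N}. real (card {d. d dvd n}) ^ 2 / real n)"
    proof (rule sum_mono)
      fix n assume "n \<in> {V<..N}"
      hence "n > 0" by auto
      hence "\<bar>a n\<bar> ^ 2 \<le> real (card {d. d dvd n}) ^ 2"
        unfolding a_def by (intro power_mono abs_mob_high_le) auto
      thus "(\<bar>a n\<bar> / sqrt (real n)) ^ 2 \<le> real (card {d. d dvd n}) ^ 2 / real n"
        by (simp add: power_divide divide_right_mono)
    qed
    also have "\<dots> \<le> (\<Sum>n=1..N. real (card {d. d dvd n}) ^ 2 / real n)"
      by (intro sum_mono2) auto
    also have "\<dots> \<le> harm N ^ 4" by (rule sum_divisor_count_square_le)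
    finally show "(\<Sum>n\<in>{V<..N}. (\<bar>a n\<bar> / sqrt (real n)) ^ 2) \<le> harm N ^ 4" .
    show "(\<Sum>n\<in>{V<..N}. (sqrt (real n) * norm (B n)) ^ 2) \<le> ln (real N) ^ 2 * X"
      using sum_weighted_exp_sums_le[OF bad U V, of N]
      by (simp add: power_mult_distrib B_def L_def X_def K_def)
  qed (auto intro: sum_nonneg harm_nonneg)
  also have "\<dots> = (harm N ^ 2 * ln (real N) * sqrt X) ^ 2"
  proof -
    have "(harm N ^ 2) ^ 2 = (harm N ^ 4 :: real)" unfolding power_mult[symmetric] by simp
    thus ?thesis using X by (simp add: power_mult_distrib)
  qed
  finally have "norm (\<Sum>n\<in>{V<..N}. of_real (a n) * B n) ^ 2 \<le> (harm N ^ 2 * ln (real N) * sqrt X) ^ 2" .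
  moreover have "0 \<le> harm N ^ 2 * ln (real N) * sqrt X" using X lnN by simp
  ultimately have "norm (\<Sum>n\<in>{V<..N}. of_real (a n) * B n) \<le> harm N ^ 2 * ln (real N) * sqrt X"
    by (rule power2_le_imp_le)
  thus ?thesis unfolding S_eq[symmetric] by (simp only: L_def a_def X_def)
qed

text \<open>Vaughan's four terms estimated one by one. In the third the frequencies are
  \<open>d * k * \<theta>\<close> with \<open>d * k \<le> U * V\<close>, and there are
  \<open>U * V\<close> of them, whence the squares of both truncation points.\<close>

lemma prime_exp_sum_le:
  fixes N :: nat
  assumes bad: "bad_const c \<theta>" and U: "U \<ge> 1" "U \<le> N" and V: "V \<ge> 1"
  defines "K \<equiv> N div V"
  shows "norm (prime_exp_sum \<theta> N) \<le> real U * ln (real N) + 2 * real V ^ 2 * ln (real N) / c +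
    real U ^ 2 * real V ^ 2 * ln (real N) / c +
    harm N ^ 2 * ln (real N) * sqrt (real N ^ 2 / real U + 8 * real N * (real K * sqrt (real K)) / c)"
proof -
  note c = bad_constD[OF bad]
  have lnN: "ln (real N) \<ge> 0" by (cases "N = 0") auto
  have ml: "norm (complex_of_real (mangoldt k)) \<le> ln (real N)" if "k \<in> {1..U}" for k
  proof -
    have "mangoldt k \<le> ln (real k)" using mangoldt_le[of k] that by simp
    also have "\<dots> \<le> ln (real N)" using that U by simp
    finally show ?thesis by simp
  qed
  have 1: "norm (\<Sum>k=1..U. of_real (mangoldt k) * ucis (real k * \<theta>)) \<le> real U * ln (real N)"
  proof -
    have "norm (\<Sum>k=1..U. of_real (mangoldt k) * ucis (real k * \<theta>)) \<le> (\<Sum>k=1..U. ln (real N))"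
      by (intro order_trans[OF norm_sum] sum_mono) (subst norm_mult, use ml in auto)
    thus ?thesis by simp
  qed
  have 2: "norm (\<Sum>d=1..V. of_real (mob d) * (log_ucis_sum (N div d) (real d * \<theta>))) \<le>
      2 * real V ^ 2 * ln (real N) / c"
  proof -
    have "norm (\<Sum>d=1..V. of_real (mob d) * (log_ucis_sum (N div d) (real d * \<theta>))) \<le>
        (\<Sum>d=1..V. 1 * (2 * (real V / c) * ln (real N)))"
    proof (intro order_trans[OF norm_sum] sum_mono)
      fix d assume d: "d \<in> {1..V}"
      have "norm (log_ucis_sum (N div d) (real d * \<theta>)) \<le> 2 * (real d / c) * ln (real N)"
        using d by (intro norm_log_ucis_sum_le bad) auto
      also have "\<dots> \<le> 2 * (real V / c) * ln (real N)"
        using d c(1) lnN by (intro mult_right_mono mult_left_mono divide_right_mono) auto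
      finally show "norm (of_real (mob d) * (log_ucis_sum (N div d) (real d * \<theta>))) \<le>
          1 * (2 * (real V / c) * ln (real N))"
        unfolding norm_mult using abs_mob_le[of d] by (intro mult_mono) auto
    qed
    thus ?thesis by (simp add: power2_eq_square mult_ac)
  qed
  have 3: "norm (\<Sum>k=1..U. of_real (mangoldt k) * (\<Sum>d=1..V. of_real (mob d) *
       (ucis_sum (N div k div d) (real d * (real k * \<theta>))))) \<le>
      real U ^ 2 * real V ^ 2 * ln (real N) / c"
  proof -
    have "norm (\<Sum>k=1..U. of_real (mangoldt k) * (\<Sum>d=1..V. of_real (mob d) *
       (ucis_sum (N div k div d) (real d * (real k * \<theta>))))) \<le>
       (\<Sum>k=1..U. ln (real N) * (\<Sum>d=1..V. 1 * (real U * real V / c)))"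
    proof (intro order_trans[OF norm_sum] sum_mono, subst norm_mult, intro mult_mono ml order_trans[OF norm_sum] sum_mono)
      fix k d assume k: "k \<in> {1..U}" and d: "d \<in> {1..V}"
      have eq: "real d * (real k * \<theta>) = real (d * k) * \<theta>" by simp
      have dk: "d * k \<ge> 1" using k d by (auto simp: Suc_le_eq)
      have "d * k \<le> V * U" using k d by (intro mult_mono) auto
      hence dkUV: "real (d * k) \<le> real U * real V" by (simp add: mult.commute flip: of_nat_mult)
      have "norm (ucis_sum (N div k div d) (real d * (real k * \<theta>))) \<le> 1 / int_dist (real (d * k) * \<theta>)"
        unfolding eq by (intro norm_sum_ucis_interval_le c(3) dk)
      also have "\<dots> \<le> 1 / (c / real (d * k))"
        using c(1) c(2)[OF dk] c(3)[OF dk] dk by (intro divide_left_mono mult_pos_pos divide_pos_pos) auto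
      also have "\<dots> \<le> real U * real V / c" using dkUV c(1) by (simp add: divide_right_mono)
      finally show "norm (of_real (mob d) * (ucis_sum (N div k div d) (real d * (real k * \<theta>)))) \<le>
          1 * (real U * real V / c)"
        unfolding norm_mult using abs_mob_le[of d] by (intro mult_mono) auto
    qed (use lnN in auto)
    thus ?thesis by (simp add: power2_eq_square mult_ac)
  qed
  show ?thesis
    unfolding vaughan_identity[OF U(2), of \<theta> V] K_def
    by (intro order_trans[OF norm_triangle_ineq] add_mono order_trans[OF norm_triangle_ineq4]
        1 2 3 bilinear_sum_le[OF bad U(1) V])
qed

theorem prime_exp_sum_smallo:
  assumes bad: "bad_const c \<theta>"
  shows "(\<lambda>N. norm (prime_exp_sum \<theta> N) / real N) \<longlonglongrightarrow> 0"
proof (rule Lim_null_comparison)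
  note c = bad_constD[OF bad]
  \<comment> \<open>Majorant, up to the factor \<open>1 / c\<close>, for \<open>U\<close> about
    \<open>x powr (1/20)\<close> and \<open>V = U ^ 8\<close>, so that \<open>V\<close> is about
    \<open>x powr (2/5)\<close> and \<open>K\<close> about \<open>x powr (3/5)\<close>. The
    exponents are those of \<open>U\<close>, \<open>V ^ 2\<close>, \<open>U ^ 2 * V ^ 2\<close>,
    \<open>x ^ 2 / U\<close> and \<open>x * K * sqrt K\<close>. The large constant arises because
    rounding may halve \<open>U\<close>, which is then raised to the eighth power.\<close>
  define g where "g x = (x powr (1/20) * ln x + 2 * x powr (4/5) * ln x + x powr (9/10) * ln x +
    (1 + ln x) ^ 2 * ln x * sqrt (2 * x powr (39/20) + 32768 * x powr (19/10))) / x" for x :: real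
  have "(g \<longlongrightarrow> 0) at_top" unfolding g_def by real_asymp
  hence "(\<lambda>N. 1 / c * g (real N)) \<longlonglongrightarrow> 1 / c * 0"
    by (intro tendsto_mult tendsto_const filterlim_compose[OF _ filterlim_real_sequentially])
  thus "(\<lambda>N. 1 / c * g (real N)) \<longlonglongrightarrow> 0" by simp
  show "eventually (\<lambda>N. norm (norm (prime_exp_sum \<theta> N) / real N) \<le> 1 / c * g (real N)) sequentially"
    using eventually_ge_at_top[of 1]
  proof eventually_elim
    case (elim N)
    define x where "x = real N"
    define y where "y = x powr (1/20)"
    (* all error terms are o(N) once U, N^(1/2) / (U V) and V / N^(1/3) are powers of N *)
    define U where "U = nat \<lfloor>y\<rfloor>"
    define V where "V = U ^ 8"
    define K where "K = N div V"
    have x: "x \<ge> 1" using elim by (simp add: x_def)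
    have y: "y \<ge> 1" using x by (simp add: y_def ge_one_powr_ge_zero)
    have yp: "y ^ k = x powr (real k / 20)" for k
      using x by (simp add: y_def powr_powr flip: powr_realpow)
    have U: "real U \<le> y" "y / 2 \<le> real U" "U \<ge> 1" proof -
      have "real (nat \<lfloor>y\<rfloor>) = of_int \<lfloor>y\<rfloor>" "\<lfloor>y\<rfloor> \<ge> 1" using y by auto
      moreover have "of_int \<lfloor>y\<rfloor> \<le> y" "y < of_int \<lfloor>y\<rfloor> + 1" by linarith+
      ultimately show "real U \<le> y" "y / 2 \<le> real U" "U \<ge> 1" unfolding U_def by linarith+
    qed
    have UN: "U \<le> N"
    proof -
      have "y \<le> x powr 1" unfolding y_def using x by (intro powr_mono) auto
      thus ?thesis using U(1) x by (simp add: x_def)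
    qed
    have V: "V \<ge> 1" "real V \<le> y ^ 8" using U by (auto simp: V_def intro!: power_mono one_le_power)
    have Vge: "(y / 2) ^ 8 \<le> real V" using U y by (auto simp: V_def intro!: power_mono)
    have lnN: "ln x \<ge> 0" using x by simp
    have c1: "1 \<le> 1 / c" using bad_const_le_half[OF bad] c(1) by simp
    have "real K \<le> x / (y / 2) ^ 8"
    proof -
      have "real K \<le> x / real V" unfolding K_def x_def by (rule of_nat_div_le_of_nat)
      also have "\<dots> \<le> x / (y / 2) ^ 8" using x y V Vge by (intro divide_left_mono mult_pos_pos) auto
      finally show ?thesis .
    qed
    also have "\<dots> = 256 * x powr (3/5)"
    proof -
      have "x / y ^ 8 = x powr (1 - 2/5)" unfolding yp using x by (subst powr_diff) auto
      moreover have "x / (y / 2) ^ 8 = 256 * (x / y ^ 8)" by (simp add: power_divide)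
      ultimately show ?thesis by simp
    qed
    finally have K: "real K \<le> 256 * x powr (3/5)" .
    hence "sqrt (real K) \<le> sqrt (256 * x powr (3/5))" by simp
    also have "\<dots> = 16 * x powr (3/10)"
      using x by (simp add: real_sqrt_mult powr_half_sqrt[symmetric] powr_powr)
    finally have sK: "sqrt (real K) \<le> 16 * x powr (3/10)" .
    have "x * (real K * sqrt (real K)) \<le> x * ((256 * x powr (3/5)) * (16 * x powr (3/10)))"
      using K sK x by (intro mult_left_mono mult_mono) auto
    also have "\<dots> = 4096 * x powr (1 + 3/5 + 3/10)" unfolding powr_add using x by simp
    finally have xK: "x * (real K * sqrt (real K)) \<le> 4096 * x powr (19/10)" by simp
    have xU: "x ^ 2 / real U \<le> 2 * x powr (39/20)"
    proof -
      have "x ^ 2 / real U \<le> x ^ 2 / (y / 2)" using U y x by (intro divide_left_mono mult_pos_pos) auto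
      also have "\<dots> = 2 * (x powr 2 / x powr (1/20))" using x by (simp add: y_def)
      also have "x powr 2 / x powr (1/20) = x powr (2 - 1/20)" by (rule powr_diff[symmetric])
      finally show ?thesis by simp
    qed
    have s: "sqrt (x ^ 2 / real U + 8 * x * (real K * sqrt (real K)) / c) \<le>
        1 / c * sqrt (2 * x powr (39/20) + 32768 * x powr (19/10))"
    proof -
      have "x ^ 2 / real U + 8 * x * (real K * sqrt (real K)) / c \<le>
          1 / c * (2 * x powr (39/20)) + 1 / c * (32768 * x powr (19/10))"
      proof (rule add_mono)
        have "1 * (2 * x powr (39/20)) \<le> 1 / c * (2 * x powr (39/20))"
          using c1 by (intro mult_right_mono) auto
        thus "x ^ 2 / real U \<le> 1 / c * (2 * x powr (39/20))" using xU by simp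
        have "8 * x * (real K * sqrt (real K)) \<le> 32768 * x powr (19/10)" using xK by simp
        hence "8 * x * (real K * sqrt (real K)) / c \<le> 32768 * x powr (19/10) / c"
          using c(1) by (intro divide_right_mono) auto
        thus "8 * x * (real K * sqrt (real K)) / c \<le> 1 / c * (32768 * x powr (19/10))" by simp
      qed
      also have "\<dots> = 1 / c * (2 * x powr (39/20) + 32768 * x powr (19/10))" by (simp add: distrib_left)
      also have "\<dots> \<le> (1 / c) ^ 2 * (2 * x powr (39/20) + 32768 * x powr (19/10))"
        using c1 by (intro mult_right_mono self_le_power) auto
      finally have "sqrt (x ^ 2 / real U + 8 * x * (real K * sqrt (real K)) / c) \<le>
          sqrt ((1 / c) ^ 2 * (2 * x powr (39/20) + 32768 * x powr (19/10)))" by simp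
      also have "\<dots> = 1 / c * sqrt (2 * x powr (39/20) + 32768 * x powr (19/10))"
        using c(1) by (simp add: real_sqrt_mult)
      finally show ?thesis .
    qed
    have harm: "harm N \<le> 1 + ln x"
      using euler_mascheroni_sequence_decreasing[of 1 N] elim by (simp add: harm_expand x_def)
    have V2: "real V ^ 2 \<le> x powr (4/5)"
    proof -
      have "real V ^ 2 \<le> (y ^ 8) ^ 2" using V by (intro power_mono) auto
      also have "\<dots> = y ^ 16" by (simp flip: power_mult)
      finally show ?thesis unfolding yp by simp
    qed
    have UV2: "real U ^ 2 * real V ^ 2 \<le> x powr (9/10)"
    proof -
      have "real U ^ 2 * real V ^ 2 \<le> y ^ 2 * (y ^ 8) ^ 2" using U V by (intro mult_mono power_mono) auto
      also have "\<dots> = y ^ 18" by (simp flip: power_mult power_add)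
      finally show ?thesis unfolding yp by simp
    qed
    have "norm (prime_exp_sum \<theta> N) \<le> real U * ln x + 2 * real V ^ 2 * ln x / c +
      real U ^ 2 * real V ^ 2 * ln x / c +
      harm N ^ 2 * ln x * sqrt (x ^ 2 / real U + 8 * x * (real K * sqrt (real K)) / c)"
      unfolding x_def K_def by (rule prime_exp_sum_le[OF bad U(3) UN V(1)])
    also have "\<dots> \<le> 1 / c * (y * ln x) + 1 / c * (2 * x powr (4/5) * ln x) + 1 / c * (x powr (9/10) * ln x) +
      (1 + ln x) ^ 2 * ln x * (1 / c * sqrt (2 * x powr (39/20) + 32768 * x powr (19/10)))"
    proof (intro add_mono)
      have "1 * (real U * ln x) \<le> 1 / c * (y * ln x)"
        using c1 c(1) U lnN by (intro mult_mono mult_right_mono) auto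
      thus "real U * ln x \<le> 1 / c * (y * ln x)" by simp
      have "2 * real V ^ 2 * ln x \<le> 2 * x powr (4/5) * ln x"
        using V2 lnN by (intro mult_right_mono) auto
      thus "2 * real V ^ 2 * ln x / c \<le> 1 / c * (2 * x powr (4/5) * ln x)"
        using c(1) by (simp add: divide_right_mono)
      have "real U ^ 2 * real V ^ 2 * ln x \<le> x powr (9/10) * ln x"
        using UV2 lnN by (intro mult_right_mono) auto
      thus "real U ^ 2 * real V ^ 2 * ln x / c \<le> 1 / c * (x powr (9/10) * ln x)"
        using c(1) by (simp add: divide_right_mono)
      show "harm N ^ 2 * ln x * sqrt (x ^ 2 / real U + 8 * x * (real K * sqrt (real K)) / c) \<le>
          (1 + ln x) ^ 2 * ln x * (1 / c * sqrt (2 * x powr (39/20) + 32768 * x powr (19/10)))"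
        using harm lnN s x c(1) by (intro mult_mono power_mono) (auto intro: harm_nonneg)
    qed
    also have "\<dots> = 1 / c * (g x * x)"
    proof -
      have gx: "g x * x = x powr (1/20) * ln x + 2 * x powr (4/5) * ln x + x powr (9/10) * ln x +
          (1 + ln x) ^ 2 * ln x * sqrt (2 * x powr (39/20) + 32768 * x powr (19/10))"
        using x by (simp add: g_def)
      show ?thesis unfolding gx by (simp add: y_def distrib_left)
    qed
    finally have "norm (prime_exp_sum \<theta> N) / x \<le> 1 / c * g x"
      using x by (simp add: field_simps)
    thus ?case by (simp add: x_def)
  qed
qed

section \<open>Weighted exponential sums over primes\<close>

definition prime_recip_sum :: "nat \<Rightarrow> real" where
  "prime_recip_sum N = (\<Sum>p | p \<in> {1..N} \<and> prime p. 1 / real p)"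

lemma prime_recip_sum_at_top: "filterlim prime_recip_sum at_top at_top"
proof (rule filterlim_at_top_mono)
  show "filterlim (\<lambda>N :: nat. ln (ln (real N + 1) / 2)) at_top at_top" by real_asymp
  show "eventually (\<lambda>N. ln (ln (real N + 1) / 2) \<le> prime_recip_sum N) at_top"
    unfolding prime_recip_sum_def using sum_inverse_primes_ge by (intro always_eventually) auto
qed

text \<open>A proper prime power \<open>p^k\<close> is at least the square of \<open>p^(k div 2)\<close>.\<close>

lemma sum_inverse_proper_prime_powers_le:
  "(\<Sum>n | n \<in> {1..N} \<and> primepow n \<and> \<not> prime n. 1 / real n) \<le> 4"
proof -
  define X where "X = {n. n \<in> {1..N} \<and> primepow n \<and> \<not> prime n}"
  define p where "p n = aprimedivisor n" for n :: nat
  define k where "k n = multiplicity (p n) n" for n :: nat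
  define a where "a n = p n ^ (k n div 2)" for n
  have props: "prime (p n)" "n = p n ^ k n" "k n \<ge> 2" if "n \<in> X" for n
  proof -
    have pp: "primepow n" "\<not> prime n" using that by (auto simp: X_def)
    from pp(1) obtain q j where q: "prime q" "j > 0" "n = q ^ j"
      by (auto simp: primepow_def)
    thus pr: "prime (p n)" by (simp add: p_def aprimedivisor_prime_power)
    show n: "n = p n ^ k n" unfolding p_def k_def using primepow_decompose[OF pp(1)] by simp
    have "k n \<noteq> 0" using n primepow_gt_Suc_0[OF pp(1)] by (metis One_nat_def less_irrefl power_0)
    moreover have "k n \<noteq> 1" using n pp pr by (metis power_one_right)
    ultimately show "k n \<ge> 2" by linarith
  qed
  \<comment> \<open>The parity of the exponent is what \<open>k n div 2\<close> forgets; each square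
    is thus used at most twice.\<close>
  have inj: "inj_on (\<lambda>n. (a n, odd (k n))) X"
  proof (rule inj_onI)
    fix n m assume nm: "n \<in> X" "m \<in> X" "(a n, odd (k n)) = (a m, odd (k m))"
    note n = props[OF nm(1)] and m = props[OF nm(2)]
    have "aprimedivisor (a n) = p n" "aprimedivisor (a m) = p m"
      unfolding a_def using n m by (auto intro!: aprimedivisor_prime_power)
    hence peq: "p n = p m" using nm(3) by simp
    have "p n > 1" using n(1) by (rule prime_gt_1_nat)
    hence "k n div 2 = k m div 2" using nm(3) peq by (simp add: a_def power_inject_exp)
    moreover have "odd (k n) = odd (k m)" using nm(3) by simp
    ultimately have "k n = k m" by (metis odd_two_times_div_two_succ even_two_times_div_two)
    thus "n = m" using n(2) m(2) peq by simp
  qed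
  have im: "(\<lambda>n. (a n, odd (k n))) ` X \<subseteq> {1..N} \<times> UNIV"
  proof (rule image_subsetI)
    fix n assume n: "n \<in> X"
    have p1: "p n \<ge> 1" using props(1)[OF n] prime_ge_1_nat by blast
    hence "a n \<le> p n ^ k n" unfolding a_def by (intro power_increasing) auto
    also have "\<dots> = n" using props(2)[OF n] by simp
    finally have "a n \<le> N" using n by (simp add: X_def)
    moreover have "a n \<ge> 1" using p1 unfolding a_def by (rule one_le_power)
    ultimately show "(a n, odd (k n)) \<in> {1..N} \<times> UNIV" by simp
  qed
  have "(\<Sum>n\<in>X. 1 / real n) \<le> (\<Sum>n\<in>X. 1 / real (a n) ^ 2)"
  proof (rule sum_mono)
    fix n assume n: "n \<in> X"
    have p1: "p n \<ge> 1" using props(1)[OF n] prime_ge_1_nat by blast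
    have "a n ^ 2 = p n ^ (k n div 2 * 2)" by (simp add: a_def power_mult)
    also have "\<dots> \<le> p n ^ k n" using p1 by (intro power_increasing) auto
    also have "\<dots> = n" using props(2)[OF n] by simp
    finally have "real (a n) ^ 2 \<le> real n" by (metis of_nat_le_iff of_nat_power)
    moreover have "a n \<ge> 1" using p1 unfolding a_def by (rule one_le_power)
    ultimately show "1 / real n \<le> 1 / real (a n) ^ 2"
      using n by (intro divide_left_mono) (auto simp: X_def)
  qed
  also have "\<dots> = (\<Sum>x\<in>(\<lambda>n. (a n, odd (k n))) ` X. 1 / real (fst x) ^ 2)"
    by (subst sum.reindex[OF inj]) simp
  also have "\<dots> \<le> (\<Sum>x\<in>{1..N} \<times> (UNIV :: bool set). 1 / real (fst x) ^ 2)"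
    by (intro sum_mono2 im) auto
  also have "\<dots> = (\<Sum>i=1..N. \<Sum>b\<in>(UNIV :: bool set). 1 / real i ^ 2)"
    by (subst sum.cartesian_product) (simp add: case_prod_unfold)
  also have "\<dots> = 2 * (\<Sum>i=1..N. 1 / real i ^ 2)" by (simp add: sum_distrib_left)
  also have "\<dots> \<le> 2 * 2" by (intro mult_left_mono sum_inverse_squares_le) auto
  finally show ?thesis by (simp add: X_def)
qed

text \<open>A telescoping comparison with \<open>ln (ln n)\<close>: the inequality
  \<open>ln x \<le> x - 1\<close> is applied once to \<open>n / (n + 1)\<close> and once to the
  quotient of consecutive logarithms.\<close>

lemma sum_inverse_n_ln_n_le:
  assumes "N \<ge> 2"
  shows "(\<Sum>n=2..N. 1 / (real n * ln (real n))) \<le> 1 / (2 * ln 2) + ln (ln (real N)) - ln (ln 2)"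
  using assms
proof (induction N rule: nat_induct_at_least)
  case (Suc n)
  define L where "L = ln (real n)"
  define L' where "L' = ln (real (Suc n))"
  have L: "L > 0" "L' > 0" using Suc by (auto simp: L_def L'_def)
  have "ln (real n / real (Suc n)) \<le> real n / real (Suc n) - 1"
    using Suc by (intro ln_le_minus_one) auto
  also have "\<dots> = - (1 / real (Suc n))" by (simp add: field_simps)
  also have "ln (real n / real (Suc n)) = L - L'" using Suc by (simp add: L_def L'_def ln_div)
  finally have "1 / real (Suc n) \<le> L' - L" by simp
  hence "1 / real (Suc n) / L' \<le> (L' - L) / L'" using L by (intro divide_right_mono) auto
  also have "(L' - L) / L' = 1 - L / L'" using L by (simp add: field_simps)
  also have "\<dots> \<le> - ln (L / L')" using ln_le_minus_one[of "L / L'"] L by simp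
  also have "\<dots> = ln L' - ln L" using L by (simp add: ln_div)
  finally have "1 / (real (Suc n) * L') \<le> ln L' - ln L" by simp
  thus ?case using Suc.IH Suc.hyps by (simp add: L_def L'_def)
qed simp

text \<open>Partial summation read backwards for partial sums equal to \<open>n\<close>. The
  additional \<open>f 2\<close> appears because the sum starts at 2 and not at 1.\<close>

lemma abel_linear_eq:
  fixes f :: "nat \<Rightarrow> real"
  assumes "N \<ge> 2"
  shows "f N * real N + (\<Sum>n=2..<N. (f n - f (Suc n)) * real n) = f 2 + (\<Sum>n=2..N. f n)"
  using assms
proof (induction N rule: nat_induct_at_least)
  case (Suc n)
  have "(\<Sum>k=2..<Suc n. (f k - f (Suc k)) * real k) =
      (\<Sum>k=2..<n. (f k - f (Suc k)) * real k) + (f n - f (Suc n)) * real n"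
    using Suc.hyps by simp
  with Suc show ?case by (simp add: algebra_simps)
qed simp

text \<open>Partial summation with \<open>f n = 1 / (n * ln n)\<close> turns \<open>mangoldt\<close>
  into the weight \<open>1 / p\<close> at primes. Partial sums of size
  \<open>\<epsilon> * n + C\<close> yield \<open>\<epsilon>\<close> times a sum of order
  \<open>log log N\<close>, plus a constant; proper prime powers contribute at most 4.\<close>

theorem prime_weighted_exp_sum_smallo:
  assumes bad: "bad_const c \<theta>"
  shows "(\<lambda>N. norm (\<Sum>p | p \<in> {1..N} \<and> prime p. of_real (1 / real p) * ucis (real p * \<theta>)) /
    prime_recip_sum N) \<longlonglongrightarrow> 0"
proof (rule tendstoI)
  fix e :: real assume e: "e > 0"
  define \<epsilon> where "\<epsilon> = e / 4"
  have \<epsilon>: "\<epsilon> > 0" using e by (simp add: \<epsilon>_def)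
  define f where "f n = 1 / (real n * ln (real n))" for n
  have "eventually (\<lambda>N. norm (prime_exp_sum \<theta> N) / real N < \<epsilon>) sequentially"
    using order_tendstoD(2)[OF prime_exp_sum_smallo[OF bad] \<epsilon>] .
  then obtain N0 where N0: "\<And>N. N \<ge> N0 \<Longrightarrow> norm (prime_exp_sum \<theta> N) / real N < \<epsilon>"
    by (auto simp: eventually_at_top_linorder)
  \<comment> \<open>Absorbs the finitely many \<open>N\<close> below the threshold, so that the
    bound \<open>T\<close> is available at every stage of the partial summation.\<close>
  define C where "C = (\<Sum>N<N0. norm (prime_exp_sum \<theta> N))"
  have C: "C \<ge> 0" by (auto simp: C_def intro: sum_nonneg)
  have T: "norm (prime_exp_sum \<theta> N) \<le> \<epsilon> * real N + C" if "N \<ge> 2" for N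
  proof (cases "N < N0")
    case True
    hence "norm (prime_exp_sum \<theta> N) \<le> C" unfolding C_def by (intro member_le_sum) auto
    thus ?thesis using \<epsilon> by (simp add: add_increasing)
  next
    case False
    hence "norm (prime_exp_sum \<theta> N) < \<epsilon> * real N" using N0[of N] that by (simp add: field_simps)
    thus ?thesis using C by simp
  qed
  define P where "P N = (\<Sum>p | p \<in> {1..N} \<and> prime p. of_real (1 / real p) * ucis (real p * \<theta>))" for N
  define A where "A = 4 + C * f 2 + \<epsilon> * (2 * f 2 - ln (ln 2) + ln 2)"
  have main: "norm (P N) \<le> A + \<epsilon> * prime_recip_sum N" if N: "N \<ge> 2" for N
  proof -
    have f_dec: "f (Suc n) \<le> f n" if "n \<ge> 2" for n
      unfolding f_def using that by (intro divide_left_mono mult_mono mult_pos_pos) auto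
    have f_pos: "f n \<ge> 0" if "n \<ge> 2" for n unfolding f_def using that by simp
    have exp: "(\<Sum>i=2..n. of_real (mangoldt i) * ucis (real i * \<theta>)) = prime_exp_sum \<theta> n" if "n \<ge> 2" for n
    proof -
      have "{1..n} = insert 1 {2..n}" using that by auto
      thus ?thesis by (simp add: prime_exp_sum_def)
    qed
    have "norm (\<Sum>n=2..N. of_real (f n) * (of_real (mangoldt n) * ucis (real n * \<theta>))) \<le>
        f N * (\<epsilon> * real N + C) + (\<Sum>n=2..<N. (f n - f (Suc n)) * (\<epsilon> * real n + C))"
    proof (rule norm_abel_decseq_le)
      show "norm (\<Sum>i=2..n. of_real (mangoldt i) * ucis (real i * \<theta>)) \<le> \<epsilon> * real n + C" if "2 \<le> n" for n
        unfolding exp[OF that] by (rule T[OF that])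
    qed (use N f_dec f_pos in auto)
    also have "\<dots> = \<epsilon> * (f N * real N + (\<Sum>n=2..<N. (f n - f (Suc n)) * real n)) +
        C * (f N + (\<Sum>n=2..<N. f n - f (Suc n)))"
      by (simp add: algebra_simps sum.distrib sum_distrib_left sum_subtractf)
    also have "f N * real N + (\<Sum>n=2..<N. (f n - f (Suc n)) * real n) = f 2 + (\<Sum>n=2..N. f n)"
      by (rule abel_linear_eq[OF N])
    also have "f N + (\<Sum>n=2..<N. f n - f (Suc n)) = f 2"
      using sum_Suc_diff'[OF N, of "\<lambda>n. - f n"] by simp
    finally have "norm (\<Sum>n=2..N. of_real (f n) * (of_real (mangoldt n) * ucis (real n * \<theta>))) \<le>
        \<epsilon> * (f 2 + (\<Sum>n=2..N. f n)) + C * f 2" .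
    also have "(\<Sum>n=2..N. f n) \<le> f 2 + ln (ln (real N)) - ln (ln 2)"
      using sum_inverse_n_ln_n_le[OF N] by (simp add: f_def)
    also have "ln (ln (real N)) \<le> prime_recip_sum N + ln 2"
    proof -
      have "ln (ln (real N)) \<le> ln (ln (real N + 1))" using N by (subst ln_le_cancel_iff) auto
      also have "\<dots> = ln (ln (real N + 1) / 2) + ln 2" using N by (simp add: ln_div)
      also have "\<dots> \<le> prime_recip_sum N + ln 2"
        using sum_inverse_primes_ge[of N] by (simp add: prime_recip_sum_def)
      finally show ?thesis .
    qed
    finally have G: "norm (\<Sum>n=2..N. of_real (f n) * (of_real (mangoldt n) * ucis (real n * \<theta>))) \<le>
        \<epsilon> * (f 2 + (f 2 + (prime_recip_sum N + ln 2) - ln (ln 2))) + C * f 2"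
      using \<epsilon> by simp
    define R where "R = {n. n \<in> {1..N} \<and> primepow n \<and> \<not> prime n}"
    define Q where "Q = {n. n \<in> {1..N} \<and> prime n}"
    define h where "h n = complex_of_real (f n) * (of_real (mangoldt n) * ucis (real n * \<theta>))" for n
    have "(\<Sum>n=2..N. h n) = (\<Sum>n\<in>Q \<union> R. h n)"
      by (rule sum.mono_neutral_right) (auto simp: Q_def R_def h_def mangoldt_def dest: prime_ge_2_nat primepow_gt_Suc_0)
    also have "\<dots> = (\<Sum>n\<in>Q. h n) + (\<Sum>n\<in>R. h n)"
      by (rule sum.union_disjoint) (auto simp: Q_def R_def)
    also have "(\<Sum>n\<in>Q. h n) = P N"
      unfolding P_def Q_def[symmetric]
    proof (intro sum.cong refl)
      fix p assume "p \<in> Q"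
      hence p: "prime p" "ln (real p) > 0" by (auto simp: Q_def dest: prime_gt_1_nat)
      have "f p * ln (real p) = 1 / real p" using p(2) by (simp add: f_def)
      hence "complex_of_real (f p) * of_real (ln (real p)) = of_real (1 / real p)"
        by (metis of_real_mult)
      thus "h p = of_real (1 / real p) * ucis (real p * \<theta>)"
        using p(1) by (simp add: h_def mult.assoc[symmetric])
    qed
    finally have PN: "P N = (\<Sum>n=2..N. h n) - (\<Sum>n\<in>R. h n)" by simp
    have "norm (\<Sum>n\<in>R. h n) \<le> (\<Sum>n\<in>R. 1 / real n)"
    proof (intro order_trans[OF norm_sum] sum_mono)
      fix n assume "n \<in> R"
      hence n: "n \<ge> 2" by (auto simp: R_def dest: primepow_gt_Suc_0)
      have "norm (h n) = f n * mangoldt n"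
        using f_pos[OF n] by (simp add: h_def norm_mult)
      also have "\<dots> \<le> f n * ln (real n)"
        using f_pos[OF n] mangoldt_le[of n] n by (intro mult_left_mono) auto
      also have "\<dots> = 1 / real n" using n by (simp add: f_def)
      finally show "norm (h n) \<le> 1 / real n" .
    qed
    also have "\<dots> \<le> 4" unfolding R_def by (rule sum_inverse_proper_prime_powers_le)
    finally have "norm (P N) \<le> norm (\<Sum>n=2..N. h n) + 4"
      unfolding PN using norm_triangle_ineq4[of "\<Sum>n=2..N. h n" "\<Sum>n\<in>R. h n"] by linarith
    also have "\<dots> \<le> \<epsilon> * (f 2 + (f 2 + (prime_recip_sum N + ln 2) - ln (ln 2))) + C * f 2 + 4"
      using G by (simp add: h_def)
    also have "\<dots> = A + \<epsilon> * prime_recip_sum N" by (simp add: A_def algebra_simps)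
    finally show ?thesis .
  qed
  have "eventually (\<lambda>N. prime_recip_sum N \<ge> max 1 (A / \<epsilon>)) at_top"
    using prime_recip_sum_at_top unfolding filterlim_at_top by blast
  thus "eventually (\<lambda>N. dist (norm (\<Sum>p | p \<in> {1..N} \<and> prime p. of_real (1 / real p) * ucis (real p * \<theta>)) /
    prime_recip_sum N) 0 < e) sequentially"
    using eventually_ge_at_top[of 2]
  proof eventually_elim
    case (elim N)
    have S: "prime_recip_sum N > 0" using elim by simp
    have "A \<le> \<epsilon> * prime_recip_sum N" using elim \<epsilon> by (simp add: field_simps)
    with main[of N] elim have "norm (P N) \<le> 2 * \<epsilon> * prime_recip_sum N" by simp
    hence "norm (P N) / prime_recip_sum N \<le> 2 * \<epsilon>" using S by (simp add: field_simps)
    also have "\<dots> < e" using e by (simp add: \<epsilon>_def)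
    finally show ?case using S by (simp add: P_def)
  qed
qed

section \<open>Limsup sets of balls\<close>

text \<open>A substitute for the density theorem. If \<open>F\<close> has measure
  \<open>\<mu>\<close>, a cover by nonoverlapping intervals of total length at most
  \<open>\<mu> + e\<close>, combined with sparseness in each of them, gives
  \<open>\<mu> \<le> (1 - c) * (\<mu> + e) + e\<close>. For \<open>e = c * \<mu> / 4\<close> this
  fails unless \<open>\<mu> = 0\<close>.\<close>

lemma negligible_if_uniformly_sparse:
  fixes F :: "real set"
  assumes F: "F \<in> lmeasurable" "F \<subseteq> {0..1}" and c: "c > 0"
    and sparse: "\<And>a b. 0 \<le> a \<Longrightarrow> a < b \<Longrightarrow> b \<le> 1 \<Longrightarrow>
      measure lebesgue (F \<inter> {a..b}) \<le> (1 - c) * (b - a)"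
  shows "negligible F"
proof (rule ccontr)
  assume "\<not> negligible F"
  hence \<mu>: "measure lebesgue F > 0"
    using F(1) by (auto simp: negligible_iff_measure less_le)
  have c1: "c \<le> 1"
    using order_trans[OF measure_nonneg sparse[of 0 1]] by simp
  define e where "e = c * measure lebesgue F / 4"
  have e: "e > 0" using c \<mu> by (simp add: e_def)
  have F': "F \<subseteq> cbox 0 1" using F(2) by (simp add: cbox_interval)
  obtain \<D> where \<D>: "countable \<D>"
      "\<And>K. K \<in> \<D> \<Longrightarrow> K \<subseteq> cbox 0 1 \<and> K \<noteq> {} \<and> (\<exists>c d. K = cbox c d)"
      "pairwise (\<lambda>A B. interior A \<inter> interior B = {}) \<D>"
      "\<And>u v. cbox u v \<in> \<D> \<Longrightarrow> \<exists>n. \<forall>i\<in>Basis. v \<bullet> i - u \<bullet> i = (1 \<bullet> i - 0 \<bullet> i) / 2 ^ n"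
      "\<And>K. \<lbrakk>K \<in> \<D>; box 0 (1 :: real) \<noteq> {}\<rbrakk> \<Longrightarrow> interior K \<noteq> {}"
      "F \<subseteq> \<Union>\<D>" "\<Union>\<D> \<in> lmeasurable" "measure lebesgue (\<Union>\<D>) \<le> measure lebesgue F + e"
    by (rule measurable_outer_intervals_bounded[OF F(1) F' e]) (rule that)
  have meas: "K \<in> lmeasurable" if "K \<in> \<D>" for K using \<D>(2)[OF that] by auto
  \<comment> \<open>Additivity is then needed for finitely many intervals only; the part of
    \<open>F\<close> they miss lies in a set of measure below \<open>e\<close>.\<close>
  obtain \<D>' where \<D>': "\<D>' \<subseteq> \<D>" "finite \<D>'" "measure lebesgue (\<Union>\<D>) - e < measure lebesgue (\<Union>\<D>')"
  proof (rule measure_countable_Union_approachable[OF \<D>(1) e meas])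
    fix \<D>' assume "\<D>' \<subseteq> \<D>" "finite \<D>'"
    thus "measure lebesgue (\<Union>\<D>') \<le> measure lebesgue (\<Union>\<D>)"
      using meas \<D>(7) by (intro measure_mono_fmeasurable) (auto intro!: sets.finite_Union fmeasurableD)
  qed auto
  have U': "\<Union>\<D>' \<in> lmeasurable" using \<D>' meas by (intro fmeasurable.finite_Union) auto
  have sum_eq: "measure lebesgue (\<Union>\<D>') = (\<Sum>K\<in>\<D>'. measure lebesgue K)"
  proof (rule measure_negligible_finite_Union)
    show "pairwise (\<lambda>S T. negligible (S \<inter> T)) \<D>'"
    proof (rule pairwiseI)
      fix A B assume AB: "A \<in> \<D>'" "B \<in> \<D>'" "A \<noteq> B"
      have "convex (A \<inter> B)" using \<D>(2)[of A] \<D>(2)[of B] AB \<D>'(1) by (auto intro!: convex_Int)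
      moreover have "interior (A \<inter> B) = {}"
        using \<D>(3) AB \<D>'(1) unfolding pairwise_def by auto
      ultimately show "negligible (A \<inter> B)" by (simp add: negligible_convex_interior)
    qed
  qed (use \<D>' meas in auto)
  have K: "measure lebesgue (F \<inter> K) \<le> (1 - c) * measure lebesgue K" if KD: "K \<in> \<D>" for K
  proof -
    obtain a b where ab: "K = {a..b}" using \<D>(2)[OF KD] by (auto simp: cbox_interval)
    have "interior K \<noteq> {}" using \<D>(5)[OF KD] by simp
    hence "a < b" unfolding ab by simp
    moreover have "0 \<le> a" "b \<le> 1" using \<D>(2)[OF KD] \<open>a < b\<close> unfolding ab by auto
    ultimately show ?thesis using sparse[of a b] by (simp add: ab)
  qed
  have "measure lebesgue F \<le> measure lebesgue ((\<Union>K\<in>\<D>'. F \<inter> K) \<union> (\<Union>\<D> - \<Union>\<D>'))"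
    using \<D>(6,7) U' \<D>' meas F(1)
    by (intro measure_mono_fmeasurable) (auto intro!: fmeasurable.Un fmeasurable.finite_UN fmeasurable_Diff fmeasurableD
        intro: fmeasurable.Int)
  also have "\<dots> \<le> measure lebesgue (\<Union>K\<in>\<D>'. F \<inter> K) + measure lebesgue (\<Union>\<D> - \<Union>\<D>')"
    using \<D>(7) U' \<D>' meas F(1)
    by (intro measure_Un_le) (auto intro!: sets.finite_UN fmeasurableD fmeasurable.Diff intro: fmeasurable.Int)
  also have "measure lebesgue (\<Union>K\<in>\<D>'. F \<inter> K) \<le> (\<Sum>K\<in>\<D>'. measure lebesgue (F \<inter> K))"
    using \<D>' meas F(1) by (intro measure_UNION_le) (auto intro!: fmeasurableD intro: fmeasurable.Int)
  also have "\<dots> \<le> (\<Sum>K\<in>\<D>'. (1 - c) * measure lebesgue K)"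
    using K \<D>'(1) by (intro sum_mono) auto
  also have "\<dots> = (1 - c) * measure lebesgue (\<Union>\<D>')"
    by (simp add: sum_eq sum_distrib_left)
  also have "measure lebesgue (\<Union>\<D> - \<Union>\<D>') = measure lebesgue (\<Union>\<D>) - measure lebesgue (\<Union>\<D>')"
    using \<D>(7) U' \<D>'(1) by (intro measurable_measure_Diff) (auto intro: fmeasurableD)
  also have "\<dots> \<le> e" using \<D>'(3) by simp
  also have "measure lebesgue (\<Union>\<D>') \<le> measure lebesgue F + e"
  proof -
    have "measure lebesgue (\<Union>\<D>') \<le> measure lebesgue (\<Union>\<D>)"
      using \<D>'(1) U' \<D>(7) by (intro measure_mono_fmeasurable) (auto intro: fmeasurableD)
    thus ?thesis using \<D>(8) by simp
  qed
  finally have "measure lebesgue F \<le> (1 - c) * (measure lebesgue F + e) + e"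
    using c1 by (simp add: mult_left_mono)
  also have "\<dots> \<le> measure lebesgue F - c * measure lebesgue F + 2 * e"
    using c c1 e by (simp add: algebra_simps)
  finally show False using e by (simp add: e_def)
qed

text \<open>With \<open>f\<close> counting the sets that contain a point, the integral of
  \<open>(f - t * indicator U) ^ 2\<close> is a nonnegative quadratic polynomial in
  \<open>t\<close>; evaluating it at its minimum \<open>t = s / u\<close> gives the
  inequality.\<close>

lemma chung_erdos:
  fixes E :: "'i \<Rightarrow> real set"
  assumes I: "finite I" and E: "\<And>i. i \<in> I \<Longrightarrow> E i \<in> lmeasurable"
  shows "(\<Sum>i\<in>I. measure lebesgue (E i)) ^ 2 \<le>
    measure lebesgue (\<Union>i\<in>I. E i) * (\<Sum>i\<in>I. \<Sum>j\<in>I. measure lebesgue (E i \<inter> E j))"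
proof -
  define U where "U = (\<Union>i\<in>I. E i)"
  define s where "s = (\<Sum>i\<in>I. measure lebesgue (E i))"
  define q where "q = (\<Sum>i\<in>I. \<Sum>j\<in>I. measure lebesgue (E i \<inter> E j))"
  define u where "u = measure lebesgue U"
  define f where "f x = (\<Sum>i\<in>I. indicat_real (E i) x)" for x
  have U: "U \<in> lmeasurable" unfolding U_def using I E by (intro fmeasurable.finite_UN) auto
  have int: "integrable lebesgue (indicat_real A)" "integral\<^sup>L lebesgue (indicat_real A) = measure lebesgue A"
    if "A \<in> lmeasurable" for A
    using that by (auto simp: fmeasurable_def)
  have EE: "E i \<inter> E j \<in> lmeasurable" if "i \<in> I" "j \<in> I" for i j
    using E that by (intro fmeasurable.Int) auto
  have eq: "(f x - t * indicat_real U x) ^ 2 = (\<Sum>i\<in>I. \<Sum>j\<in>I. indicat_real (E i \<inter> E j) x) -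
      2 * t * (\<Sum>i\<in>I. indicat_real (E i) x) + t ^ 2 * indicat_real U x" for x t
  proof -
    have "f x * indicat_real U x = f x"
      unfolding f_def sum_distrib_right by (intro sum.cong) (auto simp: indicator_def U_def)
    moreover have "f x ^ 2 = (\<Sum>i\<in>I. \<Sum>j\<in>I. indicat_real (E i \<inter> E j) x)"
      unfolding f_def power2_eq_square sum_product by (simp add: indicator_inter_arith)
    moreover have "indicat_real U x ^ 2 = indicat_real U x" by (simp add: indicator_def)
    ultimately show ?thesis
      by (simp add: power2_diff power_mult_distrib f_def[symmetric] mult_ac)
  qed
  have key: "0 \<le> q - 2 * t * s + t ^ 2 * u" for t
  proof -
    have "0 \<le> integral\<^sup>L lebesgue (\<lambda>x. (f x - t * indicat_real U x) ^ 2)"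
      by (intro integral_nonneg_AE) auto
    also have "\<dots> = q - 2 * t * s + t ^ 2 * u"
      unfolding eq using E EE U
      by (simp add: int Bochner_Integration.integral_add Bochner_Integration.integral_diff q_def s_def u_def)
    finally show ?thesis .
  qed
  have u0: "u \<ge> 0" by (simp add: u_def)
  have "s ^ 2 \<le> u * q"
  proof (cases "u = 0")
    case True
    have "measure lebesgue (E i) \<le> u" if "i \<in> I" for i
      unfolding u_def U_def using that E U[unfolded U_def] by (intro measure_mono_fmeasurable) auto
    hence "s \<le> 0" unfolding s_def True by (intro sum_nonpos) (auto simp: True)
    moreover have "s \<ge> 0" unfolding s_def by (intro sum_nonneg) auto
    ultimately show ?thesis using True by simp
  next
    case False
    with u0 have u: "u > 0" by simp
    have "0 \<le> u * (q - 2 * (s / u) * s + (s / u) ^ 2 * u)"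
      using key[of "s / u"] u by simp
    also have "\<dots> = u * q - s ^ 2"
      using u by (simp add: power2_eq_square field_simps)
    finally show ?thesis by simp
  qed
  thus ?thesis by (simp add: s_def u_def q_def U_def)
qed

section \<open>The Weyl criterion with weights\<close>

inductive trig_poly :: "(real \<Rightarrow> complex) \<Rightarrow> bool" where
  mono: "trig_poly (\<lambda>t. c * ucis (of_int h * t))"
| add: "trig_poly f \<Longrightarrow> trig_poly g \<Longrightarrow> trig_poly (\<lambda>t. f t + g t)"

lemma trig_poly_mult_mono:
  "trig_poly f \<Longrightarrow> trig_poly (\<lambda>t. c * ucis (of_int h * t) * f t)"
proof (induction rule: trig_poly.induct)
  case (mono d k)
  have "(\<lambda>t. c * ucis (of_int h * t) * (d * ucis (of_int k * t))) = (\<lambda>t. (c * d) * ucis (of_int (h + k) * t))"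
    by (simp add: fun_eq_iff distrib_right ucis_add)
  thus ?case using trig_poly.mono[of "c * d" "h + k"] by (simp only:)
next
  case (add f g)
  thus ?case using trig_poly.add by (simp add: distrib_left)
qed

lemma trig_poly_mult: "trig_poly f \<Longrightarrow> trig_poly g \<Longrightarrow> trig_poly (\<lambda>t. f t * g t)"
proof (induction rule: trig_poly.induct)
  case (mono d k)
  thus ?case by (rule trig_poly_mult_mono)
next
  case (add f1 f2)
  thus ?case using trig_poly.add[of "\<lambda>t. f1 t * g t" "\<lambda>t. f2 t * g t"] by (simp add: distrib_right)
qed

text \<open>Stone--Weierstrass supplies real polynomials on the plane, to be restricted to the unit
  circle. There a linear form is a combination of \<open>cos\<close> and \<open>sin\<close>, hence
  of the frequencies 1 and -1, and the class is closed under products.\<close>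

lemma trig_poly_real_polynomial:
  fixes g :: "complex \<Rightarrow> real"
  shows "real_polynomial_function g \<Longrightarrow> trig_poly (\<lambda>t. of_real (g (ucis t)))"
proof (induction rule: real_polynomial_function.induct)
  case (linear f)
  interpret bounded_linear f by fact
  have "complex_of_real (f (ucis t)) = ((of_real (f 1) - \<i> * of_real (f \<i>)) / 2) * ucis (of_int 1 * t) +
      ((of_real (f 1) + \<i> * of_real (f \<i>)) / 2) * ucis (of_int (-1) * t)" for t
  proof -
    have "f (ucis t) = f (cos (2 * pi * t) *\<^sub>R 1 + sin (2 * pi * t) *\<^sub>R \<i>)"
      by (intro arg_cong[where f = f]) (auto simp: ucis_def complex_eq_iff)
    also have "\<dots> = cos (2 * pi * t) * f 1 + sin (2 * pi * t) * f \<i>"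
      by (simp only: add scaleR real_scaleR_def)
    finally show ?thesis
      by (auto simp: ucis_def complex_eq_iff algebra_simps add_divide_distrib diff_divide_distrib)
  qed
  thus ?case
    using trig_poly.add[OF trig_poly.mono[of "(of_real (f 1) - \<i> * of_real (f \<i>)) / 2" 1]
        trig_poly.mono[of "(of_real (f 1) + \<i> * of_real (f \<i>)) / 2" "-1"]] by simp
next
  case (const c)
  show ?case using trig_poly.mono[of "of_real c" 0] by simp
next
  case (add f g)
  thus ?case using trig_poly.add by simp
next
  case (mult f g)
  thus ?case using trig_poly_mult by simp
qed

lemma has_integral_ucis:
  assumes "h \<noteq> 0"
  shows "((\<lambda>t. ucis (of_int h * t)) has_integral 0) {0..1}"
proof -
  define F where "F t = ucis (of_int h * t) / (2 * pi * \<i> * of_int h)" for t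
  have "(F has_vector_derivative ucis (of_int h * t)) (at t within {0..1})" for t
  proof -
    have "((\<lambda>z. exp (2 * pi * \<i> * of_int h * z) / (2 * pi * \<i> * of_int h)) has_field_derivative
        exp (2 * pi * \<i> * of_int h * of_real t)) (at (of_real t))"
      using assms by (auto intro!: derivative_eq_intros)
    hence "((\<lambda>x. exp (2 * pi * \<i> * of_int h * of_real x) / (2 * pi * \<i> * of_int h)) has_vector_derivative
        exp (2 * pi * \<i> * of_int h * of_real t)) (at t within {0..1})"
      by (rule has_vector_derivative_real_field)
    moreover have "ucis (of_int h * x) = exp (2 * pi * \<i> * of_int h * of_real x)" for x
      by (simp add: ucis_def cis_conv_exp mult_ac)
    ultimately show ?thesis by (simp add: F_def[abs_def])
  qed
  hence "((\<lambda>t. ucis (of_int h * t)) has_integral F 1 - F 0) {0..1}"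
    by (intro fundamental_theorem_of_calculus) auto
  moreover have "F 1 = F 0" by (simp add: F_def)
  ultimately show ?thesis by simp
qed

text \<open>A nonzero frequency tends to 0 on average by assumption and has integral 0, while the
  constant term averages to itself; sums follow by linearity.\<close>

lemma trig_poly_weyl:
  fixes y w :: "nat \<Rightarrow> real"
  defines "S \<equiv> \<lambda>N. \<Sum>n\<le>N. w n"
  assumes S: "filterlim S at_top at_top"
    and weyl: "\<And>h :: int. h \<noteq> 0 \<Longrightarrow> (\<lambda>N. (\<Sum>n\<le>N. of_real (w n) * ucis (of_int h * y n)) / of_real (S N)) \<longlonglongrightarrow> 0"
  shows "trig_poly f \<Longrightarrow> \<exists>I. (f has_integral I) {0..1} \<and> (\<lambda>N. (\<Sum>n\<le>N. of_real (w n) * f (y n)) / of_real (S N)) \<longlonglongrightarrow> I"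
proof (induction rule: trig_poly.induct)
  case (mono c h)
  show ?case
  proof (cases "h = 0")
    case True
    have "eventually (\<lambda>N. S N > 0) at_top" using S by (simp add: filterlim_at_top_dense)
    hence "eventually (\<lambda>N. c = (\<Sum>n\<le>N. of_real (w n) * (c * ucis (of_int h * y n))) / of_real (S N)) sequentially"
    proof eventually_elim
      case (elim N)
      have "(\<Sum>n\<le>N. of_real (w n) * (c * ucis (of_int h * y n))) = of_real (S N) * c"
        by (simp add: True S_def sum_distrib_right)
      thus ?case using elim by simp
    qed
    hence "(\<lambda>N. (\<Sum>n\<le>N. of_real (w n) * (c * ucis (of_int h * y n))) / of_real (S N)) \<longlonglongrightarrow> c"
      by (rule Lim_transform_eventually[OF tendsto_const])
    moreover have "((\<lambda>t. c * ucis (of_int h * t)) has_integral c) {0..1}"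
      using has_integral_const_real[of c 0 1] by (simp add: True)
    ultimately show ?thesis by blast
  next
    case False
    have "(\<lambda>N. c * ((\<Sum>n\<le>N. of_real (w n) * ucis (of_int h * y n)) / of_real (S N))) \<longlonglongrightarrow> c * 0"
      by (intro tendsto_mult tendsto_const weyl False)
    moreover have eq: "c * ((\<Sum>n\<le>N. of_real (w n) * ucis (of_int h * y n)) / of_real (S N)) =
        (\<Sum>n\<le>N. of_real (w n) * (c * ucis (of_int h * y n))) / of_real (S N)" for N
      by (simp add: sum_distrib_left mult_ac)
    moreover have "((\<lambda>t. c * ucis (of_int h * t)) has_integral c * 0) {0..1}"
      by (intro has_integral_mult_right has_integral_ucis False)
    ultimately show ?thesis by (intro exI[of _ 0]) (simp only: eq mult_zero_right)
  qed
next
  case (add f g)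
  then obtain I J where I: "(f has_integral I) {0..1}" "(\<lambda>N. (\<Sum>n\<le>N. of_real (w n) * f (y n)) / of_real (S N)) \<longlonglongrightarrow> I"
    and J: "(g has_integral J) {0..1}" "(\<lambda>N. (\<Sum>n\<le>N. of_real (w n) * g (y n)) / of_real (S N)) \<longlonglongrightarrow> J"
    by blast
  have "(\<lambda>N. (\<Sum>n\<le>N. of_real (w n) * (f (y n) + g (y n))) / of_real (S N)) \<longlonglongrightarrow> I + J"
    using tendsto_add[OF I(2) J(2)] by (simp add: distrib_left sum.distrib add_divide_distrib)
  with has_integral_add[OF I(1) J(1)] show ?case by blast
qed

text \<open>A lower bound up to a constant factor suffices for the Chung--Erdos argument, so a tent
  function supported on the arc over \<open>{a..b}\<close> is tested in place of the indicator.
  Defined by chordal distance it is continuous on the whole circle, also where 0 and 1 meet.\<close>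

lemma weyl_interval_lower_bound:
  fixes y w :: "nat \<Rightarrow> real"
  defines "S \<equiv> \<lambda>N. \<Sum>n\<le>N. w n"
  assumes y: "\<And>n. 0 \<le> y n" "\<And>n. y n < 1" and w: "\<And>n. w n \<ge> 0"
    and S: "filterlim S at_top at_top"
    and weyl: "\<And>h :: int. h \<noteq> 0 \<Longrightarrow> (\<lambda>N. (\<Sum>n\<le>N. of_real (w n) * ucis (of_int h * y n)) / of_real (S N)) \<longlonglongrightarrow> 0"
    and ab: "0 \<le> a" "a < b" "b \<le> 1"
  shows "eventually (\<lambda>N. (b - a) / 32 * S N \<le> (\<Sum>n | n \<le> N \<and> y n \<in> {a..b}. w n)) at_top"
proof -
  define l where "l = b - a"
  define m where "m = (a + b) / 2"
  have l: "l > 0" "l \<le> 1" using ab by (auto simp: l_def)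
  define F where "F z = max 0 (l - norm (z - ucis m))" for z :: complex
  \<comment> \<open>Budget: the tent function has integral at least
    \<open>l ^ 2 / 16 = 6 * \<delta>\<close>. Approximating it, passing to the limit and
    approximating back cost \<open>\<delta>\<close> each, so
    \<open>3 * \<delta> = l ^ 2 / 32\<close> remains; dividing by the height \<open>l\<close> leaves
    \<open>l / 32\<close>.\<close>
  define \<delta> where "\<delta> = l ^ 2 / 96"
  have \<delta>: "\<delta> > 0" using l by (simp add: \<delta>_def)
  have contF: "continuous_on A F" for A unfolding F_def by (intro continuous_intros)
  obtain g where g: "real_polynomial_function g" "\<And>z. z \<in> sphere 0 1 \<Longrightarrow> \<bar>F z - g z\<bar> < \<delta>"
    using Stone_Weierstrass_real_polynomial_function[OF compact_sphere contF \<delta>] by blast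
  have g': "\<bar>F (ucis t) - g (ucis t)\<bar> < \<delta>" for t by (rule g(2)) simp
  obtain I where I: "((\<lambda>t. complex_of_real (g (ucis t))) has_integral I) {0..1}"
      "(\<lambda>N. (\<Sum>n\<le>N. of_real (w n) * complex_of_real (g (ucis (y n)))) / of_real (S N)) \<longlonglongrightarrow> I"
    using trig_poly_weyl[OF S[unfolded S_def] weyl[unfolded S_def] trig_poly_real_polynomial[OF g(1)]]
    unfolding S_def by blast
  have lim: "(\<lambda>N. (\<Sum>n\<le>N. w n * g (ucis (y n))) / S N) \<longlonglongrightarrow> Re I"
  proof -
    have "(\<Sum>n\<le>N. of_real (w n) * complex_of_real (g (ucis (y n)))) / of_real (S N) =
        of_real ((\<Sum>n\<le>N. w n * g (ucis (y n))) / S N)" for N by simp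
    with tendsto_Re[OF I(2)] show ?thesis by (simp only: Re_complex_of_real)
  qed
  have intg: "((\<lambda>t. g (ucis t)) has_integral Re I) {0..1}"
    using has_integral_Re[OF I(1)] by simp
  \<comment> \<open>For \<open>\<bar>t - m\<bar> \<le> r\<close> the chordal distance is at most
    \<open>2 * pi * r = l / 2\<close>, so the tent function is still at least
    \<open>l / 2\<close>.\<close>
  define r where "r = l / (4 * pi)"
  have r: "r > 0" "r \<le> l / 2" "r \<ge> l / 16"
    using l pi_gt3 pi_less_4 by (auto simp: r_def field_simps)
  have sub: "{m - r..m + r} \<subseteq> {0..1}" proof -
    have "a \<le> m - r" "m + r \<le> b" using r(2) unfolding m_def l_def by (auto simp: field_simps)
    thus ?thesis using ab by auto
  qed
  have "((\<lambda>t. (if t \<in> {m - r..m + r} then l / 2 else 0) - \<delta>) has_integral (l / 2 * (2 * r) - \<delta>)) {0..1}"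
  proof (intro has_integral_diff)
    have "((\<lambda>t. l / 2) has_integral l / 2 * (2 * r)) {m - r..m + r}"
      using has_integral_const_real[of "l / 2" "m - r" "m + r"] r by (simp add: mult_ac)
    thus "((\<lambda>t. if t \<in> {m - r..m + r} then l / 2 else 0) has_integral l / 2 * (2 * r)) {0..1}"
      using has_integral_restrict[OF sub, of "\<lambda>t. l / 2"] by simp
    show "((\<lambda>t :: real. \<delta>) has_integral \<delta>) {0..1}" using has_integral_const_real[of \<delta> 0 1] by simp
  qed
  hence "l / 2 * (2 * r) - \<delta> \<le> Re I"
  proof (rule has_integral_le[OF _ intg])
    fix t
    have "(if t \<in> {m - r..m + r} then l / 2 else 0) \<le> F (ucis t)"
    proof (cases "t \<in> {m - r..m + r}")
      case True
      have "norm (ucis t - ucis m) \<le> 2 * pi * \<bar>t - m\<bar>" by (rule norm_ucis_diff_le)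
      also have "\<dots> \<le> 2 * pi * r" using True by (intro mult_left_mono) auto
      also have "\<dots> = l / 2" by (simp add: r_def)
      finally have "l / 2 \<le> l - norm (ucis t - ucis m)" by simp
      also have "\<dots> \<le> F (ucis t)" by (simp add: F_def)
      finally show ?thesis using True by simp
    next
      case False
      have "0 \<le> F (ucis t)" by (simp add: F_def)
      thus ?thesis using False by (simp only: if_False)
    qed
    thus "(if t \<in> {m - r..m + r} then l / 2 else 0) - \<delta> \<le> g (ucis t)" using g'[of t] by linarith
  qed
  moreover have "l * (l / 16) \<le> l * r" using r l by (intro mult_left_mono) auto
  ultimately have ReI: "5 * \<delta> \<le> Re I" by (simp add: \<delta>_def power2_eq_square)
  have Fle: "F (ucis (y n)) \<le> (if y n \<in> {a..b} then l else 0)" for n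
  proof (cases "y n \<in> {a..b}")
    case False
    \<comment> \<open>Both \<open>y n\<close> and \<open>{a..b}\<close> lie in the unit interval, so
      no shift by a nonzero integer can bring \<open>y n\<close> within \<open>l / 2\<close> of
      \<open>m\<close>.\<close>
    have "l / 2 \<le> int_dist (y n - m)"
    proof (rule ccontr)
      assume "\<not> l / 2 \<le> int_dist (y n - m)"
      hence "\<bar>y n - m - of_int (round (y n - m))\<bar> < l / 2" by (simp add: int_dist_def)
      hence 1: "a < y n - of_int (round (y n - m))" "y n - of_int (round (y n - m)) < b"
        by (auto simp: m_def l_def abs_less_iff field_simps)
      hence "real_of_int (round (y n - m)) < 1" "real_of_int (round (y n - m)) > -1"
        using y[of n] ab by linarith+
      hence "round (y n - m) = 0" by linarith
      with 1 False show False by auto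
    qed
    moreover have "ucis (y n) - ucis m = ucis m * (ucis (y n - m) - 1)"
      by (simp add: right_diff_distrib flip: ucis_add)
    hence "norm (ucis (y n) - ucis m) = norm (1 - ucis (y n - m))"
      by (simp add: norm_mult norm_minus_commute)
    ultimately have "l \<le> norm (ucis (y n) - ucis m)"
      using norm_one_minus_ucis_ge[of "y n - m"] by linarith
    hence "F (ucis (y n)) = 0" by (simp add: F_def)
    thus ?thesis using False by (simp only: if_False order_refl)
  qed (use l in \<open>simp add: F_def\<close>)
  have "eventually (\<lambda>N. 4 * \<delta> < (\<Sum>n\<le>N. w n * g (ucis (y n))) / S N) at_top"
    using ReI \<delta> by (intro order_tendstoD(1)[OF lim]) simp
  moreover have "eventually (\<lambda>N. S N > 0) at_top" using S by (simp add: filterlim_at_top_dense)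
  ultimately show ?thesis
  proof eventually_elim
    case (elim N)
    have "4 * \<delta> * S N \<le> (\<Sum>n\<le>N. w n * g (ucis (y n)))" using elim by (simp add: field_simps)
    also have "\<dots> \<le> (\<Sum>n\<le>N. w n * (if y n \<in> {a..b} then l else 0) + w n * \<delta>)"
    proof (rule sum_mono)
      fix n
      have "g (ucis (y n)) \<le> (if y n \<in> {a..b} then l else 0) + \<delta>"
        using g'[of "y n"] Fle[of n] by linarith
      from mult_left_mono[OF this w[of n]]
      show "w n * g (ucis (y n)) \<le> w n * (if y n \<in> {a..b} then l else 0) + w n * \<delta>"
        by (simp only: distrib_left)
    qed
    also have "\<dots> = (\<Sum>n\<le>N. w n * (if y n \<in> {a..b} then l else 0)) + \<delta> * S N"
      by (simp add: sum.distrib S_def sum_distrib_left mult_ac)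
    also have "(\<Sum>n\<le>N. w n * (if y n \<in> {a..b} then l else 0)) = (\<Sum>n | n \<le> N \<and> y n \<in> {a..b}. w n * l)"
      by (rule sum.mono_neutral_cong_right) auto
    also have "\<dots> = l * (\<Sum>n | n \<le> N \<and> y n \<in> {a..b}. w n)" by (simp add: sum_distrib_left mult_ac)
    finally have "3 * \<delta> * S N \<le> l * (\<Sum>n | n \<le> N \<and> y n \<in> {a..b}. w n)" by simp
    hence "l * (l / 32 * S N) \<le> l * (\<Sum>n | n \<le> N \<and> y n \<in> {a..b}. w n)"
      by (simp add: \<delta>_def power2_eq_square mult_ac)
    hence "l / 32 * S N \<le> (\<Sum>n | n \<le> N \<and> y n \<in> {a..b}. w n)" using l(1) by (simp only: mult_le_cancel_left_pos)
    thus ?case by (simp add: l_def)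
  qed
qed

text \<open>The hypothesis \<open>pair\<close> is about the whole unit interval. Restricting to
  \<open>{a..b}\<close> costs only a constant: the intersections of balls centred there sum to order
  \<open>W * S N\<close>, Chung--Erdos leaves \<open>W / S N\<close>, and equidistribution makes
  this at least \<open>l / 64\<close>, which is linear in the length.\<close>

theorem limsup_balls_full_measure:
  fixes y w :: "nat \<Rightarrow> real"
  defines "S \<equiv> \<lambda>N. \<Sum>n\<le>N. w n"
  assumes y: "\<And>n. 0 \<le> y n" "\<And>n. y n < 1" and w: "\<And>n. w n \<ge> 0" "w \<longlonglongrightarrow> 0"
    and S: "filterlim S at_top at_top"
    and weyl: "\<And>h :: int. h \<noteq> 0 \<Longrightarrow> (\<lambda>N. (\<Sum>n\<le>N. of_real (w n) * ucis (of_int h * y n)) / of_real (S N)) \<longlonglongrightarrow> 0"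
    and \<epsilon>: "\<epsilon> > 0" and C: "C > 0"
    and pair: "\<And>n N. n \<ge> n0 \<Longrightarrow> w n > 0 \<Longrightarrow>
      (\<Sum>k | n < k \<and> k \<le> N \<and> \<bar>y k - y n\<bar> < \<epsilon> * (w n + w k). w k) \<le> C * w n * S N"
  shows "negligible {x \<in> {0..1}. \<not> (\<exists>\<^sub>\<infinity>n. \<bar>x - y n\<bar> < \<epsilon> * w n)}"
proof -
  \<comment> \<open>Chung--Erdos will bound the union below by
    \<open>\<epsilon> * W / (2 * (1 + 2 * C) * S N)\<close>, and \<open>W \<ge> l / 64 * S N\<close>
    turns this into \<open>c0 * l\<close>.\<close>
  define c0 where "c0 = \<epsilon> / (128 * (1 + 2 * C))"
  have c0: "c0 > 0" using \<epsilon> C by (simp add: c0_def)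
  define B where "B n = ball (y n) (\<epsilon> * w n)" for n
  define G where "G k = {0..1} - (\<Union>n\<in>{k..}. B n)" for k
  have Uopen: "open (\<Union>n\<in>{k..}. B n)" for k unfolding B_def by (intro open_UN) auto
  have Gmeas: "G k \<in> lmeasurable" for k
    unfolding G_def using Uopen by (intro fmeasurable_Diff) (auto intro: borel_open)
  have S_mono: "S N \<le> S M" if "N \<le> M" for N M
    unfolding S_def using that w by (intro sum_mono2) auto
  have large: "measure lebesgue (G k \<inter> {a..b}) \<le> (1 - c0) * (b - a)"
    if ab: "0 \<le> a" "a < b" "b \<le> 1" for k a b
  proof -
    define l where "l = b - a"
    have l: "l > 0" using ab by (simp add: l_def)
    have "eventually (\<lambda>n. w n < l / (2 * \<epsilon>)) sequentially"
      using \<epsilon> l by (intro order_tendstoD(2)[OF w(2)]) auto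
    then obtain n1 where n1: "\<And>n. n \<ge> n1 \<Longrightarrow> w n < l / (2 * \<epsilon>)" by (auto simp: eventually_at_top_linorder)
    \<comment> \<open>Beyond \<open>m\<close> the balls are among those removed in
      \<open>G k\<close>, \<open>pair\<close> is available, and radii are below half the length of
      the interval. \<open>N\<close> is then taken so large that the discarded weight
      \<open>S m\<close> is at most half of what \<open>{a..b}\<close> receives.\<close>
    define m where "m = max k (max n0 n1)"
    have "eventually (\<lambda>N. S N \<ge> max 1 (64 / l * S m)) at_top"
      using S unfolding filterlim_at_top by blast
    moreover have "eventually (\<lambda>N. (b - a) / 32 * S N \<le> (\<Sum>n | n \<le> N \<and> y n \<in> {a..b}. w n)) at_top"
      using weyl_interval_lower_bound[OF y w(1) S[unfolded S_def] weyl[unfolded S_def] ab] by (simp add: S_def)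
    ultimately have "eventually (\<lambda>N. S N \<ge> max 1 (64 / l * S m) \<and>
        (b - a) / 32 * S N \<le> (\<Sum>n | n \<le> N \<and> y n \<in> {a..b}. w n)) at_top" by eventually_elim simp
    then obtain N where N: "S N \<ge> 1" "64 / l * S m \<le> S N"
        "l / 32 * S N \<le> (\<Sum>n | n \<le> N \<and> y n \<in> {a..b}. w n)"
      by (auto simp: eventually_at_top_linorder l_def)
    define I where "I = {n. m < n \<and> n \<le> N \<and> y n \<in> {a..b} \<and> w n > 0}"
    define W where "W = (\<Sum>n\<in>I. w n)"
    have finI: "finite I" by (rule finite_subset[of _ "{..N}"]) (auto simp: I_def)
    have W: "W \<ge> l / 64 * S N"
    proof -
      have "(\<Sum>n | n \<le> N \<and> y n \<in> {a..b}. w n) \<le> (\<Sum>n\<in>{..m} \<union> I. w n)"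
      proof -
        have "(\<Sum>n | n \<le> N \<and> y n \<in> {a..b}. w n) = (\<Sum>n | n \<le> N \<and> y n \<in> {a..b} \<and> w n > 0. w n)"
          using w(1) by (intro sum.mono_neutral_right) (auto simp: less_le)
        also have "\<dots> \<le> (\<Sum>n\<in>{..m} \<union> I. w n)"
          using finI w by (intro sum_mono2) (auto simp: I_def)
        finally show ?thesis .
      qed
      also have "\<dots> = S m + W" unfolding S_def W_def
        using finI by (intro sum.union_disjoint) (auto simp: I_def)
      finally have "l / 32 * S N \<le> S m + W" using N(3) by simp
      moreover have "S m \<le> l / 64 * S N" using N(2) l by (simp add: field_simps)
      ultimately show ?thesis by simp
    qed
    have Wpos: "W > 0" using W N(1) l by (intro less_le_trans[OF _ W] mult_pos_pos) auto
    define E where "E n = B n \<inter> {a..b}" for n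
    have Emeas: "E n \<in> lmeasurable" for n unfolding E_def B_def by (intro fmeasurable.Int) auto
    have E_le: "measure lebesgue (E n) \<le> 2 * \<epsilon> * w n" for n
    proof -
      have "measure lebesgue (E n) \<le> measure lebesgue (cball (y n) (\<epsilon> * w n))"
        using Emeas by (intro measure_mono_fmeasurable) (auto simp: E_def B_def fmeasurableD)
      also have "\<dots> = 2 * \<epsilon> * w n" using \<epsilon> w(1)[of n] by (simp add: cball_eq_atLeastAtMost)
      finally show ?thesis .
    qed
    have E_ge: "\<epsilon> * w n \<le> measure lebesgue (E n)" if n: "n \<in> I" for n
    proof -
      have wn: "w n > 0" "\<epsilon> * w n < l / 2" using n n1[of n] \<epsilon> by (auto simp: I_def m_def field_simps)
      have yn: "a \<le> y n" "y n \<le> b" using n by (auto simp: I_def)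
      \<comment> \<open>At least one half of the ball lies in \<open>{a..b}\<close>, because the
        centre does and the radius is below half the length.\<close>
      obtain u where u: "{u<..<u + \<epsilon> * w n} \<subseteq> E n"
      proof (cases "y n + \<epsilon> * w n \<le> b")
        case True
        have "{y n<..<y n + \<epsilon> * w n} \<subseteq> E n" using True yn by (auto simp: E_def B_def dist_real_def)
        thus ?thesis by (rule that)
      next
        case False
        have "{y n - \<epsilon> * w n<..<(y n - \<epsilon> * w n) + \<epsilon> * w n} \<subseteq> E n"
          using False yn wn by (auto simp: E_def B_def dist_real_def l_def)
        thus ?thesis by (rule that)
      qed
      have "\<epsilon> * w n = measure lebesgue {u<..<u + \<epsilon> * w n}" using wn \<epsilon> by simp
      also have "\<dots> \<le> measure lebesgue (E n)"
        using u Emeas by (intro measure_mono_fmeasurable) auto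
      finally show ?thesis .
    qed
    \<comment> \<open>An intersection forces the centres to be close and is charged with the bound
      for the later ball, which is the form in which \<open>pair\<close> can be summed.\<close>
    have "(\<Sum>i\<in>I. \<Sum>j\<in>I. measure lebesgue (E i \<inter> E j)) \<le>
        (\<Sum>i\<in>I. \<Sum>j\<in>I. (if i = j then 2 * \<epsilon> * w i else 0) +
           (if i < j \<and> \<bar>y j - y i\<bar> < \<epsilon> * (w i + w j) then 2 * \<epsilon> * w j else 0) +
           (if j < i \<and> \<bar>y i - y j\<bar> < \<epsilon> * (w j + w i) then 2 * \<epsilon> * w i else 0))"
    proof (intro sum_mono)
      fix i j
      have m1: "measure lebesgue (E i \<inter> E j) \<le> measure lebesgue (E i)"
        "measure lebesgue (E i \<inter> E j) \<le> measure lebesgue (E j)"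
        using Emeas by (auto intro!: measure_mono_fmeasurable fmeasurableD intro: fmeasurable.Int)
      have "\<bar>y j - y i\<bar> < \<epsilon> * (w i + w j)" if ne: "E i \<inter> E j \<noteq> {}"
      proof -
        from ne obtain x where "\<bar>y i - x\<bar> < \<epsilon> * w i" "\<bar>y j - x\<bar> < \<epsilon> * w j"
          by (auto simp: E_def B_def dist_real_def)
        thus ?thesis by (simp add: distrib_left)
      qed
      moreover have "E i \<inter> E j = {} \<Longrightarrow> measure lebesgue (E i \<inter> E j) = 0" by simp
      moreover have "2 * \<epsilon> * w i \<ge> 0" "2 * \<epsilon> * w j \<ge> 0" using \<epsilon> w by auto
      ultimately show "measure lebesgue (E i \<inter> E j) \<le> (if i = j then 2 * \<epsilon> * w i else 0) +
           (if i < j \<and> \<bar>y j - y i\<bar> < \<epsilon> * (w i + w j) then 2 * \<epsilon> * w j else 0) +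
           (if j < i \<and> \<bar>y i - y j\<bar> < \<epsilon> * (w j + w i) then 2 * \<epsilon> * w i else 0)"
        using m1 E_le[of i] E_le[of j]
        by (cases i j rule: linorder_cases; cases "E i \<inter> E j = {}")
           (auto simp: abs_minus_commute add.commute)
    qed
    also have "\<dots> = (\<Sum>i\<in>I. 2 * \<epsilon> * w i) +
        2 * (\<Sum>i\<in>I. \<Sum>j\<in>I. if i < j \<and> \<bar>y j - y i\<bar> < \<epsilon> * (w i + w j) then 2 * \<epsilon> * w j else 0)"
    proof -
      have "(\<Sum>i\<in>I. \<Sum>j\<in>I. if j < i \<and> \<bar>y i - y j\<bar> < \<epsilon> * (w j + w i) then 2 * \<epsilon> * w i else 0) =
          (\<Sum>i\<in>I. \<Sum>j\<in>I. if i < j \<and> \<bar>y j - y i\<bar> < \<epsilon> * (w i + w j) then 2 * \<epsilon> * w j else 0)"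
        by (rule sum.swap)
      moreover have "(\<Sum>i\<in>I. \<Sum>j\<in>I. if i = j then 2 * \<epsilon> * w i else 0) = (\<Sum>i\<in>I. 2 * \<epsilon> * w i)"
        using finI by (intro sum.cong refl) simp
      ultimately show ?thesis by (simp only: sum.distrib mult_2)
    qed
    also have "\<dots> \<le> 2 * \<epsilon> * W + 2 * (2 * \<epsilon> * (C * W * S N))"
    proof (intro add_mono mult_left_mono)
      have "(\<Sum>i\<in>I. \<Sum>j\<in>I. if i < j \<and> \<bar>y j - y i\<bar> < \<epsilon> * (w i + w j) then 2 * \<epsilon> * w j else 0) \<le>
          (\<Sum>i\<in>I. 2 * \<epsilon> * (C * w i * S N))"
      proof (rule sum_mono)
        fix i assume i: "i \<in> I"
        have "(\<Sum>j\<in>I. if i < j \<and> \<bar>y j - y i\<bar> < \<epsilon> * (w i + w j) then 2 * \<epsilon> * w j else 0) =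
            (\<Sum>j | j \<in> I \<and> i < j \<and> \<bar>y j - y i\<bar> < \<epsilon> * (w i + w j). 2 * \<epsilon> * w j)"
          using finI by (intro sum.mono_neutral_cong_right) auto
        also have "\<dots> \<le> (\<Sum>j | i < j \<and> j \<le> N \<and> \<bar>y j - y i\<bar> < \<epsilon> * (w i + w j). 2 * \<epsilon> * w j)"
          using \<epsilon> w by (intro sum_mono2) (auto simp: I_def)
        also have "\<dots> = 2 * \<epsilon> * (\<Sum>j | i < j \<and> j \<le> N \<and> \<bar>y j - y i\<bar> < \<epsilon> * (w i + w j). w j)"
          by (simp add: sum_distrib_left)
        also have "\<dots> \<le> 2 * \<epsilon> * (C * w i * S N)"
          using i \<epsilon> by (intro mult_left_mono pair) (auto simp: I_def m_def)
        finally show "(\<Sum>j\<in>I. if i < j \<and> \<bar>y j - y i\<bar> < \<epsilon> * (w i + w j) then 2 * \<epsilon> * w j else 0) \<le>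
            2 * \<epsilon> * (C * w i * S N)" .
      qed
      also have "\<dots> = 2 * \<epsilon> * (C * W * S N)"
        by (simp add: W_def sum_distrib_left sum_distrib_right mult_ac)
      finally show "(\<Sum>i\<in>I. \<Sum>j\<in>I. if i < j \<and> \<bar>y j - y i\<bar> < \<epsilon> * (w i + w j) then 2 * \<epsilon> * w j else 0) \<le>
          2 * \<epsilon> * (C * W * S N)" .
    qed (simp_all add: W_def sum_distrib_left)
    also have "\<dots> \<le> 2 * \<epsilon> * W * ((1 + 2 * C) * S N)"
    proof -
      have "2 * \<epsilon> * W * 1 \<le> 2 * \<epsilon> * W * S N" using N(1) \<epsilon> Wpos by (intro mult_left_mono) auto
      thus ?thesis by (simp add: algebra_simps)
    qed
    finally have pairs: "(\<Sum>i\<in>I. \<Sum>j\<in>I. measure lebesgue (E i \<inter> E j)) \<le> 2 * \<epsilon> * W * ((1 + 2 * C) * S N)" .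
    define U where "U = (\<Union>i\<in>I. E i)"
    have Umeas: "U \<in> lmeasurable" unfolding U_def using finI Emeas by (intro fmeasurable.finite_UN) auto
    have "(\<epsilon> * W) ^ 2 \<le> (\<Sum>i\<in>I. measure lebesgue (E i)) ^ 2"
      using E_ge \<epsilon> Wpos unfolding W_def sum_distrib_left
      by (intro power_mono sum_mono sum_nonneg) (auto simp: w)
    also have "\<dots> \<le> measure lebesgue U * (\<Sum>i\<in>I. \<Sum>j\<in>I. measure lebesgue (E i \<inter> E j))"
      unfolding U_def by (rule chung_erdos[OF finI Emeas])
    also have "\<dots> \<le> measure lebesgue U * (2 * \<epsilon> * W * ((1 + 2 * C) * S N))"
      by (intro mult_left_mono pairs) auto
    finally have "(\<epsilon> * W) * (\<epsilon> * W) \<le> (\<epsilon> * W) * (measure lebesgue U * (2 * (1 + 2 * C) * S N))"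
      by (simp add: power2_eq_square mult_ac)
    hence 1: "\<epsilon> * W \<le> measure lebesgue U * (2 * (1 + 2 * C) * S N)"
      using \<epsilon> Wpos by (subst (asm) mult_le_cancel_left_pos) auto
    have "\<epsilon> * (l / 64 * S N) \<le> \<epsilon> * W" using W \<epsilon> by (intro mult_left_mono) auto
    from order_trans[OF this 1] have "(\<epsilon> * l / 64) * S N \<le> (measure lebesgue U * (2 * (1 + 2 * C))) * S N"
      by (simp only: mult_ac times_divide_eq_right times_divide_eq_left)
    hence "\<epsilon> * l / 64 \<le> measure lebesgue U * (2 * (1 + 2 * C))"
      using N(1) by (subst (asm) mult_le_cancel_right_pos) auto
    hence Ul: "c0 * l \<le> measure lebesgue U"
      using C by (simp add: c0_def field_simps)
    have "measure lebesgue (G k \<inter> {a..b}) \<le> measure lebesgue ({a..b} - U)"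
    proof (rule measure_mono_fmeasurable)
      show "G k \<inter> {a..b} \<subseteq> {a..b} - U" by (auto simp: G_def U_def E_def I_def m_def)
      show "G k \<inter> {a..b} \<in> sets lebesgue" using fmeasurableD[OF Gmeas] by (intro sets.Int) auto
      show "{a..b} - U \<in> lmeasurable" using fmeasurableD[OF Umeas] by (intro fmeasurable_Diff) auto
    qed
    also have "\<dots> = measure lebesgue {a..b} - measure lebesgue U"
      using Umeas by (intro measurable_measure_Diff) (auto simp: U_def E_def intro: fmeasurableD)
    also have "\<dots> \<le> (1 - c0) * (b - a)"
      using Ul ab by (simp add: l_def algebra_simps)
    finally show ?thesis .
  qed
  have "negligible (G k)" for k
    by (rule negligible_if_uniformly_sparse[OF Gmeas _ c0 large]) (auto simp: G_def)
  hence "negligible (\<Union>k. G k)" by (intro negligible_countable_Union) auto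
  moreover have "{x \<in> {0..1}. \<not> (\<exists>\<^sub>\<infinity>n. \<bar>x - y n\<bar> < \<epsilon> * w n)} \<subseteq> (\<Union>k. G k)"
  proof
    fix x assume x: "x \<in> {x \<in> {0..1}. \<not> (\<exists>\<^sub>\<infinity>n. \<bar>x - y n\<bar> < \<epsilon> * w n)}"
    hence "\<forall>\<^sub>\<infinity>n. \<not> \<bar>x - y n\<bar> < \<epsilon> * w n" by (simp add: not_INFM)
    then obtain k where "\<And>n. n \<ge> k \<Longrightarrow> \<not> \<bar>x - y n\<bar> < \<epsilon> * w n" by (auto simp: MOST_nat_le)
    thus "x \<in> (\<Union>k. G k)" using x by (auto simp: G_def B_def dist_real_def abs_minus_commute intro!: exI[of _ k])
  qed
  ultimately show ?thesis by (rule negligible_subset)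
qed

section \<open>Approximation along the primes\<close>

text \<open>Zero-based: \<open>nth_prime 0\<close> is 2, and the index \<open>n_p\<close> of
  \<open>p = nth_prime i\<close> is \<open>Suc i\<close>. Sequences indexed by primes thereby become
  ordinary sequences.\<close>

definition nth_prime :: "nat \<Rightarrow> nat" where
  "nth_prime = enumerate {p. prime p}"

definition nth_prime_sum :: "nat \<Rightarrow> real" where
  "nth_prime_sum N = (\<Sum>i\<le>N. 1 / real (nth_prime i))"

lemma infinite_primes: "infinite {p :: nat. prime p}"
  using primes_infinite by simp

lemma strict_mono_nth_prime: "strict_mono nth_prime"
  unfolding nth_prime_def by (rule strict_mono_enumerate[OF infinite_primes])

lemma range_nth_prime: "range nth_prime = {p. prime p}"
  unfolding nth_prime_def by (rule range_enumerate[OF infinite_primes])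

lemma prime_nth_prime [simp]: "prime (nth_prime i)"
  using range_nth_prime by auto

lemma nth_prime_le_iff [simp]: "nth_prime i \<le> nth_prime j \<longleftrightarrow> i \<le> j"
  using strict_mono_nth_prime by (rule strict_mono_less_eq)

lemma nth_prime_less_iff [simp]: "nth_prime i < nth_prime j \<longleftrightarrow> i < j"
  using strict_mono_nth_prime by (rule strict_mono_less)

lemma inj_nth_prime: "inj nth_prime"
  using strict_mono_nth_prime by (rule strict_mono_imp_inj_on)

lemma nth_prime_pos [simp]: "nth_prime i > 0"
  using prime_nth_prime prime_gt_0_nat by blast

lemma nth_prime_ge: "i + 1 \<le> nth_prime i"
proof (induction i)
  case (Suc i)
  have "nth_prime i < nth_prime (Suc i)" by simp
  with Suc show ?case by linarith
qed (simp add: Suc_le_eq)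

lemma ex_nth_prime: "prime p \<Longrightarrow> \<exists>i. p = nth_prime i"
  using range_nth_prime by auto

lemma primes_le_nth_prime: "{p. p \<in> {1..nth_prime N} \<and> prime p} = nth_prime ` {..N}"
  by (auto dest!: ex_nth_prime simp: Suc_le_eq)

lemma prime_index_nth_prime: "prime_index (nth_prime i) = Suc i"
proof -
  have "{q. prime q \<and> q \<le> nth_prime i} = nth_prime ` {..i}"
    by (auto dest!: ex_nth_prime)
  thus ?thesis
    unfolding prime_index_def by (simp add: card_image inj_on_subset[OF inj_nth_prime])
qed

lemma nth_prime_sum_eq: "nth_prime_sum N = prime_recip_sum (nth_prime N)"
  unfolding nth_prime_sum_def prime_recip_sum_def primes_le_nth_prime
  by (subst sum.reindex) (auto intro: inj_on_subset[OF inj_nth_prime])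

lemma filterlim_nth_prime: "filterlim nth_prime at_top at_top"
  using strict_mono_nth_prime by (rule filterlim_subseq)

lemma nth_prime_sum_at_top: "filterlim nth_prime_sum at_top at_top"
  unfolding nth_prime_sum_eq
  by (rule filterlim_compose[OF prime_recip_sum_at_top filterlim_nth_prime])

lemma eventually_primes_at_top:
  "eventually P primes_at_top \<longleftrightarrow> (\<exists>m. \<forall>p\<ge>m. prime p \<longrightarrow> P p)"
  by (simp add: primes_at_top_def eventually_inf_principal eventually_at_top_linorder)

lemma sum_nth_prime_squares_le: "(\<Sum>i\<le>N. (1 / real (nth_prime i)) ^ 2) \<le> 2"
proof -
  have "(\<Sum>i\<le>N. (1 / real (nth_prime i)) ^ 2) \<le> (\<Sum>i\<le>N. 1 / real (Suc i) ^ 2)"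
  proof (rule sum_mono)
    fix i
    have "real (Suc i) ^ 2 \<le> real (nth_prime i) ^ 2"
      using nth_prime_ge[of i] by (intro power_mono) auto
    thus "(1 / real (nth_prime i)) ^ 2 \<le> 1 / real (Suc i) ^ 2"
      unfolding power_divide power_one
      by (intro divide_left_mono mult_pos_pos) auto
  qed
  also have "\<dots> = (\<Sum>j=1..Suc N. 1 / real j ^ 2)"
    by (rule sum.reindex_bij_witness[of _ "\<lambda>j. j - 1" Suc]) auto
  also have "\<dots> \<le> 2" by (rule sum_inverse_squares_le)
  finally show ?thesis .
qed

text \<open>The floor changes the numerator by at most 1, and reduction modulo \<open>p\<close>
  shifts the quotient by an integer. Both sequences have this form, with \<open>x\<close> equal to
  \<open>\<beta> * n_p\<close> and \<open>\<beta> * p\<close>.\<close>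

lemma floor_mod_approx:
  fixes x :: real and p :: nat
  assumes "p \<ge> 1"
  defines "y \<equiv> real_of_int (\<lfloor>real p * x\<rfloor> mod int p) / real p"
  shows "0 \<le> y" "y < 1" "\<exists>k. \<bar>y - (x + of_int k)\<bar> \<le> 1 / real p"
proof -
  have p: "real p > 0" using assms by simp
  show "0 \<le> y" using assms by (simp add: y_def)
  have "real_of_int (\<lfloor>real p * x\<rfloor> mod int p) < real p"
    using assms pos_mod_bound[of "int p" "\<lfloor>real p * x\<rfloor>"] by linarith
  thus "y < 1" using p by (simp add: y_def)
  define q where "q = \<lfloor>real p * x\<rfloor> div int p"
  have "\<lfloor>real p * x\<rfloor> mod int p = \<lfloor>real p * x\<rfloor> - int p * q"
    by (simp add: q_def minus_mult_div_eq_mod)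
  hence "y = (real_of_int \<lfloor>real p * x\<rfloor> - real p * of_int q) / real p" by (simp add: y_def)
  hence "y - (x + of_int (- q)) = real_of_int \<lfloor>real p * x\<rfloor> / real p - q - x + q"
    using p by (simp only: diff_divide_distrib of_int_minus) simp
  also have "\<dots> = (real_of_int \<lfloor>real p * x\<rfloor> - real p * x) / real p"
    using p by (simp add: diff_divide_distrib)
  also have "\<bar>\<dots>\<bar> \<le> 1 / real p"
  proof -
    have "\<bar>real_of_int \<lfloor>real p * x\<rfloor> - real p * x\<bar> \<le> 1" by linarith
    thus ?thesis using p by (simp add: divide_right_mono)
  qed
  finally show "\<exists>k. \<bar>y - (x + of_int k)\<bar> \<le> 1 / real p" by blast
qed

text \<open>The centres \<open>y i\<close> may be replaced by the points \<open>x i\<close>, from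
  which they differ by at most \<open>1 / p\<close> modulo 1. In the Weyl sums, weighted by
  \<open>1 / p\<close>, this changes only a bounded amount since the inverse squares of the primes
  are summable; in the pair condition it widens the window by a multiple of
  \<open>1 / p\<close>.\<close>

lemma approximable_points_full_measure:
  fixes x :: "nat \<Rightarrow> real" and a :: "nat \<Rightarrow> int"
  assumes a: "\<And>i. a (nth_prime i) = \<lfloor>real (nth_prime i) * x i\<rfloor> mod int (nth_prime i)"
    and weyl: "\<And>h :: nat. h \<ge> 1 \<Longrightarrow>
      (\<lambda>N. norm (\<Sum>i\<le>N. of_real (1 / real (nth_prime i)) * ucis (real h * x i)) / nth_prime_sum N) \<longlonglongrightarrow> 0"
    and pair: "\<And>K. K > 0 \<Longrightarrow> \<exists>C>0. \<exists>n0. \<forall>n\<ge>n0. \<forall>N.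
      (\<Sum>k | n < k \<and> k \<le> N \<and> int_dist (x k - x n) \<le> K / real (nth_prime n). 1 / real (nth_prime k)) \<le>
      C * (1 / real (nth_prime n)) * nth_prime_sum N"
  shows "emeasure (lebesgue_on {0..1}) (approximable_points a) = 1"
proof -
  define w where "w i = 1 / real (nth_prime i)" for i
  define y where "y i = real_of_int (a (nth_prime i)) / real (nth_prime i)" for i
  have w: "w i > 0" for i by (simp add: w_def)
  have w_mono: "w j \<le> w i" if "i \<le> j" for i j
    unfolding w_def using that by (intro divide_left_mono mult_pos_pos) auto
  have S_eq: "nth_prime_sum = (\<lambda>N. \<Sum>i\<le>N. w i)" by (simp add: fun_eq_iff nth_prime_sum_def w_def)
  have nth_prime_ge1: "nth_prime i \<ge> 1" for i by (simp add: Suc_le_eq)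
  have y: "0 \<le> y i" "y i < 1" "\<exists>k. \<bar>y i - (x i + of_int k)\<bar> \<le> w i" for i
    using floor_mod_approx[OF nth_prime_ge1[of i], of "x i"] by (auto simp: y_def a w_def)
  have w_lim: "w \<longlonglongrightarrow> 0"
  proof (rule tendsto_sandwich[OF _ _ tendsto_const])
    show "eventually (\<lambda>i. 0 \<le> w i) sequentially" using w by (simp add: less_imp_le)
    show "eventually (\<lambda>i. w i \<le> 1 / real (Suc i)) sequentially"
    proof (intro always_eventually allI)
      fix i
      have "real (Suc i) \<le> real (nth_prime i)" using nth_prime_ge[of i] by simp
      thus "w i \<le> 1 / real (Suc i)" unfolding w_def by (intro divide_left_mono) auto
    qed
    show "(\<lambda>i. 1 / real (Suc i)) \<longlonglongrightarrow> 0" by real_asymp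
  qed
  have S_pos: "eventually (\<lambda>N. nth_prime_sum N > 0) at_top"
    using nth_prime_sum_at_top by (simp add: filterlim_at_top_dense)
  have weyl_nat: "(\<lambda>N. norm (\<Sum>i\<le>N. of_real (w i) * ucis (real h * y i)) / nth_prime_sum N) \<longlonglongrightarrow> 0"
    if h: "h \<ge> 1" for h :: nat
  proof (rule tendsto_sandwich[OF _ _ tendsto_const])
    \<comment> \<open>The second term accounts for replacing \<open>x\<close> by \<open>y\<close>:
      it is \<open>2 * pi * h\<close> times a bound 2 for the sum of the \<open>w i ^ 2\<close>,
      divided by a sum that tends to infinity.\<close>
    show "(\<lambda>N. norm (\<Sum>i\<le>N. of_real (w i) * ucis (real h * x i)) / nth_prime_sum N +
        4 * pi * real h / nth_prime_sum N) \<longlonglongrightarrow> 0"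
      using tendsto_add[OF weyl[OF h] tendsto_divide_0[OF tendsto_const[of "4 * pi * real h"]
          filterlim_at_top_imp_at_infinity[OF nth_prime_sum_at_top]]]
      by (simp add: w_def)
    show "eventually (\<lambda>N. 0 \<le> norm (\<Sum>i\<le>N. of_real (w i) * ucis (real h * y i)) / nth_prime_sum N) sequentially"
      using S_pos by eventually_elim auto
    show "eventually (\<lambda>N. norm (\<Sum>i\<le>N. of_real (w i) * ucis (real h * y i)) / nth_prime_sum N \<le>
        norm (\<Sum>i\<le>N. of_real (w i) * ucis (real h * x i)) / nth_prime_sum N +
        4 * pi * real h / nth_prime_sum N) sequentially"
      using S_pos
    proof eventually_elim
      case (elim N)
      have "norm (\<Sum>i\<le>N. of_real (w i) * ucis (real h * y i)) \<le>
          norm (\<Sum>i\<le>N. of_real (w i) * ucis (real h * x i)) +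
          norm (\<Sum>i\<le>N. of_real (w i) * ucis (real h * y i) - of_real (w i) * ucis (real h * x i))"
        unfolding sum_subtractf by (rule norm_triangle_sub)
      also have "norm (\<Sum>i\<le>N. of_real (w i) * ucis (real h * y i) - of_real (w i) * ucis (real h * x i)) \<le>
          (\<Sum>i\<le>N. 2 * pi * real h * w i ^ 2)"
      proof (intro order_trans[OF norm_sum] sum_mono)
        fix i
        obtain k where k: "\<bar>y i - (x i + of_int k)\<bar> \<le> w i" using y(3) by blast
        have "real h * (x i + of_int k) = real h * x i + of_int (int h * k)" by (simp add: algebra_simps)
        hence "ucis (real h * (x i + of_int k)) = ucis (real h * x i)" by (simp only: ucis_add_int)
        hence "norm (ucis (real h * y i) - ucis (real h * x i)) \<le> 2 * pi * \<bar>real h * y i - real h * (x i + of_int k)\<bar>"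
          using norm_ucis_diff_le[of "real h * y i" "real h * (x i + of_int k)"] by simp
        also have "\<dots> = 2 * pi * real h * \<bar>y i - (x i + of_int k)\<bar>"
          by (simp add: abs_mult flip: right_diff_distrib)
        also have "\<dots> \<le> 2 * pi * real h * w i" using k by (intro mult_left_mono) auto
        finally have "w i * norm (ucis (real h * y i) - ucis (real h * x i)) \<le> w i * (2 * pi * real h * w i)"
          using w[of i] by (intro mult_left_mono) auto
        moreover have "of_real (w i) * ucis (real h * y i) - of_real (w i) * ucis (real h * x i) =
            of_real (w i) * (ucis (real h * y i) - ucis (real h * x i))" by (simp add: right_diff_distrib)
        ultimately show "norm (of_real (w i) * ucis (real h * y i) - of_real (w i) * ucis (real h * x i)) \<le>
            2 * pi * real h * w i ^ 2"
          using w[of i] by (simp add: norm_mult power2_eq_square mult_ac)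
      qed
      also have "\<dots> = 2 * pi * real h * (\<Sum>i\<le>N. w i ^ 2)" by (simp add: sum_distrib_left)
      also have "\<dots> \<le> 2 * pi * real h * 2"
        unfolding w_def by (intro mult_left_mono sum_nth_prime_squares_le) auto
      finally show ?case using elim by (simp add: add_divide_distrib[symmetric] divide_right_mono mult_ac)
    qed
  qed
  have weyl_int: "(\<lambda>N. (\<Sum>i\<le>N. of_real (w i) * ucis (of_int h * y i)) / of_real (nth_prime_sum N)) \<longlonglongrightarrow> 0"
    if h: "h \<noteq> 0" for h :: int
  proof (rule tendsto_norm_zero_cancel)
    \<comment> \<open>Negative frequencies are reduced to positive ones by complex
      conjugation.\<close>
    define m where "m = nat \<bar>h\<bar>"
    have m: "m \<ge> 1" using h by (simp add: m_def)
    have norm_eq: "norm (\<Sum>i\<le>N. of_real (w i) * ucis (of_int h * y i)) = norm (\<Sum>i\<le>N. of_real (w i) * ucis (real m * y i))" for N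
    proof (cases "h > 0")
      case True
      thus ?thesis by (simp add: m_def)
    next
      case False
      hence "real_of_int h = - real m" by (simp add: m_def)
      hence "(\<Sum>i\<le>N. of_real (w i) * ucis (of_int h * y i)) = cnj (\<Sum>i\<le>N. of_real (w i) * ucis (real m * y i))"
        by (simp add: cnj_ucis)
      thus ?thesis by (simp only: complex_mod_cnj)
    qed
    have "eventually (\<lambda>N. norm (\<Sum>i\<le>N. of_real (w i) * ucis (real m * y i)) / nth_prime_sum N =
        norm ((\<Sum>i\<le>N. of_real (w i) * ucis (of_int h * y i)) / of_real (nth_prime_sum N))) sequentially"
      using S_pos by eventually_elim (simp add: norm_divide norm_eq)
    thus "(\<lambda>N. norm ((\<Sum>i\<le>N. of_real (w i) * ucis (of_int h * y i)) / of_real (nth_prime_sum N))) \<longlonglongrightarrow> 0"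
      by (rule Lim_transform_eventually[OF weyl_nat[OF m]])
  qed
  \<comment> \<open>The exceptional set for radius parameter \<open>1 / (j + 1)\<close>. Outside all
    of them the lower limit is at most every \<open>1 / (j + 1)\<close>, hence 0.\<close>
  define Z where "Z j = {t \<in> {0..1}. \<not> (\<exists>\<^sub>\<infinity>n. \<bar>t - y n\<bar> < (1 / real (Suc j)) * w n)}" for j
  have "negligible (Z j)" for j
  proof -
    define \<epsilon> where "\<epsilon> = 1 / real (Suc j)"
    have \<epsilon>: "\<epsilon> > 0" by (simp add: \<epsilon>_def)
    \<comment> \<open>If the centres are closer than \<open>\<epsilon> * (w n + w k)\<close>, then
      \<open>x k - x n\<close> is within \<open>2 * \<epsilon> * w n + 2 * w n\<close> of an
      integer, because \<open>w k \<le> w n\<close>.\<close>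
    obtain C n0 where C: "C > 0" and C_le: "\<And>n N. n \<ge> n0 \<Longrightarrow>
        (\<Sum>k | n < k \<and> k \<le> N \<and> int_dist (x k - x n) \<le> (2 * \<epsilon> + 2) / real (nth_prime n). 1 / real (nth_prime k)) \<le>
      C * (1 / real (nth_prime n)) * nth_prime_sum N"
      using pair[of "2 * \<epsilon> + 2"] \<epsilon> by fastforce
    have "negligible {t \<in> {0..1}. \<not> (\<exists>\<^sub>\<infinity>n. \<bar>t - y n\<bar> < \<epsilon> * w n)}"
    proof (rule limsup_balls_full_measure[OF y(1,2) less_imp_le[OF w] w_lim _ _ \<epsilon> C])
      show "filterlim (\<lambda>N. \<Sum>n\<le>N. w n) at_top sequentially"
        using nth_prime_sum_at_top by (simp only: S_eq)
      show "(\<lambda>N. (\<Sum>n\<le>N. of_real (w n) * ucis (of_int h * y n)) / of_real (\<Sum>n\<le>N. w n)) \<longlonglongrightarrow> 0"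
        if "h \<noteq> 0" for h :: int using weyl_int[OF that] by (simp only: S_eq)
      fix n N assume n: "n \<ge> n0"
      have "(\<Sum>k | n < k \<and> k \<le> N \<and> \<bar>y k - y n\<bar> < \<epsilon> * (w n + w k). w k) \<le>
          (\<Sum>k | n < k \<and> k \<le> N \<and> int_dist (x k - x n) \<le> (2 * \<epsilon> + 2) / real (nth_prime n). w k)"
      proof (rule sum_mono2)
        show "{k. n < k \<and> k \<le> N \<and> \<bar>y k - y n\<bar> < \<epsilon> * (w n + w k)} \<subseteq>
            {k. n < k \<and> k \<le> N \<and> int_dist (x k - x n) \<le> (2 * \<epsilon> + 2) / real (nth_prime n)}"
        proof safe
          fix k assume k: "n < k" "k \<le> N" "\<bar>y k - y n\<bar> < \<epsilon> * (w n + w k)"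
          obtain r s where rs: "\<bar>y k - (x k + of_int r)\<bar> \<le> w k" "\<bar>y n - (x n + of_int s)\<bar> \<le> w n"
            using y(3) by blast
          have wk: "w k \<le> w n" using k by (intro w_mono) auto
          have "int_dist (x k - x n) \<le> \<bar>x k - x n - of_int (s - r)\<bar>" by (rule int_dist_le)
          also have "\<dots> \<le> \<bar>y k - y n\<bar> + w k + w n" using rs by (simp add: abs_if split: if_splits)
          also have "\<dots> \<le> \<epsilon> * (w n + w n) + w n + w n"
          proof -
            have "\<epsilon> * (w n + w k) \<le> \<epsilon> * (w n + w n)" using wk \<epsilon> by (intro mult_left_mono) auto
            thus ?thesis using k(3) wk by linarith
          qed
          also have "\<dots> = (2 * \<epsilon> + 2) / real (nth_prime n)" by (simp add: w_def field_simps)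
          finally show "int_dist (x k - x n) \<le> (2 * \<epsilon> + 2) / real (nth_prime n)" .
        qed
      qed (use w in \<open>auto intro: less_imp_le\<close>)
      also have "\<dots> \<le> C * w n * nth_prime_sum N" using C_le[OF n] by (simp add: w_def)
      finally show "(\<Sum>k | n < k \<and> k \<le> N \<and> \<bar>y k - y n\<bar> < \<epsilon> * (w n + w k). w k) \<le> C * w n * (\<Sum>n\<le>N. w n)"
        by (simp only: S_eq)
    qed
    thus ?thesis by (simp add: Z_def \<epsilon>_def)
  qed
  hence neg: "negligible (\<Union>j. Z j)" by (intro negligible_countable_Union) auto
  define L where "L t = Liminf primes_at_top (\<lambda>p. ereal (real p * \<bar>t - real_of_int (a p) / real p\<bar>))" for t
  have L0: "L t = 0" if t: "t \<in> {0..1}" "t \<notin> (\<Union>j. Z j)" for t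
  proof (rule antisym)
    show "0 \<le> L t" unfolding L_def by (intro Liminf_bounded always_eventually) auto
    have bound: "L t \<le> ereal (1 / real (Suc j))" for j
      unfolding L_def Liminf_def
    proof (rule SUP_least)
      fix P assume "P \<in> {P. eventually P primes_at_top}"
      then obtain m where m: "\<And>p. p \<ge> m \<Longrightarrow> prime p \<Longrightarrow> P p" by (auto simp: eventually_primes_at_top)
      have "\<exists>\<^sub>\<infinity>n. \<bar>t - y n\<bar> < (1 / real (Suc j)) * w n" using t by (auto simp: Z_def)
      then obtain n where n: "n \<ge> m" "\<bar>t - y n\<bar> < (1 / real (Suc j)) * w n"
        unfolding INFM_nat_le by blast
      have "P (nth_prime n)" using n(1) nth_prime_ge[of n] by (intro m) auto
      moreover have "real (nth_prime n) * \<bar>t - y n\<bar> \<le> real (nth_prime n) * ((1 / real (Suc j)) * w n)"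
        using n(2) by (intro mult_left_mono) auto
      hence "real (nth_prime n) * \<bar>t - y n\<bar> \<le> 1 / real (Suc j)" by (simp add: w_def)
      ultimately show "(INF p\<in>Collect P. ereal (real p * \<bar>t - real_of_int (a p) / real p\<bar>)) \<le> ereal (1 / real (Suc j))"
        by (intro INF_lower2[of "nth_prime n"]) (auto simp: y_def)
    qed
    have "(\<lambda>j. ereal (1 / real (Suc j))) \<longlonglongrightarrow> ereal 0"
      by (intro tendsto_ereal) real_asymp
    hence "L t \<le> ereal 0"
      by (rule LIMSEQ_le_const) (use bound in blast)
    thus "L t \<le> 0" by (simp add: zero_ereal_def)
  qed
  define A where "A = approximable_points a"
  have A_sub: "A \<subseteq> {0..1}" by (auto simp: A_def approximable_points_def)
  have "{0..1} - A \<subseteq> (\<Union>j. Z j)"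
    using L0 by (auto simp: A_def approximable_points_def L_def)
  \<comment> \<open>Measurability comes from completeness: the complement is a subset of a null
    set.\<close>
  hence null: "{0..1} - A \<in> null_sets lebesgue"
    using neg negligible_subset by (simp add: negligible_iff_null_sets[symmetric])
  have A_eq: "A = {0..1} - ({0..1} - A)" using A_sub by auto
  have "A \<in> sets lebesgue" by (subst A_eq, rule sets.Diff) (use null in \<open>auto simp: null_sets_def\<close>)
  have "emeasure (lebesgue_on {0..1}) A = emeasure lebesgue A"
    using A_sub by (intro emeasure_restrict_space) auto
  also have "\<dots> = emeasure lebesgue {0..1 :: real}"
    by (subst A_eq, rule emeasure_Diff_null_set[OF null]) auto
  also have "\<dots> = 1" by simp
  finally show ?thesis by (simp add: A_def)
qed

text \<open>Each \<open>k\<close> in \<open>A\<close> owns the \<open>D\<close> indices ending at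
  \<open>k\<close>. These blocks are disjoint by separation, and every weight in a block is at least
  \<open>w k\<close>. The condition \<open>n + D \<le> k\<close> keeps the block from being cut off
  at 0.\<close>

lemma separated_decreasing_sum_le:
  fixes w :: "nat \<Rightarrow> real"
  assumes w: "\<And>i. w i \<ge> 0" "\<And>i j. i \<le> j \<Longrightarrow> w j \<le> w i"
    and A: "A \<subseteq> {n<..N}" "\<And>k. k \<in> A \<Longrightarrow> n + D \<le> k"
    and sep: "\<And>k l. k \<in> A \<Longrightarrow> l \<in> A \<Longrightarrow> k < l \<Longrightarrow> k + D \<le> l"
  shows "real D * (\<Sum>k\<in>A. w k) \<le> (\<Sum>i\<le>N. w i)"
proof -
  have finA: "finite A" using A(1) by (rule finite_subset) simp
  have "real D * (\<Sum>k\<in>A. w k) = (\<Sum>k\<in>A. \<Sum>i\<in>{k - D<..k}. w k)"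
  proof -
    have "card {k - D<..k} = D" if "k \<in> A" for k using A(2)[OF that] by simp
    thus ?thesis by (simp add: sum_distrib_left)
  qed
  also have "\<dots> \<le> (\<Sum>k\<in>A. \<Sum>i\<in>{k - D<..k}. w i)"
    by (intro sum_mono w) auto
  also have "\<dots> = (\<Sum>i\<in>(\<Union>k\<in>A. {k - D<..k}). w i)"
  proof (rule sum.UNION_disjoint[symmetric])
    show "\<forall>k\<in>A. \<forall>l\<in>A. k \<noteq> l \<longrightarrow> {k - D<..k} \<inter> {l - D<..l} = {}"
    proof (intro ballI impI)
      fix k l assume kl: "k \<in> A" "l \<in> A" "k \<noteq> l"
      show "{k - D<..k} \<inter> {l - D<..l} = {}"
        using sep[OF kl(1,2)] sep[OF kl(2,1)] kl(3) by (cases k l rule: linorder_cases) auto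
    qed
  qed (use finA in auto)
  also have "\<dots> \<le> (\<Sum>i\<le>N. w i)"
    using A(1) w(1) by (intro sum_mono2) auto
  finally show ?thesis .
qed

text \<open>Here \<open>x i = (i + 1) * \<beta>\<close>. The Weyl sums are even bounded, by partial
  summation against geometric sums. For the pair condition, two indices that are both close to
  \<open>n\<close> modulo 1 are close to each other and hence at least
  \<open>c * P / (2 * K)\<close> apart, so only one weight out of that many is counted.\<close>

lemma emeasure_approximable_points_seq_a:
  assumes bad: "bad_const c \<beta>"
  shows "emeasure (lebesgue_on {0..1}) (approximable_points (seq_a \<beta>)) = 1"
proof (rule approximable_points_full_measure[where x = "\<lambda>i. real (Suc i) * \<beta>"])
  note c = bad_constD[OF bad]
  show "seq_a \<beta> (nth_prime i) = \<lfloor>real (nth_prime i) * (real (Suc i) * \<beta>)\<rfloor> mod int (nth_prime i)" for i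
    unfolding seq_a_def prime_index_nth_prime by (simp only: mult_ac)
  show "(\<lambda>N. norm (\<Sum>i\<le>N. of_real (1 / real (nth_prime i)) * ucis (real h * (real (Suc i) * \<beta>))) / nth_prime_sum N) \<longlonglongrightarrow> 0"
    if h: "h \<ge> 1" for h :: nat
  proof (rule Lim_null_comparison)
    define t where "t = real h * \<beta>"
    have t: "int_dist t > 0" unfolding t_def by (rule c(3)[OF h])
    define B where "B = 1 / int_dist t"
    have "norm (\<Sum>i\<le>N. of_real (1 / real (nth_prime i)) * ucis (real h * (real (Suc i) * \<beta>))) \<le> 1 / real (nth_prime 0) * B" for N
    proof -
      define f where "f i = 1 / real (nth_prime i)" for i
      have f_dec: "f (Suc i) \<le> f i" for i
        unfolding f_def by (intro divide_left_mono mult_pos_pos) auto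
      have "norm (\<Sum>i=0..N. of_real (f i) * ucis (real h * (real (Suc i) * \<beta>))) \<le> f N * B + (\<Sum>i=0..<N. (f i - f (Suc i)) * B)"
      proof (rule norm_abel_decseq_le)
        fix n
        have "(\<Sum>i=0..n. ucis (real h * (real (Suc i) * \<beta>))) = (\<Sum>i<Suc n. ucis t * ucis (real i * t))"
          by (intro sum.cong) (auto simp: t_def algebra_simps simp flip: ucis_add)
        also have "norm \<dots> \<le> B"
          using norm_sum_ucis_le[OF t, of "Suc n"] by (simp only: B_def norm_mult norm_ucis mult_1 flip: sum_distrib_left)
        finally show "norm (\<Sum>i=0..n. ucis (real h * (real (Suc i) * \<beta>))) \<le> B" .
      qed (auto simp: f_dec f_def[of N])
      also have "(\<Sum>i=0..<N. (f i - f (Suc i)) * B) = (f 0 - f N) * B"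
        using sum_Suc_diff'[of 0 N "\<lambda>i. - f i"] by (simp flip: sum_distrib_right)
      finally show ?thesis by (simp add: f_def atLeast0AtMost algebra_simps)
    qed
    note bound = this
    have S_pos: "eventually (\<lambda>N. nth_prime_sum N > 0) at_top"
      using nth_prime_sum_at_top by (simp add: filterlim_at_top_dense)
    show "eventually (\<lambda>N. norm (norm (\<Sum>i\<le>N. of_real (1 / real (nth_prime i)) * ucis (real h * (real (Suc i) * \<beta>))) / nth_prime_sum N) \<le>
        (1 / real (nth_prime 0) * B) / nth_prime_sum N) sequentially"
      using S_pos
    proof eventually_elim
      case (elim N)
      define T where "T = norm (\<Sum>i\<le>N. of_real (1 / real (nth_prime i)) * ucis (real h * (real (Suc i) * \<beta>)))"
      have "T / nth_prime_sum N \<le> (1 / real (nth_prime 0) * B) / nth_prime_sum N"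
        using bound[of N] elim by (intro divide_right_mono) (auto simp only: T_def less_imp_le)
      moreover have "T / nth_prime_sum N \<ge> 0" using elim by (simp add: T_def)
      ultimately show ?case unfolding T_def[symmetric] by simp
    qed
    show "(\<lambda>N. (1 / real (nth_prime 0) * B) / nth_prime_sum N) \<longlonglongrightarrow> 0"
      by (intro tendsto_divide_0[OF tendsto_const] filterlim_at_top_imp_at_infinity nth_prime_sum_at_top)
  qed
  fix K :: real assume K: "K > 0"
  show "\<exists>C>0. \<exists>n0. \<forall>n\<ge>n0. \<forall>N.
      (\<Sum>k | n < k \<and> k \<le> N \<and> int_dist (real (Suc k) * \<beta> - real (Suc n) * \<beta>) \<le> K / real (nth_prime n). 1 / real (nth_prime k)) \<le>
      C * (1 / real (nth_prime n)) * nth_prime_sum N"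
  proof (intro exI[of _ "2 * K / c"] conjI exI[of _ 0] allI impI)
    show "2 * K / c > 0" using K c(1) by simp
    fix n N
    define P where "P = real (nth_prime n)"
    have P: "P > 0" by (simp add: P_def)
    define A where "A = {k. n < k \<and> k \<le> N \<and> int_dist (real (Suc k) * \<beta> - real (Suc n) * \<beta>) \<le> K / P}"
    define D where "D = nat \<lceil>c * P / (2 * K)\<rceil>"
    have D: "real D \<ge> c * P / (2 * K)" unfolding D_def by linarith
    have gap: "k + D \<le> l" if kl: "k < l" and le: "int_dist (real (Suc l) * \<beta> - real (Suc k) * \<beta>) \<le> 2 * K / P" for k l
    proof -
      have "c / \<bar>real (Suc l) - real (Suc k)\<bar> \<le> int_dist (real (Suc l) * \<beta> - real (Suc k) * \<beta>)"
        using kl by (intro bad_const_separated bad) auto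
      hence "c / (real l - real k) \<le> 2 * K / P" using le kl by simp
      hence "c * P / (2 * K) \<le> real l - real k"
        using kl K P by (simp add: field_simps)
      hence "c * P / (2 * K) \<le> of_int (int l - int k)" by simp
      hence "\<lceil>c * P / (2 * K)\<rceil> \<le> int l - int k" by (simp only: ceiling_le_iff)
      thus ?thesis using kl by (simp add: D_def)
    qed
    have "real D * (\<Sum>k\<in>A. 1 / real (nth_prime k)) \<le> (\<Sum>i\<le>N. 1 / real (nth_prime i))"
    proof (rule separated_decreasing_sum_le)
      show "A \<subseteq> {n<..N}" by (auto simp: A_def)
      show "1 / real (nth_prime j) \<le> 1 / real (nth_prime i)" if "i \<le> j" for i j
        using that by (intro divide_left_mono mult_pos_pos) auto
      show "n + D \<le> k" if "k \<in> A" for k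
      proof (rule gap)
        have "int_dist (real (Suc k) * \<beta> - real (Suc n) * \<beta>) \<le> K / P" using that by (simp add: A_def)
        also have "\<dots> \<le> 2 * K / P" using K P by (simp add: divide_right_mono)
        finally show "int_dist (real (Suc k) * \<beta> - real (Suc n) * \<beta>) \<le> 2 * K / P" .
      qed (use that in \<open>simp add: A_def\<close>)
      show "k + D \<le> l" if "k \<in> A" "l \<in> A" "k < l" for k l
      proof (rule gap[OF that(3)])
        have "int_dist (real (Suc l) * \<beta> - real (Suc k) * \<beta>) =
            int_dist ((real (Suc l) * \<beta> - real (Suc n) * \<beta>) + (real (Suc n) * \<beta> - real (Suc k) * \<beta>))" by simp
        also have "\<dots> \<le> int_dist (real (Suc l) * \<beta> - real (Suc n) * \<beta>) + int_dist (real (Suc n) * \<beta> - real (Suc k) * \<beta>)"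
          by (rule int_dist_triangle)
        also have "int_dist (real (Suc n) * \<beta> - real (Suc k) * \<beta>) = int_dist (real (Suc k) * \<beta> - real (Suc n) * \<beta>)"
          by (rule int_dist_minus_commute)
        also have "int_dist (real (Suc l) * \<beta> - real (Suc n) * \<beta>) + int_dist (real (Suc k) * \<beta> - real (Suc n) * \<beta>) \<le> K / P + K / P"
          using that by (intro add_mono) (simp_all add: A_def)
        finally show "int_dist (real (Suc l) * \<beta> - real (Suc k) * \<beta>) \<le> 2 * K / P" by simp
      qed
    qed auto
    moreover have "c * P / (2 * K) * (\<Sum>k\<in>A. 1 / real (nth_prime k)) \<le> real D * (\<Sum>k\<in>A. 1 / real (nth_prime k))"
      by (intro mult_right_mono D sum_nonneg) auto
    ultimately have "c * P / (2 * K) * (\<Sum>k\<in>A. 1 / real (nth_prime k)) \<le> nth_prime_sum N"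
      by (simp add: nth_prime_sum_def)
    hence "(\<Sum>k\<in>A. 1 / real (nth_prime k)) \<le> nth_prime_sum N / (c * P / (2 * K))"
      using c(1) P K by (subst pos_le_divide_eq) (auto simp: mult.commute)
    also have "\<dots> = 2 * K / c * (1 / P) * nth_prime_sum N" by simp
    finally show "(\<Sum>k | n < k \<and> k \<le> N \<and> int_dist (real (Suc k) * \<beta> - real (Suc n) * \<beta>) \<le> K / real (nth_prime n). 1 / real (nth_prime k)) \<le>
      2 * K / c * (1 / real (nth_prime n)) * nth_prime_sum N"
      unfolding A_def P_def .
  qed
qed

text \<open>Here \<open>x i = \<beta> * p\<close> with \<open>p = nth_prime i\<close>. The Weyl sum
  of frequency \<open>h\<close> is an exponential sum over primes for \<open>h * \<beta>\<close>,
  which is badly approximable with constant \<open>c / h\<close>; the pair condition is the sieve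
  bound, transported along \<open>nth_prime\<close>.\<close>

lemma emeasure_approximable_points_seq_b:
  assumes bad: "bad_const c \<beta>"
  shows "emeasure (lebesgue_on {0..1}) (approximable_points (seq_b \<beta>)) = 1"
proof (rule approximable_points_full_measure[where x = "\<lambda>i. \<beta> * real (nth_prime i)"])
  show "seq_b \<beta> (nth_prime i) = \<lfloor>real (nth_prime i) * (\<beta> * real (nth_prime i))\<rfloor> mod int (nth_prime i)" for i
    unfolding seq_b_def power2_eq_square by (simp only: mult_ac)
  show "(\<lambda>N. norm (\<Sum>i\<le>N. of_real (1 / real (nth_prime i)) * ucis (real h * (\<beta> * real (nth_prime i)))) / nth_prime_sum N) \<longlonglongrightarrow> 0"
    if h: "h \<ge> 1" for h :: nat
  proof -
    have "(\<Sum>p | p \<in> {1..nth_prime N} \<and> prime p. of_real (1 / real p) * ucis (real p * (real h * \<beta>))) =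
        (\<Sum>i\<le>N. of_real (1 / real (nth_prime i)) * ucis (real h * (\<beta> * real (nth_prime i))))" for N
      unfolding primes_le_nth_prime
      by (subst sum.reindex) (auto intro: inj_on_subset[OF inj_nth_prime] simp: mult_ac)
    thus ?thesis
      using filterlim_compose[OF prime_weighted_exp_sum_smallo[OF bad_const_mult[OF bad h]] filterlim_nth_prime]
      by (simp only: nth_prime_sum_eq)
  qed
  fix K :: real assume K: "K > 0"
  obtain C p0 where C: "C > 0" "\<And>p N. p \<ge> p0 \<Longrightarrow>
     (\<Sum>q | prime q \<and> p < q \<and> q \<le> N \<and> int_dist (\<beta> * (real q - real p)) \<le> K / real p. 1 / real q) \<le>
     C * (1 / real p) * (\<Sum>q | q \<in> {1..N} \<and> prime q. 1 / real q)"
    using prime_bohr_sum_le[OF bad K] by blast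
  show "\<exists>C>0. \<exists>n0. \<forall>n\<ge>n0. \<forall>N.
      (\<Sum>k | n < k \<and> k \<le> N \<and> int_dist (\<beta> * real (nth_prime k) - \<beta> * real (nth_prime n)) \<le> K / real (nth_prime n). 1 / real (nth_prime k)) \<le>
      C * (1 / real (nth_prime n)) * nth_prime_sum N"
  proof (intro exI[of _ C] conjI C(1) exI[of _ p0] allI impI)
    fix n N assume "n \<ge> p0"
    hence n: "nth_prime n \<ge> p0" using nth_prime_ge[of n] by linarith
    have "(\<Sum>k | n < k \<and> k \<le> N \<and> int_dist (\<beta> * real (nth_prime k) - \<beta> * real (nth_prime n)) \<le> K / real (nth_prime n). 1 / real (nth_prime k)) =
        (\<Sum>q\<in>nth_prime ` {k. n < k \<and> k \<le> N \<and> int_dist (\<beta> * real (nth_prime k) - \<beta> * real (nth_prime n)) \<le> K / real (nth_prime n)}. 1 / real q)"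
      by (subst sum.reindex) (auto intro: inj_on_subset[OF inj_nth_prime])
    also have "nth_prime ` {k. n < k \<and> k \<le> N \<and> int_dist (\<beta> * real (nth_prime k) - \<beta> * real (nth_prime n)) \<le> K / real (nth_prime n)} =
        {q. prime q \<and> nth_prime n < q \<and> q \<le> nth_prime N \<and> int_dist (\<beta> * (real q - real (nth_prime n))) \<le> K / real (nth_prime n)}"
      by (auto simp: right_diff_distrib dest!: ex_nth_prime)
    also have "(\<Sum>q | prime q \<and> nth_prime n < q \<and> q \<le> nth_prime N \<and> int_dist (\<beta> * (real q - real (nth_prime n))) \<le> K / real (nth_prime n). 1 / real q) \<le>
        C * (1 / real (nth_prime n)) * (\<Sum>q | q \<in> {1..nth_prime N} \<and> prime q. 1 / real q)"
      by (rule C(2)[OF n])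
    finally show "(\<Sum>k | n < k \<and> k \<le> N \<and> int_dist (\<beta> * real (nth_prime k) - \<beta> * real (nth_prime n)) \<le> K / real (nth_prime n). 1 / real (nth_prime k)) \<le>
      C * (1 / real (nth_prime n)) * nth_prime_sum N"
      by (simp only: nth_prime_sum_eq prime_recip_sum_def)
  qed
qed

theorem theorem1p4:
  fixes \<beta> :: real
  assumes "\<beta> > 0" and "badly_approximable \<beta>"
  shows "emeasure (lebesgue_on {0..1}) (approximable_points (seq_a \<beta>)) = 1 \<and>
         emeasure (lebesgue_on {0..1}) (approximable_points (seq_b \<beta>)) = 1"
  using badly_approximable_imp_bad_const[OF assms(2)]
    emeasure_approximable_points_seq_a emeasure_approximable_points_seq_b by blast

end
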